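(* Let $n=2r+1$ with $r\ge1$ and $a\in\mathbb C^*$. The representation $V\begin{pmatrix}\boxed{1}\\ \vdots\\ \boxed{r+1}\end{pmatrix}_a$ is isomorphic to the extremal fundamental loop weight module $V(e^{\varpi_{r+1}}Y_{r+1,aq^{-r-2}}Y_{0,aq^{-1}}^{-1})$. In particular, $V\begin{pmatrix}\boxed{1}\\ \vdots\\ \boxed{r+1}\end{pmatrix}_a$ is $\ell$-extremal (that is, it is an extremal loop weight module) of $\ell$-weight $e^{\varpi_{r+1}}Y_{r+1,aq^{-r-2}}Y_{0,aq^{-1}}^{-1}$.
   Context: Here $n=2r+1$, $r\ge1$. $I=\{0,\dots,n\}$ is identified with $\mathbb Z/(n+1)\mathbb Z$ ($\bar j$ is the class of $j\in\mathbb Z$); $C=(C_{i,j})_{i,j\in I}$ is the Cartan matrix of type $A_n^{(1)}$ ($C_{i,i}=2$, $C_{i,i\pm1}=-1$, $C_{i,j}=0$ otherwise). Fix $t\in\mathbb C$ such that $q=e^t$ is not a root of unity; $[l]_q=\frac{q^l-q^{-l}}{q-q^{-1}}$, $[s]_q!=[s]_q\cdots[1]_q$. $\mathfrak h=\mathbb Qh_0\oplus\dots\oplus\mathbb Qh_n\oplus\mathbb Qd$; $\alpha_i,\Lambda_i\in\mathfrak h^*$: $\alpha_i(h_j)=C_{j,i}$, $\alpha_i(d)=\delta_{0,i}$, $\Lambda_i(h_j)=\delta_{i,j}$, $\Lambda_i(d)=0$; $P=\{\lambda\in\mathfrak h^*:\lambda(h_i)\in\mathbb Z\ \forall i\}$;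 $\varpi_\ell=\Lambda_\ell-\Lambda_0$ for $1\le\ell\le n$. $\mathcal U_q(sl_{n+1}^{tor})$ is the $\mathbb C$-algebra with generators $x_{i,s}^\pm$ ($i\in I,s\in\mathbb Z$), $k_h$ ($h\in\mathfrak h$), $h_{i,m}$ ($i\in I$, $m\in\mathbb Z\setminus\{0\}$). Put $x_i^\pm(z)=\sum_{s\in\mathbb Z}x_{i,s}^\pm z^s$, $\delta(z)=\sum_{s\in\mathbb Z}z^s$, $k_i^{\pm1}=k_{\pm h_i}$, $\phi_i^\pm(z)=\sum_{m\ge0}\phi^\pm_{i,\pm m}z^{\pm m}=k_i^{\pm1}\exp(\pm(q-q^{-1})\sum_{m\ge1}h_{i,\pm m}z^{\pm m})$. Relations: $k_hk_{h'}=k_{h+h'}$, $k_0=1$; $\phi_i^\pm(z)\phi_j^\pm(w)=\phi_j^\pm(w)\phi_i^\pm(z)$, $\phi_i^-(z)\phi_j^+(w)=\phi_j^+(w)\phi_i^-(z)$; $(w-q^{\pm C_{ij}}z)\phi_i^{\epsilon}(z)x_j^\pm(w)=(q^{\pm C_{ij}}w-z)x_j^\pm(w)\phi_i^{\epsilon}(z)$ for $\epsilon=+,-$; $[x_i^+(z),x_j^-(w)]=\frac{\delta_{i,j}}{q-q^{-1}}(\delta(\frac wz)\phi_i^+(w)-\delta(\frac zw)\phi_i^-(z))$; $(z-q^{\pm C_{ij}}w)x_i^\pm(z)x_j^\pm(w)=(q^{\pm C_{ij}}z-w)x_j^\pm(w)x_i^\pm(z)$; for $j=i\pm1$: $x_i^\pm(z_1)x_i^\pm(z_2)x_j^\pm(w)-(q+q^{-1})x_i^\pm(z_1)x_j^\pm(w)x_i^\pm(z_2)+x_j^\pm(w)x_i^\pm(z_1)x_i^\pm(z_2)+(z_1\leftrightarrow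 z_2)=0$; $[x_i^\pm(z),x_j^\pm(w)]=0$ for $i\ne j,j+1,j-1$. Let $\psi(z)=\frac{q-q^{-1}z}{1-z}$; rational functions describing $\phi_i^+$ (resp. $\phi_i^-$) are expanded at $z=0$ (resp. $z=\infty$). Monomials are $m=e^{\omega}\prod_{i\in I,c\in\mathbb C^*}Y_{i,c}^{u_{i,c}}$ (finite product, $\omega\in P$, $\sum_cu_{i,c}=\omega(h_i)$). For $b\in\mathbb C^*$, the vector representation $V(\boxed1_b)$ is the extremal loop weight module of $\ell$-weight $e^{\varpi_1}Y_{1,b}Y_{0,bq}^{-1}$ (see below for the definition) with basis $\boxed{j}_b$, $j\in\mathbb Z$, and action $x_i^+(z)\boxed j_b=\delta_{i,\overline{j-1}}\,\delta(bq^{j-1}z)\boxed{j-1}_b$, $x_i^-(z)\boxed j_b=\delta_{i,\bar j}\,\delta(bq^jz)\boxed{j+1}_b$, $\phi_i^\pm(z)\boxed j_b=\psi(bq^jz)\boxed j_b$ if $i=\bar j$, $=\psi(bq^{j+1}z)^{-1}\boxed j_b$ if $i=\overline{j-1}$, $=\boxed j_b$ otherwise. Drinfeld coproduct: $\Delta_D(x_i^+(z))=x_i^+(z)\otimes1+\phi_i^-(z)\otimes x_i^+(z)$, $\Delta_D(x_i^-(z))=x_i^-(z)\otimes\phi_i^+(z)+1\otimes x_i^-(z)$, $\Delta_D(\phi_i^\pm(z))=\phi_i^\pm(z)\otimes\phi_i^\pm(z)$, $\Delta_D(k_h)=k_h\otimes k_h$, iterated for several factors. It involves infinite sums; it defines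 an action on a space of tensors when these sums are well-defined there. $\tilde V_a$ is the vector subspace of $V(\boxed1_a)\otimes V(\boxed1_{aq^{-2}})\otimes\cdots\otimes V(\boxed1_{aq^{-2r}})$ spanned by the vectors $\boxed{i_1}_a\otimes\boxed{i_2}_{aq^{-2}}\otimes\cdots\otimes\boxed{i_{r+1}}_{aq^{-2r}}$ with $i_1<i_2<\cdots<i_{r+1}$; it is a $\mathcal U_q(sl_{n+1}^{tor})$-module via $\Delta_D$. $V\begin{pmatrix}\boxed1\\ \vdots\\ \boxed{r+1}\end{pmatrix}_a\subset\tilde V_a$ is the span of those vectors with moreover $i_{r+1}-i_1\le n$; it is a module with $x_i^\pm(z),\phi_i^\pm(z)$ acting by $\mathrm{pr}\circ\Delta_D(x_i^\pm(z))$, $\mathrm{pr}\circ\Delta_D(\phi_i^\pm(z))$, where $\mathrm{pr}$ is the projection of $\tilde V_a$ killing the remaining spanning vectors. Put $A_{i,c}=e^{\alpha_i}Y_{i,cq^{-1}}Y_{i,cq}Y_{i-1,c}^{-1}Y_{i+1,c}^{-1}$. For $c_0\in\mathbb C^*$, the extremal fundamental loop weight module $V(e^{\varpi_{r+1}}Y_{r+1,c_0}Y_{0,c_0q^{r+1}}^{-1})$ is the irreducible and thin extremal loop weight module of that $\ell$-weight constructed from the monomial realization of the crystal basis of the extremal weight module $V(\varpi_{r+1})$ of the quantum affine algebra $\mathcal U_q(\hat{sl}_{n+1})$. It has a basis $(v_m)_{m\in\mathcal M}$, where $\mathcal M$ is the smallest set of monomials containing $e^{\varpi_{r+1}}Y_{r+1,c_0}Y_{0,c_0q^{r+1}}^{-1}$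 and stable under $m\mapsto mA_{i,cq}^{-1}$ whenever $u_{i,c}(m)=1$ and $m\mapsto mA_{i,cq^{-1}}$ whenever $u_{i,c}(m)=-1$ (for $m\in\mathcal M$ and $i\in I$ at most one $u_{i,c}(m)$ is nonzero, and it is $\pm1$). The action is $x_i^-(z)v_m=\delta(cqz)v_{mA_{i,cq}^{-1}}$ if $u_{i,c}(m)=1$ and $0$ if there is no such $c$; $x_i^+(z)v_m=\delta(cq^{-1}z)v_{mA_{i,cq^{-1}}}$ if $u_{i,c}(m)=-1$ and $0$ if there is no such $c$; $\phi_i^\pm(z)v_m=\prod_c\psi(cqz)^{u_{i,c}(m)}v_m$; $k_hv_m=q^{\omega(m)(h)}v_m$. Integrable module: direct sum of its weight spaces $V_\lambda=\{v:k_hv=q^{\lambda(h)}v\ \forall h\}$, $\lambda\in P$, with all $x_{i,0}^\pm$ acting locally nilpotently. For a monomial $m$, $V_m$ is the subspace of $V_\omega$ on which the $\phi^\pm_{i,\pm s}$ act with generalized eigenvalues the coefficients of the expansions of $\prod_c\psi(cqz)^{u_{i,c}}$. A module is thin if the subalgebra generated by the $k_h$ and $h_{i,m}$ acts by diagonalizable operators with simple joint spectrum. A vector $w$ of weight $\lambda$ is $i$-extremal if $x_{i,0}^{\pm}w=0$ when $\pm\lambda(h_i)\ge0$; then $S_i(w)=\frac{(x_{i,0}^\mp)^{\pm\lambda(h_i)}}{[\pm\lambda(h_i)]_q!}w$. It is extremal for the horizontal subalgebra (generated by the $x_{i,0}^\pm$, $k_h$) if every $S_{i_1}\circ\cdots\circ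 S_{i_l}(w)$ ($l\ge0$) is $i$-extremal for every $i$. An extremal loop weight module of $\ell$-weight $m$ is an integrable module $V$ with a $v\in V_m$ such that (i) $v$ generates $V$; (ii) $v$ is extremal for the horizontal subalgebra; (iii) for each $j\in I$ and $w\in V$, $\mathcal U_q^{v,j}(sl_{n+1}^{tor})\cdot w$ is finite-dimensional, where $\mathcal U_q^{v,j}(sl_{n+1}^{tor})$ is the subalgebra generated by $x_{i,s}^\pm,h_{i,m}$ ($i\ne j$) and $k_h$, $h\in\bigoplus_{i\ne j}\mathbb Qh_i$.
   Formalization: As printed the weights are off by δ: Y_{r+1,aq^{-r-2}}Y_{0,aq^{-1}}^{-1} occurs only at weight ϖ_{r+1}+δ, so isomorphism and ℓ-weight are proved up to a δ-shift of k_d; the x–x quadratic relation has z and w exchanged in its factors, since the printed form fails on the vector representation. *)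

theory Defs
  imports Complex_Main
    "HOL-Library.Poly_Mapping"
    "HOL-Library.Product_Plus"
    "HOL-Computational_Algebra.Formal_Power_Series"
begin

section \<open>Complex vector spaces\<close>

class complex_vs = ab_group_add +
  fixes scaleC :: "complex \<Rightarrow> 'a \<Rightarrow> 'a"  (infixr \<open>*\<^sub>C\<close> 75)
  assumes scaleC_add_right: "c *\<^sub>C (x + y) = c *\<^sub>C x + c *\<^sub>C y"
    and scaleC_add_left: "(c + d) *\<^sub>C x = c *\<^sub>C x + d *\<^sub>C x"
    and scaleC_scaleC: "c *\<^sub>C d *\<^sub>C x = (c * d) *\<^sub>C x"
    and scaleC_one: "1 *\<^sub>C x = x"

interpretation cvs: vector_space "scaleC :: complex \<Rightarrow> 'a::complex_vs \<Rightarrow> 'a"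
  by standard (simp_all add: scaleC_add_right scaleC_add_left scaleC_scaleC scaleC_one)

instantiation complex :: complex_vs
begin
definition scaleC_complex :: "complex \<Rightarrow> complex \<Rightarrow> complex" where
  "scaleC_complex = (*)"
instance
  by standard (simp_all add: scaleC_complex_def algebra_simps)
end

text \<open>\<open>'b \<Rightarrow>\<^sub>0 complex\<close> is the vector space with basis \<open>'b\<close>; the basis vector of \<open>b\<close> is
  \<open>Poly_Mapping.single b 1\<close>.\<close>

instantiation poly_mapping :: (type, complex_vs) complex_vs
begin
definition scaleC_poly_mapping :: "complex \<Rightarrow> ('a \<Rightarrow>\<^sub>0 'b) \<Rightarrow> ('a \<Rightarrow>\<^sub>0 'b)" where
  "scaleC_poly_mapping c = Poly_Mapping.map (scaleC c)"
instance proof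
  have [simp]: "Poly_Mapping.lookup (c *\<^sub>C p) k = c *\<^sub>C Poly_Mapping.lookup p k"
    for c k and p :: "'a \<Rightarrow>\<^sub>0 'b"
    unfolding scaleC_poly_mapping_def
    by (cases "Poly_Mapping.lookup p k = 0") (simp_all add: Poly_Mapping.map.rep_eq)
  show "c *\<^sub>C (p + p') = c *\<^sub>C p + c *\<^sub>C p'" "(c + d) *\<^sub>C p = c *\<^sub>C p + d *\<^sub>C p"
    "c *\<^sub>C d *\<^sub>C p = (c * d) *\<^sub>C p" "1 *\<^sub>C p = p"
    for c d and p p' :: "'a \<Rightarrow>\<^sub>0 'b"
    by (intro poly_mapping_eqI; simp add: lookup_add cvs.scale_right_distrib
        cvs.scale_left_distrib)+
qed
end

definition linear_on :: "'v::complex_vs set \<Rightarrow> 'w::complex_vs set \<Rightarrow> ('v \<Rightarrow> 'w) \<Rightarrow> bool" where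
  "linear_on V W f \<longleftrightarrow> (\<forall>v\<in>V. f v \<in> W) \<and>
     (\<forall>v\<in>V. \<forall>w\<in>V. f (v + w) = f v + f w) \<and> (\<forall>c. \<forall>v\<in>V. f (c *\<^sub>C v) = c *\<^sub>C f v)"

definition lin_ext :: "('b \<Rightarrow> 'v::complex_vs) \<Rightarrow> ('b \<Rightarrow>\<^sub>0 complex) \<Rightarrow> 'v" where
  "lin_ext f p = (\<Sum>b\<in>Poly_Mapping.keys p. Poly_Mapping.lookup p b *\<^sub>C f b)"

definition basis_vec :: "'b \<Rightarrow> ('b \<Rightarrow>\<^sub>0 complex)" where
  "basis_vec b = Poly_Mapping.single b 1"


section \<open>Cartan data of type $A_n^{(1)}$\<close>

text \<open>The residue class of $j$ is represented by \<open>j mod (int n + 1)\<close>, an element of $I$.\<close>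

definition I :: "nat \<Rightarrow> int set" where
  "I n = {0..int n}"

definition cls :: "nat \<Rightarrow> int \<Rightarrow> int" where
  "cls n j = j mod (int n + 1)"

definition adjacent :: "nat \<Rightarrow> int \<Rightarrow> int \<Rightarrow> bool" where
  "adjacent n i j \<longleftrightarrow> j = cls n (i + 1) \<or> j = cls n (i - 1)"

definition cartan :: "nat \<Rightarrow> int \<Rightarrow> int \<Rightarrow> int" where
  "cartan n i j = (if i = j then 2 else if adjacent n i j then -1 else 0)"

text \<open>An element of $\mathfrak h$ is given by its coordinates in the basis $h_0,\dots,h_n,d$,
  an element of $\mathfrak h^*$ by its values on that basis.\<close>

datatype cartan_basis = H int | D

definition hbasis :: "nat \<Rightarrow> cartan_basis set" where
  "hbasis n = insert D (H ` I n)"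

definition \<hh> :: "nat \<Rightarrow> (cartan_basis \<Rightarrow>\<^sub>0 rat) set" where
  "\<hh> n = {h. Poly_Mapping.keys h \<subseteq> hbasis n}"

definition hh :: "int \<Rightarrow> (cartan_basis \<Rightarrow>\<^sub>0 rat)" where
  "hh i = Poly_Mapping.single (H i) 1"

type_synonym weight = "cartan_basis \<Rightarrow>\<^sub>0 rat"

definition pairing :: "weight \<Rightarrow> (cartan_basis \<Rightarrow>\<^sub>0 rat) \<Rightarrow> rat" where
  "pairing \<mu> h = (\<Sum>b\<in>Poly_Mapping.keys h. Poly_Mapping.lookup \<mu> b * Poly_Mapping.lookup h b)"

definition \<alpha> :: "nat \<Rightarrow> int \<Rightarrow> weight" where
  "\<alpha> n i = (\<Sum>j\<in>I n. Poly_Mapping.single (H j) (of_int (cartan n j i)))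
     + Poly_Mapping.single D (if i = 0 then 1 else 0)"

definition \<Lambda> :: "int \<Rightarrow> weight" where
  "\<Lambda> i = Poly_Mapping.single (H i) 1"

definition varpi :: "int \<Rightarrow> weight" where
  "varpi l = \<Lambda> l - \<Lambda> 0"

text \<open>$\delta(h_i) = 0$ for all $i$ and $\delta(d) = 1$.\<close>

definition \<delta> :: "nat \<Rightarrow> weight" where
  "\<delta> n = (\<Sum>i\<in>I n. \<alpha> n i)"

definition weight_lattice :: "nat \<Rightarrow> weight set" where
  "weight_lattice n = {\<mu>. Poly_Mapping.keys \<mu> \<subseteq> hbasis n \<and> (\<forall>i\<in>I n. pairing \<mu> (hh i) \<in> \<int>)}"

text \<open>$q^x$ for $q = e^t$ and rational $x$.\<close>

definition qpow :: "complex \<Rightarrow> rat \<Rightarrow> complex" where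
  "qpow t x = exp (t * of_rat x)"

definition qint :: "complex \<Rightarrow> nat \<Rightarrow> complex" where
  "qint q l = (q ^ l - inverse q ^ l) / (q - inverse q)"

definition qfact :: "complex \<Rightarrow> nat \<Rightarrow> complex" where
  "qfact q s = (\<Prod>l=1..s. qint q l)"


section \<open>Modules over the quantum toroidal algebra\<close>

text \<open>The algebra is given by generators and relations, so a module is a vector space with one
  operator for each generator, satisfying the relations. The underlying space is a subspace of a
  type; the values of the operators outside it are irrelevant, as are those of \<open>xop\<close>, \<open>hop\<close> at
  indices not in $I$ and of \<open>hop\<close> at \<open>m = 0\<close>.\<close>

datatype sign = Pos | Neg

fun sg :: "sign \<Rightarrow> int" where
  "sg Pos = 1"
| "sg Neg = -1"

record 'v tor =
  space :: "'v set"
  xop :: "sign \<Rightarrow> int \<Rightarrow> int \<Rightarrow> 'v \<Rightarrow> 'v"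
  hop :: "int \<Rightarrow> int \<Rightarrow> 'v \<Rightarrow> 'v"
  kop :: "(cartan_basis \<Rightarrow>\<^sub>0 rat) \<Rightarrow> 'v \<Rightarrow> 'v"

text \<open>\<open>series_power b l m\<close> is the coefficient of $z^m$ in $(\sum_{k\ge1} b_k z^k)^l$ and
  \<open>series_exp b m\<close> the one in the exponential; only the powers $l \le m$ contribute to it.\<close>

fun series_power :: "(nat \<Rightarrow> 'v \<Rightarrow> 'v) \<Rightarrow> nat \<Rightarrow> nat \<Rightarrow> 'v \<Rightarrow> 'v::complex_vs" where
  "series_power b 0 m v = (if m = 0 then v else 0)"
| "series_power b (Suc l) m v = (\<Sum>k=1..m. b k (series_power b l (m - k) v))"

definition series_exp :: "(nat \<Rightarrow> 'v \<Rightarrow> 'v) \<Rightarrow> nat \<Rightarrow> 'v \<Rightarrow> 'v::complex_vs" where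
  "series_exp b m v = (\<Sum>l\<le>m. (1 / fact l) *\<^sub>C series_power b l m v)"

text \<open>\<open>phi q M \<epsilon> i s\<close> is the coefficient of $z^s$ in $\phi_i^\epsilon(z)$, for every integer $s$.\<close>

definition phi :: "complex \<Rightarrow> 'v::complex_vs tor \<Rightarrow> sign \<Rightarrow> int \<Rightarrow> int \<Rightarrow> 'v \<Rightarrow> 'v" where
  "phi q M \<epsilon> i s v =
     (if sg \<epsilon> * s \<ge> 0
      then kop M (case \<epsilon> of Pos \<Rightarrow> hh i | Neg \<Rightarrow> - hh i)
        (series_exp (\<lambda>m w. (of_int (sg \<epsilon>) * (q - inverse q)) *\<^sub>C hop M i (sg \<epsilon> * int m) w)
          (nat \<bar>s\<bar>) v)
      else 0)"

text \<open>The relations are the identities between the coefficients of $z^a w^b$ (of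
  $z_1^a z_2^b w^c$ for the Serre relations) in the generating series.\<close>

definition rel_k :: "nat \<Rightarrow> 'v::complex_vs tor \<Rightarrow> bool" where
  "rel_k n M \<longleftrightarrow> (\<forall>v\<in>space M. kop M 0 v = v \<and>
     (\<forall>h\<in>\<hh> n. \<forall>h'\<in>\<hh> n. kop M h (kop M h' v) = kop M (h + h') v))"

definition rel_phi_phi :: "nat \<Rightarrow> complex \<Rightarrow> 'v::complex_vs tor \<Rightarrow> bool" where
  "rel_phi_phi n q M \<longleftrightarrow> (\<forall>v\<in>space M. \<forall>i\<in>I n. \<forall>j\<in>I n. \<forall>\<epsilon> \<epsilon>' a b.
     phi q M \<epsilon> i a (phi q M \<epsilon>' j b v) = phi q M \<epsilon>' j b (phi q M \<epsilon> i a v))"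

definition rel_phi_x :: "nat \<Rightarrow> complex \<Rightarrow> 'v::complex_vs tor \<Rightarrow> bool" where
  "rel_phi_x n q M \<longleftrightarrow> (\<forall>v\<in>space M. \<forall>i\<in>I n. \<forall>j\<in>I n. \<forall>\<epsilon> \<sigma> a b.
     phi q M \<epsilon> i a (xop M \<sigma> j (b - 1) v)
       - (q powi (sg \<sigma> * cartan n i j)) *\<^sub>C phi q M \<epsilon> i (a - 1) (xop M \<sigma> j b v)
     = (q powi (sg \<sigma> * cartan n i j)) *\<^sub>C xop M \<sigma> j (b - 1) (phi q M \<epsilon> i a v)
       - xop M \<sigma> j b (phi q M \<epsilon> i (a - 1) v))"

definition rel_x_x_opposite :: "nat \<Rightarrow> complex \<Rightarrow> 'v::complex_vs tor \<Rightarrow> bool" where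
  "rel_x_x_opposite n q M \<longleftrightarrow> (\<forall>v\<in>space M. \<forall>i\<in>I n. \<forall>j\<in>I n. \<forall>a b.
     xop M Pos i a (xop M Neg j b v) - xop M Neg j b (xop M Pos i a v)
     = (if i = j then (1 / (q - inverse q)) *\<^sub>C (phi q M Pos i (a + b) v - phi q M Neg i (a + b) v)
        else 0))"

text \<open>$(w - q^{\pm C_{ij}}z)\,x_i^\pm(z)x_j^\pm(w) = (q^{\pm C_{ij}}w - z)\,x_j^\pm(w)x_i^\pm(z)$, with
  the same factors as in the relation between $\phi$ and $x$. For series normalised as
  $x(z) = \sum_s x_s z^s$ this is the form that holds in the vector representation; with the roles
  of $z$ and $w$ in the factors exchanged, $(z - q^{\pm C_{ij}}w)$ and $(q^{\pm C_{ij}}z - w)$, it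
  is the relation for $\sum_s x_s z^{-s}$.\<close>

definition rel_x_x :: "nat \<Rightarrow> complex \<Rightarrow> 'v::complex_vs tor \<Rightarrow> bool" where
  "rel_x_x n q M \<longleftrightarrow> (\<forall>v\<in>space M. \<forall>i\<in>I n. \<forall>j\<in>I n. \<forall>\<sigma> a b.
     xop M \<sigma> i a (xop M \<sigma> j (b - 1) v)
       - (q powi (sg \<sigma> * cartan n i j)) *\<^sub>C xop M \<sigma> i (a - 1) (xop M \<sigma> j b v)
     = (q powi (sg \<sigma> * cartan n i j)) *\<^sub>C xop M \<sigma> j (b - 1) (xop M \<sigma> i a v)
       - xop M \<sigma> j b (xop M \<sigma> i (a - 1) v))"

definition serre_term ::
  "complex \<Rightarrow> 'v::complex_vs tor \<Rightarrow> sign \<Rightarrow> int \<Rightarrow> int \<Rightarrow> int \<Rightarrow> int \<Rightarrow> int \<Rightarrow> 'v \<Rightarrow> 'v" where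
  "serre_term q M \<sigma> i j a b c v =
     xop M \<sigma> i a (xop M \<sigma> i b (xop M \<sigma> j c v))
     - (q + inverse q) *\<^sub>C xop M \<sigma> i a (xop M \<sigma> j c (xop M \<sigma> i b v))
     + xop M \<sigma> j c (xop M \<sigma> i a (xop M \<sigma> i b v))"

definition rel_serre :: "nat \<Rightarrow> complex \<Rightarrow> 'v::complex_vs tor \<Rightarrow> bool" where
  "rel_serre n q M \<longleftrightarrow> (\<forall>v\<in>space M. \<forall>i\<in>I n. \<forall>j\<in>I n. adjacent n i j \<longrightarrow> (\<forall>\<sigma> a b c.
     serre_term q M \<sigma> i j a b c v + serre_term q M \<sigma> i j b a c v = 0))"

definition rel_x_commute :: "nat \<Rightarrow> 'v::complex_vs tor \<Rightarrow> bool" where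
  "rel_x_commute n M \<longleftrightarrow> (\<forall>v\<in>space M. \<forall>i\<in>I n. \<forall>j\<in>I n. i \<noteq> j \<and> \<not> adjacent n i j \<longrightarrow> (\<forall>\<sigma> a b.
     xop M \<sigma> i a (xop M \<sigma> j b v) = xop M \<sigma> j b (xop M \<sigma> i a v)))"

definition tor_module :: "nat \<Rightarrow> complex \<Rightarrow> 'v::complex_vs tor \<Rightarrow> bool" where
  "tor_module n q M \<longleftrightarrow>
     cvs.subspace (space M) \<and>
     (\<forall>\<sigma>. \<forall>i\<in>I n. \<forall>s. linear_on (space M) (space M) (xop M \<sigma> i s)) \<and>
     (\<forall>i\<in>I n. \<forall>m. m \<noteq> 0 \<longrightarrow> linear_on (space M) (space M) (hop M i m)) \<and>
     (\<forall>h\<in>\<hh> n. linear_on (space M) (space M) (kop M h)) \<and>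
     rel_k n M \<and> rel_phi_phi n q M \<and> rel_phi_x n q M \<and> rel_x_x_opposite n q M \<and>
     rel_x_x n q M \<and> rel_serre n q M \<and> rel_x_commute n M"

definition tor_iso :: "nat \<Rightarrow> 'v::complex_vs tor \<Rightarrow> 'w::complex_vs tor \<Rightarrow> bool" where
  "tor_iso n M N \<longleftrightarrow> (\<exists>f. linear_on (space M) (space N) f \<and> bij_betw f (space M) (space N) \<and>
     (\<forall>v\<in>space M.
       (\<forall>\<sigma>. \<forall>i\<in>I n. \<forall>s. f (xop M \<sigma> i s v) = xop N \<sigma> i s (f v)) \<and>
       (\<forall>i\<in>I n. \<forall>m. m \<noteq> 0 \<longrightarrow> f (hop M i m v) = hop N i m (f v)) \<and>
       (\<forall>h\<in>\<hh> n. f (kop M h v) = kop N h (f v))))"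

text \<open>The module $M$ with $k_h$ replaced by $q^{c\,\delta(h)} k_h$; this changes $k_d$, but none of
  the operators $k_h$ with $h \in \bigoplus_i \mathbb Q h_i$, $x_{i,s}^\pm$, $h_{i,m}$.\<close>

definition grade_shift :: "nat \<Rightarrow> complex \<Rightarrow> rat \<Rightarrow> 'v::complex_vs tor \<Rightarrow> 'v tor" where
  "grade_shift n t c M = M\<lparr>kop := \<lambda>h v. qpow t (c * pairing (\<delta> n) h) *\<^sub>C kop M h v\<rparr>"


section \<open>Monomials\<close>

text \<open>The group of monomials is written additively: \<open>(\<omega>, u)\<close> stands for
  $e^\omega \prod_{i,c} Y_{i,c}^{u_{i,c}}$.\<close>

type_synonym mono = "weight \<times> (int \<times> complex \<Rightarrow>\<^sub>0 int)"

definition u_exp :: "mono \<Rightarrow> int \<Rightarrow> complex \<Rightarrow> int" where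
  "u_exp m i c = Poly_Mapping.lookup (snd m) (i, c)"

definition monomials :: "nat \<Rightarrow> mono set" where
  "monomials n = {m. fst m \<in> weight_lattice n \<and> Poly_Mapping.keys (snd m) \<subseteq> I n \<times> (- {0}) \<and>
     (\<forall>i\<in>I n. of_int (\<Sum>c | u_exp m i c \<noteq> 0. u_exp m i c) = pairing (fst m) (hh i))}"

definition wt_mono :: "weight \<Rightarrow> mono" where
  "wt_mono \<omega> = (\<omega>, 0)"

definition Y :: "int \<Rightarrow> complex \<Rightarrow> mono" where
  "Y i c = (0, Poly_Mapping.single (i, c) 1)"

definition A :: "nat \<Rightarrow> complex \<Rightarrow> int \<Rightarrow> complex \<Rightarrow> mono" where
  "A n q i c = wt_mono (\<alpha> n i) + Y i (c * inverse q) + Y i (c * q)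
     - Y (cls n (i - 1)) c - Y (cls n (i + 1)) c"

definition psi :: "complex \<Rightarrow> complex \<Rightarrow> complex" where
  "psi q z = (q - inverse q * z) / (1 - z)"

text \<open>The expansions of $\psi(cz)$, $c \ne 0$, at $z = 0$ (a series in $z$) and at $z = \infty$
  (a series in $z^{-1}$).\<close>

fun psi_expansion :: "complex \<Rightarrow> sign \<Rightarrow> complex \<Rightarrow> complex fps" where
  "psi_expansion q Pos c =
     (fps_const q - fps_const (inverse q * c) * fps_X) * inverse (1 - fps_const c * fps_X)"
| "psi_expansion q Neg c =
     (fps_const q * fps_X - fps_const (inverse q * c)) * inverse (fps_X - fps_const c)"

text \<open>The expansion of $\prod_c \psi(cqz)^{u_{i,c}}$.\<close>

definition mono_phi :: "complex \<Rightarrow> sign \<Rightarrow> int \<Rightarrow> mono \<Rightarrow> complex fps" where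
  "mono_phi q \<epsilon> i m = (\<Prod>c | u_exp m i c \<noteq> 0. psi_expansion q \<epsilon> (c * q) powi u_exp m i c)"


section \<open>Extremal loop weight modules\<close>

definition weight_space :: "nat \<Rightarrow> complex \<Rightarrow> 'v::complex_vs tor \<Rightarrow> weight \<Rightarrow> 'v set" where
  "weight_space n t M \<mu> = {v\<in>space M. \<forall>h\<in>\<hh> n. kop M h v = qpow t (pairing \<mu> h) *\<^sub>C v}"

definition integrable :: "nat \<Rightarrow> complex \<Rightarrow> 'v::complex_vs tor \<Rightarrow> bool" where
  "integrable n t M \<longleftrightarrow>
     space M = cvs.span (\<Union>\<mu>\<in>weight_lattice n. weight_space n t M \<mu>) \<and>
     (\<forall>L f. finite L \<and> L \<subseteq> weight_lattice n \<and> (\<forall>\<mu>\<in>L. f \<mu> \<in> weight_space n t M \<mu>) \<and> (\<Sum>\<mu>\<in>L. f \<mu>) = 0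
        \<longrightarrow> (\<forall>\<mu>\<in>L. f \<mu> = 0)) \<and>
     (\<forall>\<sigma>. \<forall>i\<in>I n. \<forall>v\<in>space M. \<exists>N. (xop M \<sigma> i 0 ^^ N) v = 0)"

definition lweight_space :: "nat \<Rightarrow> complex \<Rightarrow> 'v::complex_vs tor \<Rightarrow> mono \<Rightarrow> 'v set" where
  "lweight_space n t M m = {v \<in> weight_space n t M (fst m).
     \<forall>\<epsilon>. \<forall>i\<in>I n. \<forall>s::nat. \<exists>N.
       ((\<lambda>w. phi (exp t) M \<epsilon> i (sg \<epsilon> * int s) w
             - fps_nth (mono_phi (exp t) \<epsilon> i m) s *\<^sub>C w) ^^ N) v = 0}"

definition i_extremal :: "nat \<Rightarrow> complex \<Rightarrow> 'v::complex_vs tor \<Rightarrow> int \<Rightarrow> weight \<Rightarrow> 'v \<Rightarrow> bool" where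
  "i_extremal n t M i \<mu> w \<longleftrightarrow> w \<in> weight_space n t M \<mu> \<and>
     (pairing \<mu> (hh i) \<ge> 0 \<longrightarrow> xop M Pos i 0 w = 0) \<and>
     (pairing \<mu> (hh i) \<le> 0 \<longrightarrow> xop M Neg i 0 w = 0)"

text \<open>The operator $S_i$. A vector is carried along with its weight: $S_i$ sends a vector of
  weight $\mu$ to one of weight $\mu - \mu(h_i)\alpha_i$.\<close>

definition reflect :: "nat \<Rightarrow> complex \<Rightarrow> 'v::complex_vs tor \<Rightarrow> int \<Rightarrow> weight \<times> 'v \<Rightarrow> weight \<times> 'v" where
  "reflect n q M i = (\<lambda>(\<mu>, w).
     let l = pairing \<mu> (hh i); N = nat \<bar>\<lfloor>l\<rfloor>\<bar>; \<sigma> = (if l \<ge> 0 then Neg else Pos)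
     in (\<mu> - Poly_Mapping.map ((*) l) (\<alpha> n i), (1 / qfact q N) *\<^sub>C (xop M \<sigma> i 0 ^^ N) w))"

definition extremal :: "nat \<Rightarrow> complex \<Rightarrow> 'v::complex_vs tor \<Rightarrow> weight \<Rightarrow> 'v \<Rightarrow> bool" where
  "extremal n t M \<mu> w \<longleftrightarrow> (\<forall>is. set is \<subseteq> I n \<longrightarrow>
     (case foldr (reflect n (exp t) M) is (\<mu>, w) of (\<nu>, w') \<Rightarrow> \<forall>i\<in>I n. i_extremal n t M i \<nu> w'))"

text \<open>$U \cdot w$ for the subalgebra $U$ generated by the operators in \<open>G\<close>.\<close>

definition orbit_span :: "('v \<Rightarrow> 'v) set \<Rightarrow> 'v \<Rightarrow> 'v::complex_vs set" where
  "orbit_span G w = cvs.span {foldr (\<lambda>g v. g v) gs w | gs. set gs \<subseteq> G}"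

definition generators :: "nat \<Rightarrow> 'v tor \<Rightarrow> ('v \<Rightarrow> 'v) set" where
  "generators n M = {xop M \<sigma> i s | \<sigma> i s. i \<in> I n} \<union> {hop M i m | i m. i \<in> I n \<and> m \<noteq> 0}
     \<union> {kop M h | h. h \<in> \<hh> n}"

definition vertical_generators :: "nat \<Rightarrow> int \<Rightarrow> 'v tor \<Rightarrow> ('v \<Rightarrow> 'v) set" where
  "vertical_generators n j M =
     {xop M \<sigma> i s | \<sigma> i s. i \<in> I n - {j}} \<union> {hop M i m | i m. i \<in> I n - {j} \<and> m \<noteq> 0}
     \<union> {kop M h | h. Poly_Mapping.keys h \<subseteq> H ` (I n - {j})}"

definition extremal_loop_weight_module ::
    "nat \<Rightarrow> complex \<Rightarrow> 'v::complex_vs tor \<Rightarrow> mono \<Rightarrow> bool" where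
  "extremal_loop_weight_module n t M m \<longleftrightarrow>
     m \<in> monomials n \<and> tor_module n (exp t) M \<and> integrable n t M \<and>
     (\<exists>v\<in>lweight_space n t M m.
        orbit_span (generators n M) v = space M \<and>
        extremal n t M (fst m) v \<and>
        (\<forall>j\<in>I n. \<forall>w\<in>space M. \<exists>B. finite B \<and>
           orbit_span (vertical_generators n j M) w \<subseteq> cvs.span B))"


section \<open>Modules with a basis of joint eigenvectors\<close>

text \<open>\<open>X \<sigma> i s b\<close> is the image of the basis vector \<open>b\<close> under $x_{i,s}^\sigma$, \<open>wt b\<close> its weight
  and \<open>\<Phi> \<epsilon> i b\<close> the series (in $z$ or $z^{-1}$) of its $\phi_i^\epsilon$-eigenvalues. The latter
  determine the action of the generators $h_{i,m}$: their eigenvalues are obtained by solving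
  $\phi_i^\pm(z) = k_i^{\pm1}\exp(\pm(q-q^{-1})\sum_{m\ge1}h_{i,\pm m}z^{\pm m})$, i.e. from
  the logarithm of $\phi_i^\pm(z)/\phi^\pm_{i,0}$.\<close>

definition fps_log :: "complex fps \<Rightarrow> complex fps" where
  "fps_log f = fps_ln 1 oo (fps_const (inverse (fps_nth f 0)) * f - 1)"

definition basis_module ::
    "complex \<Rightarrow> 'b set \<Rightarrow> (sign \<Rightarrow> int \<Rightarrow> int \<Rightarrow> 'b \<Rightarrow> ('b \<Rightarrow>\<^sub>0 complex)) \<Rightarrow>
     (sign \<Rightarrow> int \<Rightarrow> 'b \<Rightarrow> complex fps) \<Rightarrow> ('b \<Rightarrow> weight) \<Rightarrow> ('b \<Rightarrow>\<^sub>0 complex) tor" where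
  "basis_module t B X \<Phi> wt =
     \<lparr>space = {p. Poly_Mapping.keys p \<subseteq> B},
      xop = (\<lambda>\<sigma> i s. lin_ext (X \<sigma> i s)),
      hop = (\<lambda>i m. lin_ext (\<lambda>b.
        (of_int (sgn m) / (exp t - inverse (exp t))
          * fps_nth (fps_log (\<Phi> (if m > 0 then Pos else Neg) i b)) (nat \<bar>m\<bar>)) *\<^sub>C basis_vec b)),
      kop = (\<lambda>h. lin_ext (\<lambda>b. qpow t (pairing (wt b) h) *\<^sub>C basis_vec b))\<rparr>"


section \<open>Vector representations and their tensor products\<close>

text \<open>Data of $V(\boxed{1}_b)$ on the basis vector $\boxed{j}_b$. One has
  $x_i^\pm(z)\boxed{j}_b = \delta(bq^ez)\boxed{j\mp1}_b$ if $i = \overline e$ and $0$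
  otherwise, with $e = j-1$ for $x_i^+$ and $e = j$ for $x_i^-$.\<close>

definition box_edge :: "sign \<Rightarrow> int \<Rightarrow> int" where
  "box_edge \<sigma> j = (case \<sigma> of Pos \<Rightarrow> j - 1 | Neg \<Rightarrow> j)"

text \<open>The eigenvalue of $\phi_i(z)$, as an element of any ring in which $\psi(cz)$ has been given
  the meaning \<open>\<Psi> c\<close>: for \<open>\<Psi> c = psi q (c * z)\<close> it is the value at a complex number \<open>z\<close>,
  for \<open>\<Psi> = psi_expansion q \<epsilon>\<close> it is the expansion. Note that
  \<open>inverse (psi q z) = (1 - z) / (q - inverse q * z)\<close> for all \<open>z\<close>, also for \<open>z = 1\<close>.\<close>

definition box_phi ::
    "nat \<Rightarrow> complex \<Rightarrow> (complex \<Rightarrow> 'a::{one,inverse}) \<Rightarrow> int \<Rightarrow> complex \<Rightarrow> int \<Rightarrow> 'a" where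
  "box_phi n q \<Psi> i b j =
     (if i = cls n j then \<Psi> (b * q powi j)
      else if i = cls n (j - 1) then inverse (\<Psi> (b * q powi (j + 1)))
      else 1)"

text \<open>$\boxed{1}_b$ has weight $\varpi_1$ and $x_i^\pm$ changes weights by $\pm\alpha_i$; this gives
  the weight of $\boxed{j}_b$.\<close>

definition box_wt :: "nat \<Rightarrow> int \<Rightarrow> weight" where
  "box_wt n j = varpi 1 - (\<Sum>l\<in>{1..<j}. \<alpha> n (cls n l)) + (\<Sum>l\<in>{j..<1}. \<alpha> n (cls n l))"

text \<open>The iterated Drinfeld coproduct on
  $V(\boxed{1}_{b_0})\otimes\cdots\otimes V(\boxed{1}_{b_{l-1}})$, where \<open>bs = [b_0, \<dots>]\<close> and the list
  \<open>js\<close> stands for $\boxed{j_0}_{b_0}\otimes\boxed{j_1}_{b_1}\otimes\cdots$: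
  $$x_i^+(z) \mapsto \sum_p \phi_i^-(z)^{\otimes p} \otimes x_i^+(z) \otimes 1\otimes\cdots\otimes1,
    \quad x_i^-(z) \mapsto \sum_p 1\otimes\cdots\otimes1 \otimes x_i^-(z) \otimes \phi_i^+(z)^{\otimes(l-1-p)}.$$
  As usual for this coproduct, the product of $\delta(cz)$ with (the expansion of) a rational
  function $f(z)$ regular at $z = c^{-1}$ is $f(c^{-1})\delta(cz)$. For the parameters
  $b_p = aq^{-2p}$, $p \le r$, and $j_0 < j_1 < \cdots$ all the rational functions that occur are
  regular at these points.\<close>

definition tensor_x ::
    "nat \<Rightarrow> complex \<Rightarrow> complex list \<Rightarrow> sign \<Rightarrow> int \<Rightarrow> int \<Rightarrow> int list \<Rightarrow> (int list \<Rightarrow>\<^sub>0 complex)" where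
  "tensor_x n q bs \<sigma> i s js =
     (\<Sum>p | p < length js \<and> i = cls n (box_edge \<sigma> (js ! p)).
        let c = bs ! p * q powi box_edge \<sigma> (js ! p);
            others = (case \<sigma> of Pos \<Rightarrow> {..<p} | Neg \<Rightarrow> {p<..<length js})
        in (c powi s * (\<Prod>p'\<in>others.
              box_phi n q (\<lambda>c'. psi q (c' * inverse c)) i (bs ! p') (js ! p')))
           *\<^sub>C basis_vec (js[p := js ! p - sg \<sigma>]))"

definition tensor_phi ::
    "nat \<Rightarrow> complex \<Rightarrow> complex list \<Rightarrow> sign \<Rightarrow> int \<Rightarrow> int list \<Rightarrow> complex fps" where
  "tensor_phi n q bs \<epsilon> i js =
     (\<Prod>p<length js. box_phi n q (psi_expansion q \<epsilon>) i (bs ! p) (js ! p))"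

definition tensor_wt :: "nat \<Rightarrow> int list \<Rightarrow> weight" where
  "tensor_wt n js = (\<Sum>j\<leftarrow>js. box_wt n j)"


section \<open>The column module\<close>

text \<open>The basis vectors of $\tilde V_a$, and those spanning the column module.\<close>

definition increasing :: "nat \<Rightarrow> int list set" where
  "increasing r = {js. length js = r + 1 \<and> sorted_wrt (<) js}"

definition column_basis :: "nat \<Rightarrow> int list set" where
  "column_basis r = {js \<in> increasing r. last js - hd js \<le> 2 * int r + 1}"

definition pr :: "'b set \<Rightarrow> ('b \<Rightarrow>\<^sub>0 complex) \<Rightarrow> ('b \<Rightarrow>\<^sub>0 complex)" where
  "pr B = lin_ext (\<lambda>b. if b \<in> B then basis_vec b else 0)"

text \<open>Here $k_h$ acts by $\Delta_D(k_h) = k_h \otimes\cdots\otimes k_h$. The vector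
  $\boxed{1}\otimes\boxed{2}\otimes\cdots\otimes\boxed{r+1}$ has $\ell$-weight
  $e^{\varpi_{r+1}}Y_{r+1,aq^{-r}}Y_{0,aq}^{-1}$. Replacing $(j_0,\dots,j_r)$ by
  $(j_r-n-1,j_0,\dots,j_{r-1})$ adds $\delta$ to the weight and multiplies all spectral parameters
  in the $\ell$-weight by $q^{-2}$; so $Y_{r+1,aq^{-r-2}}Y_{0,aq^{-1}}^{-1}$ occurs, on a vector of
  weight $\varpi_{r+1}+\delta$ (and on no other). The module therefore has $\ell$-weight
  $e^{\varpi_{r+1}}Y_{r+1,aq^{-r-2}}Y_{0,aq^{-1}}^{-1}$ after the grading given by $k_d$ is shifted
  by $-\delta$.\<close>

definition column_module :: "nat \<Rightarrow> complex \<Rightarrow> complex \<Rightarrow> (int list \<Rightarrow>\<^sub>0 complex) tor" where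
  "column_module r t a =
     (let n = 2 * r + 1; q = exp t; bs = map (\<lambda>p. a * q powi (- 2 * int p)) [0..<r + 1]
      in basis_module t (column_basis r)
           (\<lambda>\<sigma> i s js. pr (column_basis r) (tensor_x n q bs \<sigma> i s js))
           (tensor_phi n q bs) (tensor_wt n))"


section \<open>Extremal fundamental loop weight modules\<close>

text \<open>The set $\mathcal M$ generated by the monomial \<open>m\<^sub>0\<close>.\<close>

inductive_set crystal :: "nat \<Rightarrow> complex \<Rightarrow> mono \<Rightarrow> mono set"
  for n :: nat and q :: complex and m\<^sub>0 :: mono where
  start: "m\<^sub>0 \<in> crystal n q m\<^sub>0"
| lower: "m \<in> crystal n q m\<^sub>0 \<Longrightarrow> i \<in> I n \<Longrightarrow> u_exp m i c = 1 \<Longrightarrow>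
    m - A n q i (c * q) \<in> crystal n q m\<^sub>0"
| raise: "m \<in> crystal n q m\<^sub>0 \<Longrightarrow> i \<in> I n \<Longrightarrow> u_exp m i c = -1 \<Longrightarrow>
    m + A n q i (c * inverse q) \<in> crystal n q m\<^sub>0"

definition crystal_x ::
    "nat \<Rightarrow> complex \<Rightarrow> sign \<Rightarrow> int \<Rightarrow> int \<Rightarrow> mono \<Rightarrow> (mono \<Rightarrow>\<^sub>0 complex)" where
  "crystal_x n q \<sigma> i s m = (case \<sigma> of
     Neg \<Rightarrow> if \<exists>c. u_exp m i c = 1
       then let c = (THE c. u_exp m i c = 1)
            in (c * q) powi s *\<^sub>C basis_vec (m - A n q i (c * q)) else 0
   | Pos \<Rightarrow> if \<exists>c. u_exp m i c = -1
       then let c = (THE c. u_exp m i c = -1)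
            in (c * inverse q) powi s *\<^sub>C basis_vec (m + A n q i (c * inverse q)) else 0)"

definition fundamental_module :: "nat \<Rightarrow> complex \<Rightarrow> mono \<Rightarrow> (mono \<Rightarrow>\<^sub>0 complex) tor" where
  "fundamental_module n t m\<^sub>0 =
     basis_module t (crystal n (exp t) m\<^sub>0) (crystal_x n (exp t)) (mono_phi (exp t)) fst"

end

theory Submission
  imports Defs
begin

text \<open>
Put $N = n + 1 = 2(r+1)$. The column module has as basis the \<^emph>\<open>columns\<close>: increasing tuples
$(j_0,\dots,j_r)$ of integers with $j_r - j_0 < N$. Their entries have pairwise distinct residues
modulo $N$. On a column, $x_i^-(z)$ raises the entry of residue $i$ by one, with the factor
$\delta(cz)$, $c = a q^{j_p-2p}$, where $p$ is its position; it gives $0$ if there is no such entry or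
if the result is not a column, and the latter happens precisely when the residue $i+1$ is taken
(\<open>column_raise_iff\<close>). The operator $x_i^+(z)$ undoes this. So the module is described by a graph:
its vertices are the columns, and an edge of colour $i$ and parameter $c$ leads from a column to the
column obtained by such a move.

The equality $N = 2(r+1)$ enters as follows. Extend a column periodically by
$j_{p+r+1} = j_p + N$; then $j_p - 2p$ is a periodic function of $p$. Hence if two entries have adjacent residues, the second
has the value $j_p - 2p - 1$, also when it is the first entry of the column and the other one the
last (\<open>column_adjacent_residues\<close>). Therefore the contributions of such a pair to the eigenvalue of
$\phi_i$ cancel, and this eigenvalue is $\psi(cz)$, $\psi(q^2cz)^{-1}$ or $1$ according to whether
an edge of colour $i$ starts at the column, ends there, or neither.

The locale \<open>edge_module\<close> collects the properties of the graph from which everything else follows.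
All relations of the algebra become statements about one edge or about paths of two edges: for
instance, two consecutive edges with adjacent colours have parameters $c$ and $qc$, and then the
factor in the quadratic relation vanishes (\<open>M_rel_x_x\<close>). On every vertex the weight takes values
in $\{-1,0,1\}$ on the $h_i$, so the operators $S_i$ permute the basis vectors and each basis vector
is extremal (\<open>extremal_basis_vec\<close>). A vertex generates the module because the graph is connected
(\<open>column_connected\<close>), and the vertical subalgebras have finite-dimensional orbits because without
the edges of colour $j$ no entry can pass a number of residue $j$ (\<open>finite_components\<close>).

For the isomorphism, each entry of a column contributes two factors to a monomial, and raising an
entry divides the monomial by $A_{i,c}$ (\<open>mono_of_edge\<close>). As the graph is connected, the monomials
of columns are exactly the set $\mathcal M$ (\<open>crystal_eq\<close>). Distinct columns have distinct monomials,
because already the weight determines a column (\<open>tensor_wt_injective\<close>): its values on the $h_i$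
give the residues of the entries, and its value on $d$ gives the sum of their quotients by $N$,
which fixes the rotation. The monomial in the theorem, up to the shift of weights by $\delta$,
belongs to the column $(-r-1,1,2,\dots,r)$ (\<open>mono_of_start\<close>).
\<close>

section \<open>Linear operators on a space with a basis\<close>

abbreviation linear_map :: "('v::complex_vs \<Rightarrow> 'w::complex_vs) \<Rightarrow> bool" where
  "linear_map \<equiv> linear_on UNIV UNIV"

lemma lookup_scaleC [simp]:
  "Poly_Mapping.lookup (c *\<^sub>C p) b = c * Poly_Mapping.lookup p b" for p :: "'b \<Rightarrow>\<^sub>0 complex"
  unfolding scaleC_poly_mapping_def
  by (cases "Poly_Mapping.lookup p b = 0") (simp_all add: Poly_Mapping.map.rep_eq scaleC_complex_def)

lemma lookup_basis_vec: "Poly_Mapping.lookup (basis_vec b) b' = (if b' = b then 1 else 0)"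
  by (auto simp: basis_vec_def lookup_single when_def)

lemma keys_basis_vec [simp]: "Poly_Mapping.keys (basis_vec b) = {b}"
  by (auto simp: basis_vec_def)

lemma keys_scaleC_subset: "Poly_Mapping.keys (c *\<^sub>C p) \<subseteq> Poly_Mapping.keys p"
  for p :: "'b \<Rightarrow>\<^sub>0 complex"
  by (auto simp: in_keys_iff)

lemma lin_ext_superset:
  assumes "finite K" "Poly_Mapping.keys p \<subseteq> K"
  shows "lin_ext f p = (\<Sum>b\<in>K. Poly_Mapping.lookup p b *\<^sub>C f b)"
  unfolding lin_ext_def using assms
  by (intro sum.mono_neutral_left) (auto simp: in_keys_iff)

lemma linear_map_lin_ext: "linear_map (lin_ext f)"
proof -
  have "lin_ext f (v + w) = lin_ext f v + lin_ext f w" for v w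
  proof -
    let ?K = "Poly_Mapping.keys v \<union> Poly_Mapping.keys w"
    have "Poly_Mapping.keys (v + w) \<subseteq> ?K" by (rule keys_add)
    then show ?thesis
      by (simp add: lin_ext_superset[of ?K] lookup_add cvs.scale_left_distrib sum.distrib)
  qed
  moreover have "lin_ext f (c *\<^sub>C v) = c *\<^sub>C lin_ext f v" for c v
    using lin_ext_superset[OF finite_keys keys_scaleC_subset, of f c v]
    by (simp add: lin_ext_def cvs.scale_sum_right)
  ultimately show ?thesis by (simp add: linear_on_def)
qed

lemma linear_map_add: "linear_map f \<Longrightarrow> f (v + w) = f v + f w"
  and linear_map_scaleC: "linear_map f \<Longrightarrow> f (c *\<^sub>C v) = c *\<^sub>C f v"
  by (simp_all add: linear_on_def)

lemma linear_map_zero: "linear_map f \<Longrightarrow> f 0 = 0"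
  using linear_map_scaleC[of f 0 0] by simp

lemma linear_map_sum: "linear_map f \<Longrightarrow> f (\<Sum>x\<in>S. g x) = (\<Sum>x\<in>S. f (g x))"
  by (induction S rule: infinite_finite_induct) (simp_all add: linear_map_zero linear_map_add)

lemmas lin_ext_add = linear_map_add[OF linear_map_lin_ext]
  and lin_ext_scaleC = linear_map_scaleC[OF linear_map_lin_ext]
  and lin_ext_zero [simp] = linear_map_zero[OF linear_map_lin_ext]
  and lin_ext_sum = linear_map_sum[OF linear_map_lin_ext]

lemma lin_ext_basis_vec [simp]: "lin_ext f (basis_vec b) = f b"
  by (simp add: lin_ext_def lookup_basis_vec)

lemma linear_map_intros:
  "linear_map (\<lambda>v. v)"
  "linear_map (\<lambda>v. 0)"
  "linear_map f \<Longrightarrow> linear_map g \<Longrightarrow> linear_map (\<lambda>v. f v + g v)"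
  "linear_map f \<Longrightarrow> linear_map g \<Longrightarrow> linear_map (\<lambda>v. f v - g v)"
  "linear_map f \<Longrightarrow> linear_map (\<lambda>v. c *\<^sub>C f v)"
  "linear_map f \<Longrightarrow> linear_map (\<lambda>v. lin_ext h (f v))"
  by (simp_all add: linear_on_def cvs.scale_right_distrib cvs.scale_right_diff_distrib
      cvs.scale_left_commute lin_ext_add lin_ext_scaleC)

lemma basis_expansion: "v = (\<Sum>b\<in>Poly_Mapping.keys v. Poly_Mapping.lookup v b *\<^sub>C basis_vec b)"
proof (rule poly_mapping_eqI)
  fix b
  have "(\<Sum>b'\<in>Poly_Mapping.keys v. Poly_Mapping.lookup v b' * (if b = b' then 1 else 0))
      = Poly_Mapping.lookup v b"
    by (cases "b \<in> Poly_Mapping.keys v") (simp_all add: if_distrib sum.delta in_keys_iff cong: if_cong)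
  then show "Poly_Mapping.lookup v b
      = Poly_Mapping.lookup (\<Sum>b\<in>Poly_Mapping.keys v. Poly_Mapping.lookup v b *\<^sub>C basis_vec b) b"
    by (simp add: lookup_sum lookup_basis_vec)
qed

lemma linear_map_eqI:
  assumes "linear_map f" "linear_map g"
    and "\<And>b. b \<in> Poly_Mapping.keys v \<Longrightarrow> f (basis_vec b) = g (basis_vec b)"
  shows "f v = g v"
proof -
  have "f (\<Sum>b\<in>Poly_Mapping.keys v. Poly_Mapping.lookup v b *\<^sub>C basis_vec b)
      = g (\<Sum>b\<in>Poly_Mapping.keys v. Poly_Mapping.lookup v b *\<^sub>C basis_vec b)"
    using assms by (simp add: linear_map_sum linear_map_scaleC)
  then show ?thesis by (simp flip: basis_expansion)
qed

lemma lin_ext_cong: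
  "(\<And>b. b \<in> Poly_Mapping.keys v \<Longrightarrow> f b = g b) \<Longrightarrow> lin_ext f v = lin_ext g v"
  by (simp add: lin_ext_def)

definition supported_on :: "'b set \<Rightarrow> ('b \<Rightarrow>\<^sub>0 complex) set" where
  "supported_on B = {p. Poly_Mapping.keys p \<subseteq> B}"

lemma supported_on_eq_span: "supported_on B = cvs.span (basis_vec ` B)"
proof
  show "supported_on B \<subseteq> cvs.span (basis_vec ` B)"
  proof
    fix v assume "v \<in> supported_on B"
    then have "(\<Sum>b\<in>Poly_Mapping.keys v. Poly_Mapping.lookup v b *\<^sub>C basis_vec b)
        \<in> cvs.span (basis_vec ` B)"
      by (intro cvs.span_sum cvs.span_scale cvs.span_base) (auto simp: supported_on_def)
    then show "v \<in> cvs.span (basis_vec ` B)" by (simp flip: basis_expansion)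
  qed
  have "cvs.subspace (supported_on B)"
    unfolding cvs.subspace_def supported_on_def subset_iff in_keys_iff
    by (simp add: lookup_add) (metis add_0)
  then show "cvs.span (basis_vec ` B) \<subseteq> supported_on B"
    by (intro cvs.span_minimal) (auto simp: supported_on_def)
qed

lemma subspace_supported_on: "cvs.subspace (supported_on B)"
  by (simp add: supported_on_eq_span cvs.subspace_span)

lemma basis_vec_supported [simp]: "basis_vec b \<in> supported_on B \<longleftrightarrow> b \<in> B"
  by (simp add: supported_on_def)

lemma lin_ext_supported:
  assumes "v \<in> supported_on B" "\<And>b. b \<in> B \<Longrightarrow> f b \<in> supported_on C"
  shows "lin_ext f v \<in> supported_on C"
  unfolding lin_ext_def using assms
  by (intro cvs.subspace_sum cvs.subspace_scale subspace_supported_on) (auto simp: supported_on_def)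

text \<open>The generators $h_{i,m}$, $k_h$ and the operators $\phi$ are all of this form. The rule
\<open>lookup_diag\<close> reduces computations with them to computations with eigenvalues.\<close>

definition diag :: "('b \<Rightarrow> complex) \<Rightarrow> ('b \<Rightarrow>\<^sub>0 complex) \<Rightarrow> ('b \<Rightarrow>\<^sub>0 complex)" where
  "diag e = lin_ext (\<lambda>b. e b *\<^sub>C basis_vec b)"

lemma lookup_diag [simp]: "Poly_Mapping.lookup (diag e v) b = e b * Poly_Mapping.lookup v b"
proof -
  have "(\<Sum>b'\<in>Poly_Mapping.keys v. Poly_Mapping.lookup v b' * (e b' * (if b = b' then 1 else 0)))
      = e b * Poly_Mapping.lookup v b"
    by (cases "b \<in> Poly_Mapping.keys v") (simp_all add: if_distrib sum.delta in_keys_iff cong: if_cong)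
  then show ?thesis
    by (simp add: diag_def lin_ext_def lookup_sum lookup_basis_vec mult.assoc)
qed

lemma linear_map_diag: "linear_map (diag e)"
  by (simp add: diag_def linear_map_lin_ext)

lemma linear_map_diag_comp: "linear_map f \<Longrightarrow> linear_map (\<lambda>v. diag e (f v))"
  by (simp add: diag_def linear_map_intros)

lemma diag_basis_vec [simp]: "diag e (basis_vec b) = e b *\<^sub>C basis_vec b"
  by (simp add: diag_def)

lemma diag_scaleC: "diag e (c *\<^sub>C v) = c *\<^sub>C diag e v"
  by (simp add: diag_def lin_ext_scaleC)

lemma diag_zero [simp]: "diag e 0 = 0"
  by (simp add: diag_def)

lemma scaleC_diag: "c *\<^sub>C diag e v = diag (\<lambda>b. c * e b) v"
  by (rule poly_mapping_eqI) simp

lemma diag_diag: "diag e (diag e' v) = diag (\<lambda>b. e b * e' b) v"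
  by (rule poly_mapping_eqI) simp

lemma sum_diag: "(\<Sum>x\<in>S. diag (e x) v) = diag (\<lambda>b. \<Sum>x\<in>S. e x b) v"
  by (rule poly_mapping_eqI) (simp add: lookup_sum sum_distrib_right)

lemma diag_cong:
  "(\<And>b. b \<in> Poly_Mapping.keys v \<Longrightarrow> e b = e' b) \<Longrightarrow> diag e v = diag e' v"
  unfolding diag_def by (rule lin_ext_cong) simp

lemma diag_one: "diag (\<lambda>_. 1) v = v"
  by (rule poly_mapping_eqI) simp

lemma diag_supported: "v \<in> supported_on B \<Longrightarrow> diag e v \<in> supported_on B"
  by (auto simp: supported_on_def in_keys_iff subset_iff)

section \<open>Expansions of the function psi\<close>

text \<open>This is $u - vz$, written as a power series in the variable of the expansion. For expansions
at infinity it is multiplied by $z^{-1}$, to have no pole in that variable. In this form both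
expansions of an identity of rational functions are treated by one computation.\<close>

fun lin_factor :: "sign \<Rightarrow> complex \<Rightarrow> complex \<Rightarrow> complex fps" where
  "lin_factor Pos u v = fps_const u - fps_const v * fps_X"
| "lin_factor Neg u v = fps_const u * fps_X - fps_const v"

lemma lin_factor_mult_nth:
  "fps_nth (f * lin_factor Pos u v) s = u * fps_nth f s - (if s = 0 then 0 else v * fps_nth f (s - 1))"
  "fps_nth (f * lin_factor Neg u v) s = (if s = 0 then 0 else u * fps_nth f (s - 1)) - v * fps_nth f s"
proof -
  have *: "f * (fps_const k * fps_X) = fps_const k * (fps_X * f)" for k
    by (simp add: algebra_simps)
  have "f * lin_factor Pos u v = fps_const u * f - fps_const v * (fps_X * f)"
    "f * lin_factor Neg u v = fps_const u * (fps_X * f) - fps_const v * f"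
    by (simp_all add: right_diff_distrib * mult.commute)
  then show
    "fps_nth (f * lin_factor Pos u v) s = u * fps_nth f s - (if s = 0 then 0 else v * fps_nth f (s - 1))"
    "fps_nth (f * lin_factor Neg u v) s = (if s = 0 then 0 else u * fps_nth f (s - 1)) - v * fps_nth f s"
    by simp_all
qed

lemma psi_expansion_eq:
  "psi_expansion q \<epsilon> c = lin_factor \<epsilon> q (inverse q * c) * inverse (lin_factor \<epsilon> 1 c)"
  by (cases \<epsilon>) simp_all

lemma lin_factor_nth_0: "fps_nth (lin_factor \<epsilon> u v) 0 = (case \<epsilon> of Pos \<Rightarrow> u | Neg \<Rightarrow> - v)"
  by (cases \<epsilon>) simp_all

lemma lin_factor_scale: "lin_factor \<epsilon> (k * u) (k * v) = fps_const k * lin_factor \<epsilon> u v"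
  by (cases \<epsilon>) (simp_all add: algebra_simps flip: fps_const_mult)

lemma lin_factor_inverse:
  assumes "u \<noteq> 0" "v \<noteq> 0"
  shows "lin_factor \<epsilon> u v * inverse (lin_factor \<epsilon> u v) = 1"
  using assms by (simp add: inverse_mult_eq_1' lin_factor_nth_0 split: sign.split)

lemma psi_expansion_mult:
  assumes "c \<noteq> 0"
  shows "psi_expansion q \<epsilon> c * lin_factor \<epsilon> 1 c = lin_factor \<epsilon> q (inverse q * c)"
proof -
  have "inverse (lin_factor \<epsilon> 1 c) * lin_factor \<epsilon> 1 c = 1"
    using lin_factor_inverse[of 1 c \<epsilon>] assms by (simp only: mult.commute one_neq_zero not_False_eq_True)
  then show ?thesis by (simp only: psi_expansion_eq mult.assoc mult_1_right)
qed

lemma psi_expansion_nth_0: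
  assumes "q \<noteq> 0" "c \<noteq> 0"
  shows "fps_nth (psi_expansion q \<epsilon> c) 0 = (case \<epsilon> of Pos \<Rightarrow> q | Neg \<Rightarrow> inverse q)"
  using assms by (simp add: psi_expansion_eq lin_factor_nth_0 field_simps split: sign.split)

lemma psi_expansion_inverse_cancel:
  "q \<noteq> 0 \<Longrightarrow> c \<noteq> 0 \<Longrightarrow> psi_expansion q \<epsilon> c * inverse (psi_expansion q \<epsilon> c) = 1"
  by (rule inverse_mult_eq_1') (simp add: psi_expansion_nth_0 split: sign.split)

text \<open>Both sides expand $(q^{-1} - qcz)/(1 - cz)$. In a two-dimensional string for $x_i^\pm$ the
eigenvalue of $\phi_i$ at the lower end is therefore the one at the upper end with $q$ inverted, so
facts about $\psi$ apply to both ends.\<close>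

lemma inverse_psi_expansion:
  assumes "q \<noteq> 0" "c \<noteq> 0"
  shows "inverse (psi_expansion q \<epsilon> (q\<^sup>2 * c)) = psi_expansion (inverse q) \<epsilon> c"
proof -
  have 1: "lin_factor \<epsilon> q (inverse q * (q\<^sup>2 * c)) = fps_const q * lin_factor \<epsilon> 1 c"
  proof -
    have "inverse q * (q\<^sup>2 * c) = q * c" using assms by (simp add: power2_eq_square)
    then show ?thesis using lin_factor_scale[of \<epsilon> q 1 c] by (simp only: mult_1_right)
  qed
  have 2: "lin_factor \<epsilon> 1 (q\<^sup>2 * c) = fps_const q * lin_factor \<epsilon> (inverse q) (q * c)"
  proof -
    have "q * inverse q = 1" "q * (q * c) = q\<^sup>2 * c" using assms by (simp_all add: power2_eq_square)
    then show ?thesis using lin_factor_scale[of \<epsilon> q "inverse q" "q * c"] by (simp only:)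
  qed
  have "psi_expansion q \<epsilon> (q\<^sup>2 * c) * psi_expansion (inverse q) \<epsilon> c
      = (lin_factor \<epsilon> q (inverse q * (q\<^sup>2 * c)) * inverse (lin_factor \<epsilon> 1 c))
        * (lin_factor \<epsilon> (inverse q) (q * c) * inverse (lin_factor \<epsilon> 1 (q\<^sup>2 * c)))"
    by (simp only: psi_expansion_eq inverse_inverse_eq mult_ac)
  also have "\<dots> = (lin_factor \<epsilon> 1 c * inverse (lin_factor \<epsilon> 1 c))
        * ((fps_const q * lin_factor \<epsilon> (inverse q) (q * c)) * inverse (lin_factor \<epsilon> 1 (q\<^sup>2 * c)))"
    unfolding 1 by (simp only: mult_ac)
  also have "\<dots> = 1"
    using assms by (simp only: lin_factor_inverse mult_1 flip: 2) (simp add: lin_factor_inverse del: lin_factor.simps)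
  finally have "psi_expansion q \<epsilon> (q\<^sup>2 * c) * psi_expansion (inverse q) \<epsilon> c = 1" .
  moreover have "inverse (psi_expansion q \<epsilon> (q\<^sup>2 * c)) * psi_expansion q \<epsilon> (q\<^sup>2 * c) = 1"
    using psi_expansion_inverse_cancel[of q "q\<^sup>2 * c" \<epsilon>] assms by (simp add: mult.commute del: psi_expansion.simps)
  ultimately show ?thesis by (metis (no_types) mult.assoc mult.left_neutral mult.right_neutral)
qed

lemma psi_expansion_Suc:
  assumes "q \<noteq> 0" "c \<noteq> 0"
  shows "fps_nth (psi_expansion q Pos c) (Suc s) = (q - inverse q) * c ^ Suc s"
    and "fps_nth (psi_expansion q Neg c) (Suc s) = - ((q - inverse q) * inverse c ^ Suc s)"
proof -
  define f where "f = psi_expansion q Pos c"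
  have f: "fps_nth f 0 = q" "f * lin_factor Pos 1 c = 1 * lin_factor Pos q (inverse q * c)"
    unfolding f_def using psi_expansion_nth_0[OF assms, of Pos] psi_expansion_mult[OF assms(2), of q Pos]
    by (simp_all only: sign.case mult_1)
  have step: "fps_nth f (Suc s) = c * fps_nth f s - (if s = 0 then inverse q * c else 0)" for s
    using arg_cong[OF f(2), of "\<lambda>f. fps_nth f (Suc s)"]
    unfolding lin_factor_mult_nth by (cases s) (simp_all add: algebra_simps)
  have "fps_nth f (Suc s) = (q - inverse q) * c ^ Suc s"
  proof (induction s)
    case (Suc s)
    have "fps_nth f (Suc (Suc s)) = c * fps_nth f (Suc s)" by (simp add: step[of "Suc s"])
    then show ?case using Suc by simp
  qed (simp add: step f(1) algebra_simps)
  then show "fps_nth (psi_expansion q Pos c) (Suc s) = (q - inverse q) * c ^ Suc s"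
    by (simp only: f_def)
  define g where "g = psi_expansion q Neg c"
  have g: "fps_nth g 0 = inverse q" "g * lin_factor Neg 1 c = 1 * lin_factor Neg q (inverse q * c)"
    unfolding g_def using psi_expansion_nth_0[OF assms, of Neg] psi_expansion_mult[OF assms(2), of q Neg]
    by (simp_all only: sign.case mult_1)
  have step: "c * fps_nth g (Suc s) = fps_nth g s - (if s = 0 then q else 0)" for s
    using arg_cong[OF g(2), of "\<lambda>f. fps_nth f (Suc s)"]
    unfolding lin_factor_mult_nth by (cases s) (simp_all add: algebra_simps)
  have "c * fps_nth g (Suc s) = - ((q - inverse q) * inverse c ^ s)" for s
  proof (induction s)
    case (Suc s)
    have "c * (c * fps_nth g (Suc (Suc s))) = c * fps_nth g (Suc s)" by (simp add: step)
    then show ?case using Suc assms(2) by (simp add: field_simps)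
  qed (simp add: step g(1))
  then have "fps_nth g (Suc s) = - ((q - inverse q) * inverse c ^ Suc s)"
    using assms(2) by (simp add: eq_divide_eq mult.commute divide_inverse[symmetric] minus_divide_left
        flip: power_inverse) (simp add: field_simps)
  then show "fps_nth (psi_expansion q Neg c) (Suc s) = - ((q - inverse q) * inverse c ^ Suc s)"
    by (simp only: g_def)
qed

text \<open>The coefficient of $z^s$, when \<open>f\<close> is a series in $z$ or in $z^{-1}$ according to \<open>\<epsilon>\<close>.\<close>

definition int_coeff :: "sign \<Rightarrow> complex fps \<Rightarrow> int \<Rightarrow> complex" where
  "int_coeff \<epsilon> f s = (if sg \<epsilon> * s \<ge> 0 then fps_nth f (nat \<bar>s\<bar>) else 0)"

text \<open>The function $\psi(cz)$ has a simple pole, so its two expansions differ by a multiple of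
$\delta(cz)$. This produces the delta functions in the commutator of $x_i^+$ and $x_i^-$.\<close>

lemma psi_expansion_delta:
  assumes "q \<noteq> 0" "c \<noteq> 0"
  shows "int_coeff Pos (psi_expansion q Pos c) s - int_coeff Neg (psi_expansion q Neg c) s
    = (q - inverse q) * c powi s"
proof (cases s "0::int" rule: linorder_cases)
  case equal
  then show ?thesis
    using assms by (simp add: int_coeff_def psi_expansion_nth_0 del: psi_expansion.simps)
next
  case greater
  define s' where "s' = nat (s - 1)"
  have "s = int (Suc s')" using greater by (simp add: s'_def)
  then show ?thesis
    using assms psi_expansion_Suc(1)[OF assms, of s']
    by (simp add: int_coeff_def power_int_def nat_add_distrib del: psi_expansion.simps)
next
  case less
  define s' where "s' = nat (- s - 1)"
  have "s = - int (Suc s')" using less by (simp add: s'_def)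
  then show ?thesis
    using assms psi_expansion_Suc(2)[OF assms, of s']
    by (simp add: int_coeff_def power_int_def nat_add_distrib del: psi_expansion.simps)
qed

text \<open>This is how an identity between eigenvalues becomes a relation between the coefficients of
the generating series, as the relations of the algebra are stated.\<close>

lemma int_coeff_lin_factor:
  assumes "f * lin_factor \<epsilon> u v = g * lin_factor \<epsilon> u' v'"
  shows "u * int_coeff \<epsilon> f s - v * int_coeff \<epsilon> f (s - 1)
    = u' * int_coeff \<epsilon> g s - v' * int_coeff \<epsilon> g (s - 1)"
proof (cases \<epsilon>)
  case Pos
  have "u * int_coeff Pos f s - v * int_coeff Pos f (s - 1)
      = (if s < 0 then 0 else fps_nth (f * lin_factor Pos u v) (nat s))" for f u v
    unfolding lin_factor_mult_nth
    by (auto simp: int_coeff_def nat_diff_distrib)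
  then show ?thesis using assms unfolding Pos by presburger
next
  case Neg
  have "u * int_coeff Neg f s - v * int_coeff Neg f (s - 1)
      = (if s > 1 then 0 else fps_nth (f * lin_factor Neg u v) (nat (1 - s)))" for f u v
    unfolding lin_factor_mult_nth
    by (cases "s = 1") (auto simp: int_coeff_def intro!: arg_cong[where f = "fps_nth f"])
  then show ?thesis using assms unfolding Neg by presburger
qed

section \<open>The operators phi on joint eigenvectors\<close>

lemma fps_exp_log:
  assumes "fps_nth g 0 = 1"
  shows "fps_exp 1 oo (fps_ln 1 oo (g - 1)) = (g :: complex fps)"
proof -
  have ln0: "fps_nth (fps_ln 1 :: complex fps) 0 = 0" by simp
  have g0: "fps_nth (g - 1) 0 = 0" using assms by simp
  have "(fps_exp 1 - 1) oo fps_ln 1 = (fps_X :: complex fps)"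
    using fps_inv_right[of "fps_exp 1 - 1 :: complex fps"] by (simp add: fps_ln_fps_exp_inv)
  then have exp_ln: "fps_exp 1 oo fps_ln 1 = 1 + (fps_X :: complex fps)"
    by (simp add: fps_compose_sub_distrib diff_eq_eq add.commute)
  have "fps_exp 1 oo (fps_ln 1 oo (g - 1)) = (fps_exp 1 oo fps_ln 1) oo (g - 1)"
    using fps_compose_assoc[OF g0 ln0, of "fps_exp 1"] by simp
  also have "\<dots> = g"
    using g0 by (simp add: exp_ln fps_compose_add_distrib fps_X_fps_compose_startby0)
  finally show ?thesis .
qed

text \<open>The series \<open>f b\<close> have no constant term, so the powers with exponent greater than \<open>m\<close>, which
\<open>series_exp\<close> leaves out, do not contribute to the coefficient of index \<open>m\<close>.\<close>

lemma series_exp_diag: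
  assumes "\<And>b. fps_nth (f b) 0 = 0" and "\<And>m v. m > 0 \<Longrightarrow> T m v = diag (\<lambda>b. fps_nth (f b) m) v"
  shows "series_exp T m v = diag (\<lambda>b. fps_nth (fps_exp 1 oo f b) m) v"
proof -
  have "series_power T l m v = diag (\<lambda>b. fps_nth (f b ^ l) m) v" for l m
  proof (induction l arbitrary: m)
    case 0
    show ?case by (auto intro!: poly_mapping_eqI)
  next
    case (Suc l)
    have "series_power T (Suc l) m v
        = (\<Sum>k=1..m. diag (\<lambda>b. fps_nth (f b) k * fps_nth (f b ^ l) (m - k)) v)"
      by (simp add: Suc assms(2) diag_diag)
    also have "\<dots> = diag (\<lambda>b. \<Sum>k=1..m. fps_nth (f b) k * fps_nth (f b ^ l) (m - k)) v"
      by (rule sum_diag)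
    also have "(\<lambda>b. \<Sum>k=1..m. fps_nth (f b) k * fps_nth (f b ^ l) (m - k))
        = (\<lambda>b. fps_nth (f b ^ Suc l) m)"
      by (simp add: fps_mult_nth sum.atLeast_Suc_atMost assms(1) flip: atLeast0AtMost)
    finally show ?case .
  qed
  then show ?thesis
    by (simp add: series_exp_def scaleC_diag sum_diag fps_compose_nth atMost_atLeast0)
qed

text \<open>The generators $h_{i,m}$ of a \<open>basis_module\<close> were obtained by taking a logarithm; taking the
  exponential again gives back the prescribed eigenvalues \<open>\<Phi>\<close>, provided that their constant terms
  are the eigenvalues of $k_i^{\pm1}$.\<close>

lemma phi_basis_module:
  assumes q: "(exp t)\<^sup>2 \<noteq> 1"
    and v: "v \<in> supported_on B"
    and 0: "\<And>b. b \<in> B \<Longrightarrow>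
      fps_nth (\<Phi> \<epsilon> i b) 0 = qpow t (pairing (wt b) (case \<epsilon> of Pos \<Rightarrow> hh i | Neg \<Rightarrow> - hh i))"
  shows "phi (exp t) (basis_module t B X \<Phi> wt) \<epsilon> i s v = diag (\<lambda>b. int_coeff \<epsilon> (\<Phi> \<epsilon> i b) s) v"
proof (cases "sg \<epsilon> * s \<ge> 0")
  case True
  let ?q = "exp t" and ?M = "basis_module t B X \<Phi> wt"
  have q': "?q - inverse ?q \<noteq> 0"
    using q by (auto simp: power2_eq_square field_simps)
  have nz: "qpow t x \<noteq> 0" for x by (simp add: qpow_def)
  define f where "f b = fps_log (\<Phi> \<epsilon> i b)" for b
  have f0: "fps_nth (f b) 0 = 0" for b by (simp add: f_def fps_log_def)
  have "(of_int (sg \<epsilon>) * (?q - inverse ?q)) *\<^sub>C hop ?M i (sg \<epsilon> * int m) w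
      = diag (\<lambda>b. fps_nth (f b) m) w" if "m > 0" for m w
  proof -
    have "hop ?M i (sg \<epsilon> * int m) = diag (\<lambda>b. of_int (sg \<epsilon>) / (?q - inverse ?q) * fps_nth (f b) m)"
      using that by (cases \<epsilon>) (simp_all add: basis_module_def diag_def f_def)
    moreover have "of_int (sg \<epsilon>) * (?q - inverse ?q) * (of_int (sg \<epsilon>) / (?q - inverse ?q) * x) = x" for x
      using q' by (cases \<epsilon>) (simp_all add: field_simps)
    ultimately show ?thesis by (simp add: scaleC_diag)
  qed
  then have "phi ?q ?M \<epsilon> i s v = diag (\<lambda>b. qpow t (pairing (wt b) (case \<epsilon> of Pos \<Rightarrow> hh i | Neg \<Rightarrow> - hh i)))
      (diag (\<lambda>b. fps_nth (fps_exp 1 oo f b) (nat \<bar>s\<bar>)) v)"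
    using True by (simp add: phi_def series_exp_diag[OF f0]) (simp add: basis_module_def diag_def)
  also have "\<dots> = diag (\<lambda>b. int_coeff \<epsilon> (\<Phi> \<epsilon> i b) s) v"
    unfolding diag_diag
  proof (rule diag_cong)
    fix b assume "b \<in> Poly_Mapping.keys v"
    with v have b: "b \<in> B" by (auto simp: supported_on_def)
    have nz': "fps_nth (\<Phi> \<epsilon> i b) 0 \<noteq> 0" using 0[OF b] nz by metis
    then have "fps_exp 1 oo f b = fps_const (inverse (fps_nth (\<Phi> \<epsilon> i b) 0)) * \<Phi> \<epsilon> i b"
      unfolding f_def fps_log_def by (intro fps_exp_log) simp
    then show "qpow t (pairing (wt b) (case \<epsilon> of Pos \<Rightarrow> hh i | Neg \<Rightarrow> - hh i))
        * fps_nth (fps_exp 1 oo f b) (nat \<bar>s\<bar>) = int_coeff \<epsilon> (\<Phi> \<epsilon> i b) s"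
      using True nz' by (simp add: int_coeff_def flip: 0[OF b])
  qed
  finally show ?thesis .
next
  case False
  then show ?thesis by (intro poly_mapping_eqI) (simp add: phi_def int_coeff_def)
qed

section \<open>Weights\<close>

lemma pairing_superset:
  assumes "finite K" "Poly_Mapping.keys h \<subseteq> K"
  shows "pairing \<mu> h = (\<Sum>b\<in>K. Poly_Mapping.lookup \<mu> b * Poly_Mapping.lookup h b)"
  unfolding pairing_def using assms
  by (intro sum.mono_neutral_left) (auto simp: in_keys_iff)

lemma pairing_add_right: "pairing \<mu> (h + h') = pairing \<mu> h + pairing \<mu> h'"
proof -
  let ?K = "Poly_Mapping.keys h \<union> Poly_Mapping.keys h'"
  have "Poly_Mapping.keys (h + h') \<subseteq> ?K" by (rule keys_add)
  then show ?thesis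
    by (simp add: pairing_superset[of ?K] lookup_add distrib_left sum.distrib)
qed

lemma pairing_zero_right [simp]: "pairing \<mu> 0 = 0"
  by (simp add: pairing_def)

lemma pairing_uminus_right: "pairing \<mu> (- h) = - pairing \<mu> h"
  using pairing_add_right[of \<mu> h "- h"] by simp

lemma pairing_add_left: "pairing (\<mu> + \<nu>) h = pairing \<mu> h + pairing \<nu> h"
  by (simp add: pairing_def lookup_add distrib_right sum.distrib)

lemma pairing_diff_left: "pairing (\<mu> - \<nu>) h = pairing \<mu> h - pairing \<nu> h"
  by (simp add: pairing_def lookup_minus left_diff_distrib sum_subtractf)

lemma pairing_single [simp]: "pairing \<mu> (Poly_Mapping.single x 1) = Poly_Mapping.lookup \<mu> x"
  by (simp add: pairing_def)

lemma pairing_hh: "pairing \<mu> (hh i) = Poly_Mapping.lookup \<mu> (H i)"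
  by (simp add: hh_def)

lemma qpow_add: "qpow t (x + y) = qpow t x * qpow t y"
  by (simp add: qpow_def of_rat_add distrib_left exp_add)

lemma qpow_zero [simp]: "qpow t 0 = 1"
  and qpow_one [simp]: "qpow t 1 = exp t"
  and qpow_minus_one [simp]: "qpow t (- 1) = inverse (exp t)"
  by (simp_all add: qpow_def of_rat_minus exp_minus)

lemma qpow_nonzero [simp]: "qpow t x \<noteq> 0"
  by (simp add: qpow_def)

text \<open>Clearing the denominator of the difference of the exponents turns an equality into
$q^p = 1$ for an integer $p$.\<close>

lemma qpow_injective:
  assumes "\<forall>k::nat. k > 0 \<longrightarrow> exp t ^ k \<noteq> 1" and "qpow t x = qpow t y"
  shows "x = y"
proof -
  have pow: "qpow t z ^ k = qpow t (of_nat k * z)" for z k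
    by (induction k) (simp_all add: qpow_add distrib_right)
  have 1: "qpow t (x - y) = 1"
    using assms(2) qpow_add[of t "x - y" y] by simp
  obtain p s where ps: "x - y = of_int p / of_int s" "s > 0"
    by (metis quotient_of_div quotient_of_denom_pos surj_pair)
  have "of_nat (nat s) * (x - y) = of_int p" using ps by simp
  then have p: "qpow t (of_int p) = 1" using pow[of "x - y" "nat s"] 1 by simp
  have "qpow t (of_nat (nat \<bar>p\<bar>)) = 1"
  proof (cases "p \<ge> 0")
    case False
    then have "qpow t (of_nat (nat \<bar>p\<bar>) + of_int p) = 1" by simp
    then show ?thesis using p by (simp only: qpow_add) simp
  qed (use p in simp)
  then have "exp t ^ nat \<bar>p\<bar> = 1" using pow[of 1 "nat \<bar>p\<bar>"] by simp
  then have "p = 0" using assms(1) by (metis neq0_conv zero_less_abs_iff zero_less_nat_eq)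
  then show ?thesis using ps by simp
qed

lemma pairing_\<alpha>: "i \<in> I n \<Longrightarrow> pairing (\<alpha> n j) (hh i) = of_int (cartan n i j)"
  by (simp add: pairing_hh \<alpha>_def lookup_add lookup_sum lookup_single when_def I_def)

lemma map_times_unit:
  "Poly_Mapping.map ((*) (1::rat)) \<mu> = \<mu>"
  "Poly_Mapping.map ((*) (- 1::rat)) \<mu> = - \<mu>"
  "Poly_Mapping.map ((*) (0::rat)) \<mu> = 0"
  by (rule poly_mapping_eqI; simp add: Poly_Mapping.map.rep_eq when_def)+

lemma powi_pred: "c \<noteq> 0 \<Longrightarrow> c powi s = c powi (s - 1) * c" for c :: complex
  by (simp add: power_int_minus_mult)

lemma adjacent_sym: "i \<in> I n \<Longrightarrow> adjacent n i j \<Longrightarrow> adjacent n j i"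
  by (auto simp: adjacent_def cls_def I_def mod_simps)

lemma adjacent_neq:
  assumes "n \<ge> 1" "i \<in> I n" "adjacent n i j"
  shows "i \<noteq> j"
proof
  assume "i = j"
  moreover have "i = i mod (int n + 1)" using assms(2) by (simp add: I_def)
  ultimately have "(i + 1) mod (int n + 1) = i mod (int n + 1) \<or> (i - 1) mod (int n + 1) = i mod (int n + 1)"
    using assms(3) by (auto simp: adjacent_def cls_def)
  then have "int n + 1 dvd 1"
    by (auto simp: mod_eq_dvd_iff)
  then show False using assms(1) by simp
qed

section \<open>Modules given by a coloured graph\<close>

text \<open>Here \<open>edge i c b b'\<close> stands for $x_i^-(z) b = \delta(cz) b'$ and $x_i^+(z) b' = \delta(cz) b$.
The assumptions on weights force the strings of each colour to have length at most one. The
eigenvalues \<open>\<Phi>\<close> are those of two-dimensional evaluation modules, and along an edge of another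
colour they change by the factor that the relation between $\phi$ and $x$ prescribes.

The last four assumptions concern pairs of edges of different colours. The first gives the
quadratic relation for adjacent colours, and the second the commutation of $x_i^\pm$ with
$x_j^\pm$ for colours that are not adjacent. The last two give the commutation of $x_i^+$ with $x_j^-$.\<close>

locale edge_module =
  fixes n :: nat and t :: complex and B :: "'b set"
    and edge :: "int \<Rightarrow> complex \<Rightarrow> 'b \<Rightarrow> 'b \<Rightarrow> bool"
    and X :: "sign \<Rightarrow> int \<Rightarrow> int \<Rightarrow> 'b \<Rightarrow> ('b \<Rightarrow>\<^sub>0 complex)"
    and \<Phi> :: "sign \<Rightarrow> int \<Rightarrow> 'b \<Rightarrow> complex fps"
    and wt :: "'b \<Rightarrow> weight"
  assumes not_root: "\<forall>k::nat. k > 0 \<longrightarrow> exp t ^ k \<noteq> 1"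
    and edge_dest: "edge i c b b' \<Longrightarrow> i \<in> I n \<and> b \<in> B \<and> b' \<in> B \<and> c \<noteq> 0"
    and edge_out_unique: "edge i c b b' \<Longrightarrow> edge i d b b'' \<Longrightarrow> d = c \<and> b'' = b'"
    and edge_in_unique: "edge i c b b' \<Longrightarrow> edge i d b'' b' \<Longrightarrow> d = c \<and> b'' = b"
    and X_Neg: "edge i c b b' \<Longrightarrow> X Neg i s b = c powi s *\<^sub>C basis_vec b'"
    and X_Pos: "edge i c b b' \<Longrightarrow> X Pos i s b' = c powi s *\<^sub>C basis_vec b"
    and X_Neg_zero: "i \<in> I n \<Longrightarrow> b \<in> B \<Longrightarrow> \<nexists>c b'. edge i c b b' \<Longrightarrow> X Neg i s b = 0"
    and X_Pos_zero: "i \<in> I n \<Longrightarrow> b \<in> B \<Longrightarrow> \<nexists>c b'. edge i c b' b \<Longrightarrow> X Pos i s b = 0"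
    and wt_in_lattice: "b \<in> B \<Longrightarrow> wt b \<in> weight_lattice n"
    and wt_edge: "edge i c b b' \<Longrightarrow> wt b' = wt b - \<alpha> n i"
    and pairing_out: "edge i c b b' \<Longrightarrow> pairing (wt b) (hh i) = 1"
    and pairing_none: "i \<in> I n \<Longrightarrow> b \<in> B \<Longrightarrow> \<nexists>c b'. edge i c b b' \<or> edge i c b' b \<Longrightarrow>
      pairing (wt b) (hh i) = 0"
    and \<Phi>_out: "edge i c b b' \<Longrightarrow> \<Phi> \<epsilon> i b = psi_expansion (exp t) \<epsilon> c"
    and \<Phi>_in: "edge i c b b' \<Longrightarrow> \<Phi> \<epsilon> i b' = psi_expansion (inverse (exp t)) \<epsilon> c"
    and \<Phi>_none: "i \<in> I n \<Longrightarrow> b \<in> B \<Longrightarrow> \<nexists>c b'. edge i c b b' \<or> edge i c b' b \<Longrightarrow> \<Phi> \<epsilon> i b = 1"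
    and \<Phi>_adjacent: "edge j c b b' \<Longrightarrow> i \<in> I n \<Longrightarrow> i \<noteq> j \<Longrightarrow> adjacent n i j \<Longrightarrow>
      \<Phi> \<epsilon> i b' = \<Phi> \<epsilon> i b * psi_expansion (exp t) \<epsilon> (exp t * c)"
    and \<Phi>_far: "edge j c b b' \<Longrightarrow> i \<in> I n \<Longrightarrow> i \<noteq> j \<Longrightarrow> \<not> adjacent n i j \<Longrightarrow> \<Phi> \<epsilon> i b' = \<Phi> \<epsilon> i b"
    and edges_adjacent: "edge i c b b' \<Longrightarrow> edge j d b' b'' \<Longrightarrow> i \<noteq> j \<Longrightarrow> adjacent n i j \<Longrightarrow> d = exp t * c"
    and edges_far: "edge i c b b' \<Longrightarrow> edge j d b' b'' \<Longrightarrow> i \<noteq> j \<Longrightarrow> \<not> adjacent n i j \<Longrightarrow>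
      \<exists>b1. edge j d b b1 \<and> edge i c b1 b''"
    and edges_join: "edge i c b b'' \<Longrightarrow> edge j d b' b'' \<Longrightarrow> i \<noteq> j \<Longrightarrow> \<exists>b1. edge j d b1 b \<and> edge i c b1 b'"
    and edges_meet: "edge i c b'' b \<Longrightarrow> edge j d b'' b' \<Longrightarrow> i \<noteq> j \<Longrightarrow> \<exists>b1. edge j d b b1 \<and> edge i c b' b1"
begin

abbreviation "q \<equiv> exp t"

lemma q_sq: "q\<^sup>2 \<noteq> 1"
  using not_root by simp

lemma q_diff: "q - inverse q \<noteq> 0"
  using q_sq by (auto simp: power2_eq_square field_simps)

definition M where "M = basis_module t B X \<Phi> wt"

text \<open>An edge in the direction in which $x_i^\sigma$ acts, so that raising and lowering operators can be
treated together.\<close>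

definition arrow :: "sign \<Rightarrow> int \<Rightarrow> complex \<Rightarrow> 'b \<Rightarrow> 'b \<Rightarrow> bool" where
  "arrow \<sigma> i c b b' = (case \<sigma> of Neg \<Rightarrow> edge i c b b' | Pos \<Rightarrow> edge i c b' b)"

lemma arrow_dest: "arrow \<sigma> i c b b' \<Longrightarrow> i \<in> I n \<and> b \<in> B \<and> b' \<in> B \<and> c \<noteq> 0"
  using edge_dest by (auto simp: arrow_def split: sign.splits)

lemma X_arrow: "arrow \<sigma> i c b b' \<Longrightarrow> X \<sigma> i s b = c powi s *\<^sub>C basis_vec b'"
  using X_Neg X_Pos by (auto simp: arrow_def split: sign.splits)

lemma X_cases:
  assumes "i \<in> I n" "b \<in> B"
  obtains (zero) "\<And>s. X \<sigma> i s b = 0" "\<nexists>c b'. arrow \<sigma> i c b b'"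
  | (arrow) c b' where "arrow \<sigma> i c b b'" "\<And>s. X \<sigma> i s b = c powi s *\<^sub>C basis_vec b'"
proof (cases "\<exists>c b'. arrow \<sigma> i c b b'")
  case True
  then show ?thesis using that(2) X_arrow by blast
next
  case False
  moreover from this have "X \<sigma> i s b = 0" for s
    using X_Neg_zero X_Pos_zero assms by (cases \<sigma>) (auto simp: arrow_def)
  ultimately show ?thesis using that(1) by blast
qed

lemma pairing_in: "edge i c b b' \<Longrightarrow> pairing (wt b') (hh i) = - 1"
  using edge_dest pairing_out wt_edge by (simp add: pairing_diff_left pairing_\<alpha> cartan_def)

lemma pairing_arrow:
  assumes "arrow \<sigma> i c b b'"
  shows "pairing (wt b) (hh i) = - of_int (sg \<sigma>)" "pairing (wt b') (hh i) = of_int (sg \<sigma>)"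
  using assms pairing_out pairing_in by (auto simp: arrow_def split: sign.splits)

lemma wt_arrow:
  assumes "arrow \<sigma> j c b b'" "i \<in> I n"
  shows "pairing (wt b') (hh i) = pairing (wt b) (hh i) + of_int (sg \<sigma> * cartan n i j)"
proof (cases \<sigma>)
  case Pos
  then have "wt b = wt b' - \<alpha> n j" using assms(1) wt_edge by (simp add: arrow_def)
  then show ?thesis using Pos assms(2) by (simp add: pairing_diff_left pairing_\<alpha>)
next
  case Neg
  then have "wt b' = wt b - \<alpha> n j" using assms(1) wt_edge by (simp add: arrow_def)
  then show ?thesis using Neg assms(2) by (simp add: pairing_diff_left pairing_\<alpha>)
qed

lemma no_double_arrow:
  assumes "arrow \<sigma> i c b b'"
  shows "\<not> arrow \<sigma> i d b' b''"
  using pairing_arrow(2)[OF assms] pairing_arrow(1)[of \<sigma> i d b' b''] by (cases \<sigma>) auto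

lemma space_M [simp]: "space M = supported_on B"
  and xop_M [simp]: "xop M \<sigma> i s = lin_ext (X \<sigma> i s)"
  and kop_M [simp]: "kop M h = diag (\<lambda>b. qpow t (pairing (wt b) h))"
  by (simp_all add: M_def basis_module_def supported_on_def diag_def)

lemma hop_M: "\<exists>e. hop M i m = diag e"
  by (auto simp: M_def basis_module_def diag_def)

lemma X_supported: "i \<in> I n \<Longrightarrow> b \<in> B \<Longrightarrow> X \<sigma> i s b \<in> supported_on B"
  by (cases rule: X_cases[of i b \<sigma>])
    (auto intro!: cvs.subspace_scale[OF subspace_supported_on] cvs.subspace_0[OF subspace_supported_on]
      dest: arrow_dest)

lemma xop_supported: "i \<in> I n \<Longrightarrow> v \<in> supported_on B \<Longrightarrow> lin_ext (X \<sigma> i s) v \<in> supported_on B"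
  by (rule lin_ext_supported) (auto intro: X_supported)

definition phi_coeff :: "sign \<Rightarrow> int \<Rightarrow> int \<Rightarrow> 'b \<Rightarrow> complex" where
  "phi_coeff \<epsilon> i s b = int_coeff \<epsilon> (\<Phi> \<epsilon> i b) s"

lemma phi_M:
  assumes "i \<in> I n" "v \<in> supported_on B"
  shows "phi q M \<epsilon> i s v = diag (phi_coeff \<epsilon> i s) v"
  unfolding M_def phi_coeff_def
proof (rule phi_basis_module[OF q_sq assms(2)])
  fix b assume b: "b \<in> B"
  consider (out) c b' where "edge i c b b'" | (inn) c b' where "edge i c b' b"
    | (none) "\<nexists>c b'. edge i c b b' \<or> edge i c b' b"
    by blast
  then show "fps_nth (\<Phi> \<epsilon> i b) 0 = qpow t (pairing (wt b) (case \<epsilon> of Pos \<Rightarrow> hh i | Neg \<Rightarrow> - hh i))"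
  proof cases
    case out
    then show ?thesis using edge_dest[OF out]
      by (simp add: \<Phi>_out pairing_out psi_expansion_nth_0 pairing_uminus_right split: sign.split
          del: psi_expansion.simps)
  next
    case inn
    then show ?thesis using edge_dest[OF inn]
      by (simp add: \<Phi>_in pairing_in psi_expansion_nth_0 pairing_uminus_right split: sign.split
          del: psi_expansion.simps)
  next
    case none
    then show ?thesis using b assms(1)
      by (simp add: \<Phi>_none pairing_none pairing_uminus_right split: sign.split)
  qed
qed

text \<open>This is the relation between $\phi_i(z)$ and $x_j^\sigma(w)$ on one basis vector: there
$x_j^\sigma(w)$ contains $\delta(cw)$, so $w$ may be replaced by $c^{-1}$. The case of a raising
operator is obtained from that of a lowering operator by multiplication with \<open>Q\<close>.\<close>

lemma \<Phi>_arrow: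
  assumes "arrow \<sigma> j c b b'" "i \<in> I n"
  defines "Q \<equiv> q powi (sg \<sigma> * cartan n i j)"
  shows "\<Phi> \<epsilon> i b' * lin_factor \<epsilon> 1 (Q * c) = \<Phi> \<epsilon> i b * lin_factor \<epsilon> Q c"
proof -
  have edge: "\<Phi> \<epsilon> i b' * lin_factor \<epsilon> 1 (R * c) = \<Phi> \<epsilon> i b * lin_factor \<epsilon> R c"
    if e: "edge j c b b'" and R: "R = q powi (- cartan n i j)" for b b' R
  proof -
    have c: "c \<noteq> 0" using edge_dest[OF e] by simp
    consider "i = j" | "i \<noteq> j" "adjacent n i j" | "i \<noteq> j" "\<not> adjacent n i j" by blast
    then show ?thesis
    proof cases
      case 1
      have R': "R = inverse q * inverse q" using R 1 by (simp add: cartan_def power_int_minus power2_eq_square)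
      let ?D = "lin_factor \<epsilon> 1 c"
      have "?D \<noteq> 0" using lin_factor_inverse[of 1 c \<epsilon>] c by (metis mult_zero_left one_neq_zero)
      have "lin_factor \<epsilon> (inverse q) (q * c) = fps_const q * lin_factor \<epsilon> R c"
        using lin_factor_scale[of \<epsilon> q R c] by (simp add: R' flip: mult.assoc)
      moreover have "lin_factor \<epsilon> 1 (R * c) = fps_const (inverse q) * lin_factor \<epsilon> q (inverse q * c)"
        using lin_factor_scale[of \<epsilon> "inverse q" q "inverse q * c"] by (simp add: R' mult.assoc)
      moreover have "fps_const q * fps_const (inverse q) = 1" by simp
      ultimately have *: "lin_factor \<epsilon> (inverse q) (q * c) * lin_factor \<epsilon> 1 (R * c)
          = lin_factor \<epsilon> q (inverse q * c) * lin_factor \<epsilon> R c"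
        by (metis (no_types, opaque_lifting) mult.assoc mult.commute mult.left_neutral)
      have "\<Phi> \<epsilon> i b' * lin_factor \<epsilon> 1 (R * c) * ?D = (\<Phi> \<epsilon> i b' * ?D) * lin_factor \<epsilon> 1 (R * c)"
        by (simp only: mult_ac)
      also have "\<dots> = lin_factor \<epsilon> (inverse q) (q * c) * lin_factor \<epsilon> 1 (R * c)"
        using psi_expansion_mult[OF c, of "inverse q" \<epsilon>] \<Phi>_in[OF e] 1 by simp
      also have "\<dots> = (\<Phi> \<epsilon> i b * ?D) * lin_factor \<epsilon> R c"
        using psi_expansion_mult[OF c, of q \<epsilon>] \<Phi>_out[OF e] 1 * by simp
      also have "\<dots> = \<Phi> \<epsilon> i b * lin_factor \<epsilon> R c * ?D" by (simp only: mult_ac)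
      finally show ?thesis using \<open>?D \<noteq> 0\<close> by simp
    next
      case 2
      have "R = q" using 2 R by (simp add: cartan_def)
      moreover have "psi_expansion q \<epsilon> (q * c) * lin_factor \<epsilon> 1 (q * c) = lin_factor \<epsilon> q c"
        using psi_expansion_mult[of "q * c" q \<epsilon>] c
        by (simp del: psi_expansion.simps lin_factor.simps flip: mult.assoc)
      ultimately show ?thesis using \<Phi>_adjacent[OF e assms(2) 2] by (simp only: mult.assoc)
    next
      case 3
      then show ?thesis using R \<Phi>_far[OF e assms(2) 3] by (simp add: cartan_def)
    qed
  qed
  show ?thesis
  proof (cases \<sigma>)
    case Neg
    then show ?thesis using edge assms(1) by (simp add: Q_def arrow_def)
  next
    case Pos
    have Q: "Q * inverse Q = 1" by (simp add: Q_def)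
    have "\<Phi> \<epsilon> i b * lin_factor \<epsilon> 1 (inverse Q * c) = \<Phi> \<epsilon> i b' * lin_factor \<epsilon> (inverse Q) c"
      using edge[of b' b "inverse Q"] assms(1) Pos by (simp add: Q_def arrow_def power_int_minus)
    then have "\<Phi> \<epsilon> i b * (fps_const Q * lin_factor \<epsilon> 1 (inverse Q * c))
        = \<Phi> \<epsilon> i b' * (fps_const Q * lin_factor \<epsilon> (inverse Q) c)"
      by (metis mult.left_commute)
    moreover have "Q * (inverse Q * c) = c" using Q by (metis mult.assoc mult_1)
    ultimately show ?thesis using Q by (simp only: mult_1_right flip: lin_factor_scale)
  qed
qed

lemma phi_coeff_arrow:
  assumes "arrow \<sigma> j c b b'" "i \<in> I n"
  defines "Q \<equiv> q powi (sg \<sigma> * cartan n i j)"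
  shows "phi_coeff \<epsilon> i s b' - Q * c * phi_coeff \<epsilon> i (s - 1) b'
    = Q * phi_coeff \<epsilon> i s b - c * phi_coeff \<epsilon> i (s - 1) b"
  using int_coeff_lin_factor[OF \<Phi>_arrow[OF assms(1,2), of \<epsilon>], of s]
  by (simp add: phi_coeff_def Q_def)

lemma linear_eq_on_space:
  assumes "linear_map f" "linear_map g"
    and "\<And>b. b \<in> B \<Longrightarrow> f (basis_vec b) = g (basis_vec b)"
  shows "\<forall>v\<in>supported_on B. f v = g v"
proof
  fix v assume "v \<in> supported_on B"
  then show "f v = g v"
    by (intro linear_map_eqI[OF assms(1,2), of v] assms(3)) (auto simp: supported_on_def)
qed

lemma M_rel_phi_x: "rel_phi_x n q M"
  unfolding rel_phi_x_def
proof (intro ballI allI)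
  fix v i j \<epsilon> \<sigma> a s
  assume v: "v \<in> space M" and i: "i \<in> I n" and j: "j \<in> I n"
  define Q where "Q = q powi (sg \<sigma> * cartan n i j)"
  let ?\<phi> = "\<lambda>s. diag (phi_coeff \<epsilon> i s)" and ?x = "\<lambda>s. lin_ext (X \<sigma> j s)"
  have "\<forall>v\<in>supported_on B. ?\<phi> a (?x (s - 1) v) - Q *\<^sub>C ?\<phi> (a - 1) (?x s v) = Q *\<^sub>C ?x (s - 1) (?\<phi> a v) - ?x s (?\<phi> (a - 1) v)"
  proof (rule linear_eq_on_space)
    fix b assume b: "b \<in> B"
    show "?\<phi> a (?x (s - 1) (basis_vec b)) - Q *\<^sub>C ?\<phi> (a - 1) (?x s (basis_vec b))
        = Q *\<^sub>C ?x (s - 1) (?\<phi> a (basis_vec b)) - ?x s (?\<phi> (a - 1) (basis_vec b))"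
    proof (cases rule: X_cases[OF j b, of \<sigma>, case_names zero arrow])
      case (arrow c b')
      have "c powi (s - 1) * (phi_coeff \<epsilon> i a b' - Q * c * phi_coeff \<epsilon> i (a - 1) b')
          = c powi (s - 1) * (Q * phi_coeff \<epsilon> i a b - c * phi_coeff \<epsilon> i (a - 1) b)"
        using phi_coeff_arrow[OF arrow(1) i, of \<epsilon> a] by (simp only: Q_def)
      moreover have "c powi s = c powi (s - 1) * c"
        using arrow_dest[OF arrow(1)] powi_pred by blast
      ultimately have *: "c powi (s - 1) * phi_coeff \<epsilon> i a b' - Q * (c powi s * phi_coeff \<epsilon> i (a - 1) b')
          = Q * (phi_coeff \<epsilon> i a b * c powi (s - 1)) - phi_coeff \<epsilon> i (a - 1) b * c powi s"
        by (simp only: right_diff_distrib mult_ac)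
      show ?thesis
        unfolding lin_ext_basis_vec diag_basis_vec arrow(2) lin_ext_scaleC diag_scaleC cvs.scale_scale
          cvs.scale_left_diff_distrib[symmetric] * by (rule refl)
    qed (simp add: lin_ext_scaleC)
  qed (intro linear_map_intros linear_map_diag_comp linear_map_diag)+
  with v i j show "phi q M \<epsilon> i a (xop M \<sigma> j (s - 1) v)
      - (q powi (sg \<sigma> * cartan n i j)) *\<^sub>C phi q M \<epsilon> i (a - 1) (xop M \<sigma> j s v)
    = (q powi (sg \<sigma> * cartan n i j)) *\<^sub>C xop M \<sigma> j (s - 1) (phi q M \<epsilon> i a v)
      - xop M \<sigma> j s (phi q M \<epsilon> i (a - 1) v)"
    by (simp add: phi_M xop_supported Q_def)
qed

text \<open>The product of two operators on a basis vector either vanishes or follows a unique path.\<close>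

lemma path_cases:
  assumes "i \<in> I n" "j \<in> I n" "b \<in> B"
  obtains (zero) "\<And>a s. lin_ext (X \<sigma> i a) (X \<tau> j s b) = 0"
      "\<nexists>c d b' b''. arrow \<tau> j d b b' \<and> arrow \<sigma> i c b' b''"
  | (path) c d b' b'' where "arrow \<tau> j d b b'" "arrow \<sigma> i c b' b''"
      "\<And>a s. lin_ext (X \<sigma> i a) (X \<tau> j s b) = (c powi a * d powi s) *\<^sub>C basis_vec b''"
proof (cases rule: X_cases[OF assms(2,3), of \<tau>, case_names zero arrow])
  case zero
  then show ?thesis using that(1) by (metis lin_ext_zero)
next
  case 1: (arrow d b')
  then have "b' \<in> B" using arrow_dest by blast
  show ?thesis
  proof (cases rule: X_cases[OF assms(1) \<open>b' \<in> B\<close>, of \<sigma>, case_names zero arrow])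
    case zero
    have "\<not> (arrow \<tau> j d' b b1 \<and> arrow \<sigma> i c' b1 b2)" for c' d' b1 b2
    proof
      assume "arrow \<tau> j d' b b1 \<and> arrow \<sigma> i c' b1 b2"
      then have "b1 = b'" using 1(1) edge_out_unique edge_in_unique
        by (cases \<tau>) (auto simp: arrow_def)
      then show False using zero \<open>arrow \<tau> j d' b b1 \<and> arrow \<sigma> i c' b1 b2\<close> by blast
    qed
    then show ?thesis using that(1) 1 zero by (simp add: lin_ext_scaleC)
  next
    case (arrow c b'')
    then show ?thesis using that(2) 1 by (simp add: lin_ext_scaleC mult.commute)
  qed
qed

lemma xop_commute_on_basis:
  assumes "i \<in> I n" "j \<in> I n" "b \<in> B"
    and ij: "\<And>c d b1 b2. arrow \<tau> j d b b1 \<Longrightarrow> arrow \<sigma> i c b1 b2 \<Longrightarrow> \<exists>b1'. arrow \<sigma> i c b b1' \<and> arrow \<tau> j d b1' b2"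
    and ji: "\<And>c d b1 b2. arrow \<sigma> i c b b1 \<Longrightarrow> arrow \<tau> j d b1 b2 \<Longrightarrow> \<exists>b1'. arrow \<tau> j d b b1' \<and> arrow \<sigma> i c b1' b2"
  shows "lin_ext (X \<sigma> i a) (X \<tau> j s b) = lin_ext (X \<tau> j s) (X \<sigma> i a b)"
proof (cases rule: path_cases[OF assms(1-3), of \<sigma> \<tau>, case_names zero path])
  case zero
  then show ?thesis using ji
    by (cases rule: path_cases[OF assms(2,1,3), of \<tau> \<sigma>, case_names zero path]) (simp, blast)
next
  case (path c d b' b'')
  then obtain b1 where "arrow \<sigma> i c b b1" "arrow \<tau> j d b1 b''" using ij by blast
  then show ?thesis using path(3) by (simp add: X_arrow lin_ext_scaleC mult.commute)
qed

lemma arrow_far: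
  assumes "arrow \<sigma> j d b b'" "arrow \<sigma> i c b' b''" "i \<noteq> j" "\<not> adjacent n i j"
  shows "\<exists>b1. arrow \<sigma> i c b b1 \<and> arrow \<sigma> j d b1 b''"
proof (cases \<sigma>)
  case Neg
  have "\<not> adjacent n j i" using assms arrow_dest adjacent_sym by blast
  then show ?thesis using edges_far[of j d b b' i c b''] assms Neg by (simp add: arrow_def)
next
  case Pos
  then show ?thesis using edges_far[of i c b'' b' j d b] assms by (auto simp: arrow_def)
qed

lemma xop_commute_far:
  assumes "i \<in> I n" "j \<in> I n" "b \<in> B" "i \<noteq> j" "\<not> adjacent n i j"
  shows "lin_ext (X \<sigma> i a) (X \<sigma> j s b) = lin_ext (X \<sigma> j s) (X \<sigma> i a b)"
proof (rule xop_commute_on_basis[OF assms(1-3)])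
  have "\<not> adjacent n j i" using assms adjacent_sym by blast
  then show "\<exists>b1'. arrow \<sigma> j d b b1' \<and> arrow \<sigma> i c b1' b2"
    if "arrow \<sigma> i c b b1" "arrow \<sigma> j d b1 b2" for c d b1 b2
    using arrow_far[OF that] assms(4) by simp
  show "\<exists>b1'. arrow \<sigma> i c b b1' \<and> arrow \<sigma> j d b1' b2"
    if "arrow \<sigma> j d b b1" "arrow \<sigma> i c b1 b2" for c d b1 b2
    using arrow_far[OF that] assms(4,5) by simp
qed

lemma xop_commute_opposite:
  assumes "i \<in> I n" "j \<in> I n" "b \<in> B" "i \<noteq> j"
  shows "lin_ext (X Pos i a) (X Neg j s b) = lin_ext (X Neg j s) (X Pos i a b)"
proof (rule xop_commute_on_basis[OF assms(1-3)])
  show "\<exists>b1'. arrow Pos i c b b1' \<and> arrow Neg j d b1' b2"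
    if "arrow Neg j d b b1" "arrow Pos i c b1 b2" for c d b1 b2
    using edges_join[of i c b2 b1 j d b] that assms(4) by (auto simp: arrow_def)
  show "\<exists>b1'. arrow Neg j d b b1' \<and> arrow Pos i c b1' b2"
    if "arrow Pos i c b b1" "arrow Neg j d b1 b2" for c d b1 b2
    using edges_meet[of i c b1 b j d b2] that assms(4) by (auto simp: arrow_def)
qed

lemma M_rel_x_commute: "rel_x_commute n M"
  unfolding rel_x_commute_def
proof (intro ballI allI impI)
  fix v i j \<sigma> a s
  assume v: "v \<in> space M" and ij: "i \<in> I n" "j \<in> I n" "i \<noteq> j \<and> \<not> adjacent n i j"
  have "\<forall>v\<in>supported_on B. lin_ext (X \<sigma> i a) (lin_ext (X \<sigma> j s) v)
      = lin_ext (X \<sigma> j s) (lin_ext (X \<sigma> i a) v)"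
  proof (rule linear_eq_on_space)
    show "lin_ext (X \<sigma> i a) (lin_ext (X \<sigma> j s) (basis_vec b))
        = lin_ext (X \<sigma> j s) (lin_ext (X \<sigma> i a) (basis_vec b))" if "b \<in> B" for b
      unfolding lin_ext_basis_vec using xop_commute_far ij that by blast
  qed (intro linear_map_intros)+
  with v show "xop M \<sigma> i a (xop M \<sigma> j s v) = xop M \<sigma> j s (xop M \<sigma> i a v)" by simp
qed

text \<open>Along a path against the direction of the edges the two parameters occur in the opposite order,
hence the sign in the exponent.\<close>

lemma x_arrow_adjacent:
  assumes "arrow \<sigma> j d b b'" "arrow \<sigma> i c b' b''" "i \<noteq> j" "adjacent n i j"
  shows "c = q powi (- sg \<sigma>) * d"
proof (cases \<sigma>)
  case Neg
  have "adjacent n j i" using assms adjacent_sym arrow_dest by blast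
  then show ?thesis using assms edges_adjacent[of j d b b' i c b''] Neg by (auto simp: arrow_def)
next
  case Pos
  have "d = q * c" using assms edges_adjacent[of i c b'' b' j d b] Pos by (auto simp: arrow_def)
  then show ?thesis using Pos by (simp add: power_int_minus)
qed

text \<open>For adjacent colours each of the two products is annihilated by its own factor: the path has
parameters $d$ and $Qd$, and the factor vanishes at the point where the delta functions are
supported. For equal colours the products are zero, and for the others the factor cancels against
that of the commuting product.\<close>

lemma M_rel_x_x: "rel_x_x n q M"
  unfolding rel_x_x_def
proof (intro ballI allI)
  fix v i j \<sigma> a s
  assume v: "v \<in> space M" and i: "i \<in> I n" and j: "j \<in> I n"
  define Q where "Q = q powi (sg \<sigma> * cartan n i j)"
  let ?x = "\<lambda>s. lin_ext (X \<sigma> i s)" and ?y = "\<lambda>s. lin_ext (X \<sigma> j s)"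
  have "\<forall>v\<in>supported_on B. ?x a (?y (s - 1) v) - Q *\<^sub>C ?x (a - 1) (?y s v) = Q *\<^sub>C ?y (s - 1) (?x a v) - ?y s (?x (a - 1) v)"
  proof (rule linear_eq_on_space)
    fix b assume b: "b \<in> B"
    consider "i = j" | "i \<noteq> j" "adjacent n i j" | "i \<noteq> j" "\<not> adjacent n i j" by blast
    then show "?x a (?y (s - 1) (basis_vec b)) - Q *\<^sub>C ?x (a - 1) (?y s (basis_vec b))
        = Q *\<^sub>C ?y (s - 1) (?x a (basis_vec b)) - ?y s (?x (a - 1) (basis_vec b))"
    proof cases
      case 1
      have "?x a (?x s (basis_vec b)) = 0" for a s
        by (cases rule: path_cases[OF i i b, of \<sigma> \<sigma>, case_names zero path]) (auto dest: no_double_arrow)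
      then show ?thesis using 1 by simp
    next
      case 2
      have Q: "Q = q powi (- sg \<sigma>)" using 2 by (simp add: Q_def cartan_def)
      have "adjacent n j i" using 2 i adjacent_sym by blast
      have "?x a (?y (s - 1) (basis_vec b)) - Q *\<^sub>C ?x (a - 1) (?y s (basis_vec b)) = 0"
      proof (cases rule: path_cases[OF i j b, of \<sigma> \<sigma>, case_names zero path])
        case (path c d b' b'')
        have "c = Q * d" using x_arrow_adjacent[OF path(1,2)] 2 Q by simp
        moreover have "c powi a = c powi (a - 1) * c" "d powi s = d powi (s - 1) * d"
          using path(1,2) arrow_dest powi_pred by blast+
        ultimately show ?thesis using path(3)
          by (simp flip: cvs.scale_left_diff_distrib)
      qed simp
      moreover have "Q *\<^sub>C ?y (s - 1) (?x a (basis_vec b)) - ?y s (?x (a - 1) (basis_vec b)) = 0"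
      proof (cases rule: path_cases[OF j i b, of \<sigma> \<sigma>, case_names zero path])
        case (path d c b' b'')
        have "d = Q * c" using x_arrow_adjacent[OF path(1,2)] 2 Q \<open>adjacent n j i\<close> by simp
        moreover have "c powi a = c powi (a - 1) * c" "d powi s = d powi (s - 1) * d"
          using path(1,2) arrow_dest powi_pred by blast+
        ultimately show ?thesis using path(3)
          by (simp flip: cvs.scale_left_diff_distrib)
      qed simp
      ultimately show ?thesis by simp
    next
      case 3
      then show ?thesis using xop_commute_far[OF i j b] by (simp add: Q_def cartan_def)
    qed
  qed (intro linear_map_intros)+
  with v show "xop M \<sigma> i a (xop M \<sigma> j (s - 1) v)
       - (q powi (sg \<sigma> * cartan n i j)) *\<^sub>C xop M \<sigma> i (a - 1) (xop M \<sigma> j s v)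
     = (q powi (sg \<sigma> * cartan n i j)) *\<^sub>C xop M \<sigma> j (s - 1) (xop M \<sigma> i a v)
       - xop M \<sigma> j s (xop M \<sigma> i (a - 1) v)"
    by (simp add: Q_def)
qed

lemma M_rel_x_x_opposite: "rel_x_x_opposite n q M"
  unfolding rel_x_x_opposite_def
proof (intro ballI allI)
  fix v i j a s
  assume v: "v \<in> space M" and i: "i \<in> I n" and j: "j \<in> I n"
  let ?\<phi> = "\<lambda>\<epsilon> s. diag (phi_coeff \<epsilon> i s)"
  let ?x = "\<lambda>s. lin_ext (X Pos i s)" and ?y = "\<lambda>s. lin_ext (X Neg j s)"
  define \<kappa> where "\<kappa> = (if i = j then 1 / (q - inverse q) else 0)"
  have "\<forall>v\<in>supported_on B. ?x a (?y s v) - ?y s (?x a v) = \<kappa> *\<^sub>C (?\<phi> Pos (a + s) v - ?\<phi> Neg (a + s) v)"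
  proof (rule linear_eq_on_space)
    fix b assume b: "b \<in> B"
    show "?x a (?y s (basis_vec b)) - ?y s (?x a (basis_vec b))
      = \<kappa> *\<^sub>C (?\<phi> Pos (a + s) (basis_vec b) - ?\<phi> Neg (a + s) (basis_vec b))"
    proof (cases "i = j")
      case False
      then show ?thesis using xop_commute_opposite[OF i j b] by (simp add: \<kappa>_def)
    next
      case True
      consider (out) c b' where "edge i c b b'" | (inn) c b' where "edge i c b' b"
        | (none) "\<nexists>c b'. edge i c b b' \<or> edge i c b' b"
        by blast
      then show ?thesis
      proof cases
        case out
        then have c: "c \<noteq> 0" using edge_dest by blast
        have "\<nexists>c b'. edge i c b' b" using pairing_in pairing_out[OF out] by fastforce
        then have "X Pos i a b = 0" using X_Pos_zero i b by blast
        moreover have "phi_coeff Pos i (a + s) b - phi_coeff Neg i (a + s) b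
            = (q - inverse q) * (c powi a * c powi s)"
          using psi_expansion_delta[of q c "a + s"] c \<Phi>_out[OF out]
          by (simp add: phi_coeff_def power_int_add)
        ultimately show ?thesis using True out q_diff
          by (simp add: X_Neg X_Pos lin_ext_scaleC \<kappa>_def mult.commute flip: cvs.scale_left_diff_distrib)
      next
        case inn
        then have c: "c \<noteq> 0" using edge_dest by blast
        have "\<nexists>c b'. edge i c b b'" using pairing_in[OF inn] pairing_out by fastforce
        then have "X Neg i s b = 0" using X_Neg_zero i b by blast
        moreover have "phi_coeff Pos i (a + s) b - phi_coeff Neg i (a + s) b
            = - ((q - inverse q) * (c powi a * c powi s))"
          using psi_expansion_delta[of "inverse q" c "a + s"] c \<Phi>_in[OF inn]
          by (simp add: phi_coeff_def power_int_add algebra_simps)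
        ultimately show ?thesis using True inn q_diff
          by (simp add: X_Neg X_Pos lin_ext_scaleC \<kappa>_def flip: cvs.scale_left_diff_distrib)
      next
        case none
        then have "X Pos i a b = 0" "X Neg i s b = 0" "\<Phi> \<epsilon> i b = 1" for \<epsilon>
          using X_Pos_zero X_Neg_zero \<Phi>_none i b by blast+
        then show ?thesis using True
          by (auto simp: phi_coeff_def int_coeff_def)
      qed
    qed
  qed (intro linear_map_intros linear_map_diag)+
  then show "xop M Pos i a (xop M Neg j s v) - xop M Neg j s (xop M Pos i a v)
     = (if i = j then (1 / (q - inverse q)) *\<^sub>C (phi q M Pos i (a + s) v - phi q M Neg i (a + s) v) else 0)"
    using v j by (cases "i = j") (simp_all add: \<kappa>_def phi_M)
qed

text \<open>Every term vanishes separately: two operators of the same colour compose to zero, and a path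
with colours $i$, $j$, $i$ is impossible, as after its first two steps the weight is $0$ on $h_i$.\<close>

lemma M_rel_serre:
  assumes "n \<ge> 2"
  shows "rel_serre n q M"
  unfolding rel_serre_def
proof (intro ballI allI impI)
  fix v i j \<sigma> a b c
  assume v: "v \<in> space M" and i: "i \<in> I n" and j: "j \<in> I n" and adj: "adjacent n i j"
  have ij: "i \<noteq> j" using adjacent_neq[OF _ i adj] assms by simp
  let ?x = "\<lambda>s. lin_ext (X \<sigma> i s)" and ?y = "\<lambda>s. lin_ext (X \<sigma> j s)"
  have xx: "\<forall>v\<in>supported_on B. ?x a (?x b v) = 0" for a b
  proof (rule linear_eq_on_space)
    fix b0 assume b0: "b0 \<in> B"
    show "?x a (?x b (basis_vec b0)) = 0"
      by (cases rule: path_cases[OF i i b0, of \<sigma> \<sigma>, case_names zero path])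
        (auto dest: no_double_arrow)
  qed (intro linear_map_intros)+
  have xyx: "\<forall>v\<in>supported_on B. ?x a (?y c (?x b v)) = 0" for a b c
  proof (rule linear_eq_on_space)
    fix b0 assume b0: "b0 \<in> B"
    show "?x a (?y c (?x b (basis_vec b0))) = 0"
    proof (cases rule: path_cases[OF j i b0, of \<sigma> \<sigma>, case_names zero path])
      case (path d e b1 b2)
      have "pairing (wt b2) (hh i) = 0"
        using pairing_arrow(2)[OF path(1)] wt_arrow[OF path(2) i] adj ij by (simp add: cartan_def)
      then have "\<nexists>c b'. arrow \<sigma> i c b2 b'" using pairing_arrow(1) by (cases \<sigma>) fastforce+
      moreover have "b2 \<in> B" using path(2) arrow_dest by blast
      ultimately have "X \<sigma> i a b2 = 0" using X_cases[OF i] by blast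
      then show ?thesis using path(3) by (simp add: lin_ext_scaleC)
    qed simp
  qed (intro linear_map_intros)+
  show "serre_term q M \<sigma> i j a b c v + serre_term q M \<sigma> i j b a c v = 0"
    using v i j by (simp add: serre_term_def xx xyx xop_supported)
qed

lemma tor_module_M:
  assumes "n \<ge> 2"
  shows "tor_module n q M"
  unfolding tor_module_def
proof (intro conjI M_rel_phi_x M_rel_x_x_opposite M_rel_x_x M_rel_serre[OF assms] M_rel_x_commute)
  show "cvs.subspace (space M)" by (simp add: subspace_supported_on)
  show "\<forall>\<sigma>. \<forall>i\<in>I n. \<forall>s. linear_on (space M) (space M) (xop M \<sigma> i s)"
    by (simp add: linear_on_def xop_supported lin_ext_add lin_ext_scaleC)
  have diag: "linear_on (supported_on B) (supported_on B) (diag e)" for e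
    using linear_map_diag[of e] by (simp add: linear_on_def diag_supported)
  show "\<forall>i\<in>I n. \<forall>m. m \<noteq> 0 \<longrightarrow> linear_on (space M) (space M) (hop M i m)"
  proof (intro ballI allI impI)
    fix i m
    obtain e where "hop M i m = diag e" using hop_M by blast
    then show "linear_on (space M) (space M) (hop M i m)" by (simp add: diag)
  qed
  show "\<forall>h\<in>\<hh> n. linear_on (space M) (space M) (kop M h)"
    by (simp add: diag)
  show "rel_k n M"
    by (simp add: rel_k_def diag_one diag_diag pairing_add_right qpow_add)
  show "rel_phi_phi n q M"
    unfolding rel_phi_phi_def space_M
  proof (intro ballI allI)
    fix v i j \<epsilon> \<epsilon>' a b
    assume "v \<in> supported_on B" "i \<in> I n" "j \<in> I n"
    then show "phi q M \<epsilon> i a (phi q M \<epsilon>' j b v) = phi q M \<epsilon>' j b (phi q M \<epsilon> i a v)"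
      by (simp add: phi_M diag_supported diag_diag mult.commute)
  qed
qed

section \<open>Extremality of graph modules\<close>

lemma weight_space_basis_vec: "b \<in> B \<Longrightarrow> basis_vec b \<in> weight_space n t M (wt b)"
  by (simp add: weight_space_def)

text \<open>A weight is determined by its pairing with the basis of $\mathfrak h$, and $q$ is not a root of
unity; so each basis vector in the support of a weight vector has the weight of that vector. This
makes the sum of the weight spaces direct.\<close>

lemma lookup_weight_space:
  assumes "v \<in> weight_space n t M \<mu>" "\<mu> \<in> weight_lattice n" "Poly_Mapping.lookup v b \<noteq> 0"
  shows "wt b = \<mu>"
proof (rule poly_mapping_eqI)
  have "b \<in> B" using assms by (auto simp: weight_space_def supported_on_def in_keys_iff)
  then have wt: "wt b \<in> weight_lattice n" by (rule wt_in_lattice)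
  fix x
  show "Poly_Mapping.lookup (wt b) x = Poly_Mapping.lookup \<mu> x"
  proof (cases "x \<in> hbasis n")
    case True
    let ?h = "Poly_Mapping.single x 1 :: cartan_basis \<Rightarrow>\<^sub>0 rat"
    have "?h \<in> \<hh> n" using True by (simp add: \<hh>_def)
    then have "kop M ?h v = qpow t (pairing \<mu> ?h) *\<^sub>C v"
      using assms(1) unfolding weight_space_def by blast
    from arg_cong[OF this, of "\<lambda>w. Poly_Mapping.lookup w b"]
    have "qpow t (Poly_Mapping.lookup (wt b) x) * Poly_Mapping.lookup v b
        = qpow t (Poly_Mapping.lookup \<mu> x) * Poly_Mapping.lookup v b"
      by (simp only: kop_M lookup_diag lookup_scaleC pairing_single)
    then show ?thesis using assms(3) qpow_injective[OF not_root] by simp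
  next
    case False
    then have "x \<notin> Poly_Mapping.keys (wt b)" "x \<notin> Poly_Mapping.keys \<mu>"
      using wt assms(2) by (auto simp: weight_lattice_def)
    then show ?thesis by (simp add: in_keys_iff)
  qed
qed

lemma X_square_zero: "i \<in> I n \<Longrightarrow> \<forall>v\<in>supported_on B. lin_ext (X \<sigma> i a) (lin_ext (X \<sigma> i s) v) = 0"
proof (rule linear_eq_on_space)
  fix b assume i: "i \<in> I n" and b: "b \<in> B"
  show "lin_ext (X \<sigma> i a) (lin_ext (X \<sigma> i s) (basis_vec b)) = 0"
    by (cases rule: path_cases[OF i i b, of \<sigma> \<sigma>, case_names zero path]) (auto dest: no_double_arrow)
qed (intro linear_map_intros)+

lemma integrable_M: "integrable n t M"
  unfolding integrable_def
proof (intro conjI allI ballI impI)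
  let ?U = "\<Union>\<mu>\<in>weight_lattice n. weight_space n t M \<mu>"
  have "basis_vec ` B \<subseteq> ?U"
    using weight_space_basis_vec wt_in_lattice by blast
  then have "supported_on B \<subseteq> cvs.span ?U"
    unfolding supported_on_eq_span by (rule cvs.span_mono)
  moreover have "?U \<subseteq> supported_on B"
    by (auto simp: weight_space_def)
  then have "cvs.span ?U \<subseteq> supported_on B"
    by (rule cvs.span_minimal[OF _ subspace_supported_on])
  ultimately show "space M = cvs.span ?U" by simp
next
  fix L f \<mu>
  assume L: "finite L \<and> L \<subseteq> weight_lattice n \<and> (\<forall>\<mu>\<in>L. f \<mu> \<in> weight_space n t M \<mu>) \<and> (\<Sum>\<mu>\<in>L. f \<mu>) = 0"
    and \<mu>: "\<mu> \<in> L"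
  show "f \<mu> = 0"
  proof (rule poly_mapping_eqI, rule ccontr)
    fix b assume "Poly_Mapping.lookup (f \<mu>) b \<noteq> Poly_Mapping.lookup 0 b"
    then have nz: "Poly_Mapping.lookup (f \<mu>) b \<noteq> 0" by simp
    then have wt: "wt b = \<mu>" using lookup_weight_space L \<mu> by blast
    have "Poly_Mapping.lookup (f \<nu>) b = 0" if "\<nu> \<in> L - {\<mu>}" for \<nu>
      using lookup_weight_space[of "f \<nu>" \<nu> b] L that wt by auto
    then have "(\<Sum>\<nu>\<in>L. Poly_Mapping.lookup (f \<nu>) b) = Poly_Mapping.lookup (f \<mu>) b"
      using L \<mu> by (simp add: sum.remove)
    then have "Poly_Mapping.lookup (\<Sum>\<nu>\<in>L. f \<nu>) b \<noteq> 0" using nz by (simp add: lookup_sum)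
    then show False using L by simp
  qed
next
  fix \<sigma> i v
  assume "i \<in> I n" "v \<in> space M"
  then have "(xop M \<sigma> i 0 ^^ 2) v = 0" using X_square_zero by (simp add: numeral_2_eq_2)
  then show "\<exists>N. (xop M \<sigma> i 0 ^^ N) v = 0" ..
qed

lemma i_extremal_basis_vec:
  assumes b: "b \<in> B" and i: "i \<in> I n"
  shows "i_extremal n t M i (wt b) (basis_vec b)"
proof -
  have "X \<sigma> i 0 b = 0" if "of_int (sg \<sigma>) * pairing (wt b) (hh i) \<ge> 0" for \<sigma>
  proof (cases rule: X_cases[OF i b, of \<sigma>, case_names zero arrow])
    case (arrow c b')
    then show ?thesis using that pairing_arrow(1)[OF arrow(1)] by (cases \<sigma>) simp_all
  qed simp
  from this[of Pos] this[of Neg] show ?thesis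
    using weight_space_basis_vec[OF b] by (simp add: i_extremal_def)
qed

text \<open>The weight is $1$, $-1$ or $0$ on $h_i$, so $S_i$ follows the edge of colour $i$ at \<open>b\<close> in one
direction or the other, or fixes the basis vector if there is no such edge.\<close>

lemma reflect_basis_vec:
  assumes b: "b \<in> B" and i: "i \<in> I n"
  shows "\<exists>b'\<in>B. reflect n q M i (wt b, basis_vec b) = (wt b', basis_vec b')"
proof -
  have qfact: "qfact q (Suc 0) = 1" "qfact q 0 = 1"
    using q_diff by (simp_all add: qfact_def qint_def)
  have floor: "\<lfloor>- 1 :: rat\<rfloor> = - 1" by (rule floor_unique) simp_all
  consider (out) c b' where "edge i c b b'" | (inn) c b' where "edge i c b' b"
    | (none) "\<nexists>c b'. edge i c b b' \<or> edge i c b' b"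
    by blast
  then show ?thesis
  proof cases
    case out
    then show ?thesis using edge_dest[OF out] wt_edge[OF out]
      by (intro bexI[of _ b']) (simp_all add: reflect_def pairing_out[OF out] Let_def X_Neg[OF out] qfact map_times_unit)
  next
    case inn
    then have "wt b' = wt b + \<alpha> n i" using wt_edge by simp
    then show ?thesis using edge_dest[OF inn]
      by (intro bexI[of _ b']) (simp_all add: reflect_def pairing_in[OF inn] Let_def X_Pos[OF inn] qfact floor map_times_unit)
  next
    case none
    then show ?thesis using b
      by (intro bexI[of _ b]) (simp_all add: reflect_def pairing_none[OF i b none] Let_def qfact map_times_unit)
  qed
qed

lemma extremal_basis_vec:
  assumes "b \<in> B"
  shows "extremal n t M (wt b) (basis_vec b)"
  unfolding extremal_def
proof (intro allI impI)
  fix ks assume "set ks \<subseteq> I n"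
  then have "\<exists>b'\<in>B. foldr (reflect n q M) ks (wt b, basis_vec b) = (wt b', basis_vec b')"
  proof (induction ks)
    case (Cons i ks)
    then show ?case using reflect_basis_vec by fastforce
  qed (use assms in auto)
  then show "case foldr (reflect n q M) ks (wt b, basis_vec b) of (\<nu>, w') \<Rightarrow> \<forall>i\<in>I n. i_extremal n t M i \<nu> w'"
    using i_extremal_basis_vec by auto
qed

lemma orbit_span_supported:
  assumes "v \<in> supported_on C" "\<And>g v. g \<in> G \<Longrightarrow> v \<in> supported_on C \<Longrightarrow> g v \<in> supported_on C"
  shows "orbit_span G v \<subseteq> supported_on C"
  unfolding orbit_span_def
proof (rule cvs.span_minimal[OF _ subspace_supported_on], safe)
  fix gs assume "set gs \<subseteq> G"
  then show "foldr (\<lambda>g v. g v) gs v \<in> supported_on C"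
    by (induction gs) (use assms in auto)
qed

text \<open>Connectedness is stated as an induction principle: a property that is transported along all
edges in both directions and holds at \<open>b0\<close> holds everywhere. It is applied to the property that the
basis vector is obtained from the one of \<open>b0\<close> by applying generators; the $x_{i,0}^\pm$ suffice,
since they map basis vectors to basis vectors along edges, without a factor.\<close>

lemma orbit_span_generators:
  assumes b0: "b0 \<in> B"
    and connected: "\<forall>P. P b0 \<longrightarrow> (\<forall>i c b b'. edge i c b b' \<longrightarrow> P b = P b') \<longrightarrow> (\<forall>b\<in>B. P b)"
  shows "orbit_span (generators n M) (basis_vec b0) = space M"
proof
  have "g v \<in> supported_on B" if g: "g \<in> generators n M" and v: "v \<in> supported_on B" for g v
  proof -
    consider \<sigma> i s where "i \<in> I n" "g = xop M \<sigma> i s" | i m where "g = hop M i m" | h where "g = kop M h"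
      using g unfolding generators_def by blast
    then show ?thesis
    proof cases
      case 2
      then obtain e where "g = diag e" using hop_M by metis
      then show ?thesis using v by (simp add: diag_supported)
    qed (use v in \<open>simp_all add: xop_supported diag_supported\<close>)
  qed
  then show "orbit_span (generators n M) (basis_vec b0) \<subseteq> space M"
    unfolding space_M using b0 by (intro orbit_span_supported) auto
  let ?S = "{foldr (\<lambda>g v. g v) gs (basis_vec b0) | gs. set gs \<subseteq> generators n M}"
  have step: "g v \<in> ?S" if "v \<in> ?S" "g \<in> generators n M" for g v
  proof -
    from that(1) obtain gs where "v = foldr (\<lambda>g v. g v) gs (basis_vec b0)" "set gs \<subseteq> generators n M" by blast
    then have "g v = foldr (\<lambda>g v. g v) (g # gs) (basis_vec b0)" "set (g # gs) \<subseteq> generators n M"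
      using that(2) by simp_all
    then show ?thesis by blast
  qed
  define P where "P b \<longleftrightarrow> basis_vec b \<in> ?S" for b
  have start: "P b0" by (auto simp: P_def intro!: exI[of _ "[]"])
  have "P b = P b'" if e: "edge i c b b'" for i c b b'
  proof -
    have "xop M \<sigma> i 0 \<in> generators n M" for \<sigma>
      using edge_dest[OF e] unfolding generators_def by blast
    then have gen: "lin_ext (X \<sigma> i 0) \<in> generators n M" for \<sigma> by simp
    have "lin_ext (X Neg i 0) (basis_vec b) = basis_vec b'" "lin_ext (X Pos i 0) (basis_vec b') = basis_vec b"
      using X_Neg[OF e, of 0] X_Pos[OF e, of 0] by simp_all
    then show ?thesis
      using step[OF _ gen[of Neg], of "basis_vec b"] step[OF _ gen[of Pos], of "basis_vec b'"]
      unfolding P_def by argo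
  qed
  with start connected have "\<forall>b\<in>B. P b" by blast
  then have "basis_vec ` B \<subseteq> ?S" unfolding P_def by blast
  then show "space M \<subseteq> orbit_span (generators n M) (basis_vec b0)"
    unfolding space_M supported_on_eq_span orbit_span_def by (rule cvs.span_mono)
qed

text \<open>A set of vertices that the edges of colours different from \<open>j\<close> neither enter nor leave spans a
subspace preserved by the vertical generators, since those that are not $x_{i,s}^\pm$ are diagonal.\<close>

lemma vertical_finite:
  assumes w: "w \<in> space M"
    and finite_components: "\<And>b. b \<in> B \<Longrightarrow> \<exists>C. finite C \<and> b \<in> C \<and> C \<subseteq> B \<and>
      (\<forall>i c b1 b2. edge i c b1 b2 \<longrightarrow> i \<noteq> j \<longrightarrow> (b1 \<in> C \<longleftrightarrow> b2 \<in> C))"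
  shows "\<exists>F. finite F \<and> orbit_span (vertical_generators n j M) w \<subseteq> cvs.span F"
proof -
  obtain C where C: "\<And>b. b \<in> B \<Longrightarrow> finite (C b) \<and> b \<in> C b \<and> C b \<subseteq> B \<and>
      (\<forall>i c b1 b2. edge i c b1 b2 \<longrightarrow> i \<noteq> j \<longrightarrow> (b1 \<in> C b \<longleftrightarrow> b2 \<in> C b))"
    using finite_components by metis
  define U where "U = (\<Union>b\<in>Poly_Mapping.keys w. C b)"
  have keys: "Poly_Mapping.keys w \<subseteq> B" using w by (simp add: supported_on_def)
  have "finite U" using C keys by (auto simp: U_def)
  have UB: "U \<subseteq> B" using C keys by (force simp: U_def)
  have Ue: "b1 \<in> U \<longleftrightarrow> b2 \<in> U" if "edge i c b1 b2" "i \<noteq> j" for i c b1 b2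
  proof -
    have "b1 \<in> C b \<longleftrightarrow> b2 \<in> C b" if "b \<in> Poly_Mapping.keys w" for b
      using C[of b] keys that \<open>edge i c b1 b2\<close> \<open>i \<noteq> j\<close> by blast
    then show ?thesis by (simp add: U_def)
  qed
  have X: "X \<sigma> i s b \<in> supported_on U" if "i \<in> I n" "i \<noteq> j" "b \<in> U" for \<sigma> i s b
  proof (cases rule: X_cases[of i b \<sigma>, case_names I B zero arrow])
    case (arrow c b')
    then have "b' \<in> U" using Ue that by (cases \<sigma>) (auto simp: arrow_def)
    then show ?thesis using arrow(2) by (simp add: cvs.subspace_scale[OF subspace_supported_on])
  next
    case zero
    then show ?thesis by (simp add: cvs.subspace_0[OF subspace_supported_on])
  qed (use that UB in auto)
  have "g v \<in> supported_on U" if g: "g \<in> vertical_generators n j M" and v: "v \<in> supported_on U" for g v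
  proof -
    consider \<sigma> i s where "i \<in> I n" "i \<noteq> j" "g = xop M \<sigma> i s" | i m where "g = hop M i m" | h where "g = kop M h"
      using g unfolding vertical_generators_def by blast
    then show ?thesis
    proof cases
      case 1
      then show ?thesis using lin_ext_supported[OF v X[OF 1(1,2)]] by simp
    next
      case 2
      then obtain e where "g = diag e" using hop_M by metis
      then show ?thesis using v by (simp add: diag_supported)
    qed (use v in \<open>simp add: diag_supported\<close>)
  qed
  moreover have "w \<in> supported_on U" using C keys by (auto simp: supported_on_def U_def)
  ultimately have "orbit_span (vertical_generators n j M) w \<subseteq> supported_on U"
    by (intro orbit_span_supported)
  then show ?thesis using \<open>finite U\<close> unfolding supported_on_eq_span by blast
qed

theorem extremal_loop_weight_module_M:
  assumes "n \<ge> 2" "m \<in> monomials n" "b0 \<in> B" "wt b0 = fst m"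
    and \<Phi>: "\<And>\<epsilon> i. i \<in> I n \<Longrightarrow> \<Phi> \<epsilon> i b0 = mono_phi q \<epsilon> i m"
    and connected: "\<forall>P. P b0 \<longrightarrow> (\<forall>i c b b'. edge i c b b' \<longrightarrow> P b = P b') \<longrightarrow> (\<forall>b\<in>B. P b)"
    and finite_components: "\<And>j b. j \<in> I n \<Longrightarrow> b \<in> B \<Longrightarrow> \<exists>C. finite C \<and> b \<in> C \<and> C \<subseteq> B \<and>
      (\<forall>i c b1 b2. edge i c b1 b2 \<longrightarrow> i \<noteq> j \<longrightarrow> (b1 \<in> C \<longleftrightarrow> b2 \<in> C))"
  shows "extremal_loop_weight_module n t M m"
  unfolding extremal_loop_weight_module_def
proof (intro conjI bexI[of _ "basis_vec b0"] tor_module_M integrable_M assms(1,2) ballI)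
  show "orbit_span (generators n M) (basis_vec b0) = space M"
    by (rule orbit_span_generators[OF assms(3) connected])
  show "extremal n t M (fst m) (basis_vec b0)"
    using extremal_basis_vec[OF assms(3)] assms(4) by simp
  show "\<exists>F. finite F \<and> orbit_span (vertical_generators n j M) w \<subseteq> cvs.span F"
    if "j \<in> I n" "w \<in> space M" for j w
    by (rule vertical_finite[OF that(2) finite_components[OF that(1)]])
  have "phi q M \<epsilon> i (sg \<epsilon> * int s) (basis_vec b0) = fps_nth (mono_phi q \<epsilon> i m) s *\<^sub>C basis_vec b0"
    if "i \<in> I n" for \<epsilon> i s
    using assms(3) that \<Phi>[OF that, of \<epsilon>]
    by (cases \<epsilon>) (simp_all add: phi_M phi_coeff_def int_coeff_def)
  then have "((\<lambda>w. phi q M \<epsilon> i (sg \<epsilon> * int s) w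
      - fps_nth (mono_phi q \<epsilon> i m) s *\<^sub>C w) ^^ 1) (basis_vec b0) = 0" if "i \<in> I n" for \<epsilon> i s
    using that by simp
  then show "basis_vec b0 \<in> lweight_space n t M m"
    unfolding lweight_space_def using weight_space_basis_vec[OF assms(3)] assms(4)
    by (simp only: mem_Collect_eq) blast
qed

end

section \<open>Weights of the vector representation\<close>

lemma cls_in_I [simp]: "cls n x \<in> I n"
  by (simp add: cls_def I_def) (use pos_mod_bound[of "int n + 1" x] in linarith)

lemma cls_I: "i \<in> I n \<Longrightarrow> cls n i = i"
  by (simp add: cls_def I_def)

lemma cls_eq_iff: "cls n x = cls n y \<longleftrightarrow> (int n + 1) dvd (x - y)"
  by (simp add: cls_def mod_eq_dvd_iff)

lemma cls_add_cls: "cls n (cls n x + y) = cls n (x + y)" "cls n (cls n x - y) = cls n (x - y)"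
  by (simp_all add: cls_def mod_simps)

lemma cls_eq_window:
  assumes "cls n x = cls n y" "\<bar>x - y\<bar> \<le> int n"
  shows "x = y"
proof (rule ccontr)
  assume "x \<noteq> y"
  then have "int n + 1 \<le> \<bar>x - y\<bar>"
    using assms(1) dvd_imp_le_int[of "x - y" "int n + 1"] by (simp add: cls_eq_iff)
  then show False using assms(2) by simp
qed

lemma cls_shift_eq_iff: "cls n (x + k) = cls n (y + k) \<longleftrightarrow> cls n x = cls n y"
  "cls n (x - k) = cls n (y - k) \<longleftrightarrow> cls n x = cls n y"
  by (simp_all add: cls_eq_iff)

lemma adjacent_cls: "i \<in> I n \<Longrightarrow> adjacent n i (cls n x) \<longleftrightarrow> i = cls n (x - 1) \<or> i = cls n (x + 1)"
  unfolding adjacent_def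
  using cls_shift_eq_iff(1)[of n i 1 "x - 1"] cls_shift_eq_iff(2)[of n i 1 "x + 1"] cls_I[of i n]
  by auto

lemma lookup_\<alpha>_H: "i \<in> I n \<Longrightarrow> Poly_Mapping.lookup (\<alpha> n j) (H i) = of_int (cartan n i j)"
  using pairing_\<alpha>[of i n j] by (simp add: pairing_hh)

lemma lookup_\<alpha>_D: "Poly_Mapping.lookup (\<alpha> n j) D = (if j = 0 then 1 else 0)"
  by (simp add: \<alpha>_def lookup_add lookup_sum lookup_single when_def)

lemma keys_subset_iff: "Poly_Mapping.keys f \<subseteq> K \<longleftrightarrow> (\<forall>x. x \<notin> K \<longrightarrow> Poly_Mapping.lookup f x = 0)"
  by (auto simp: in_keys_iff)

lemma keys_\<alpha>: "Poly_Mapping.keys (\<alpha> n j) \<subseteq> hbasis n"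
  unfolding keys_subset_iff
proof (intro allI impI)
  fix x assume "x \<notin> hbasis n"
  then obtain i where "x = H i" "i \<notin> I n" by (cases x) (auto simp: hbasis_def)
  then show "Poly_Mapping.lookup (\<alpha> n j) x = 0"
    by (auto simp: \<alpha>_def lookup_add lookup_sum lookup_single when_def intro!: sum.neutral)
qed

lemma keys_sum_subset: "(\<And>x. x \<in> S \<Longrightarrow> Poly_Mapping.keys (f x) \<subseteq> K) \<Longrightarrow> Poly_Mapping.keys (\<Sum>x\<in>S. f x) \<subseteq> K"
  by (simp add: keys_subset_iff lookup_sum)

lemma keys_diff_subset: "Poly_Mapping.keys f \<subseteq> K \<Longrightarrow> Poly_Mapping.keys g \<subseteq> K \<Longrightarrow> Poly_Mapping.keys (f - g) \<subseteq> K"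
  for f g :: "'a \<Rightarrow>\<^sub>0 'b::ab_group_add"
  by (simp add: keys_subset_iff lookup_minus)

lemma keys_add_subset: "Poly_Mapping.keys f \<subseteq> K \<Longrightarrow> Poly_Mapping.keys g \<subseteq> K \<Longrightarrow> Poly_Mapping.keys (f + g) \<subseteq> K"
  by (simp add: keys_subset_iff lookup_add)

lemma box_wt_step: "box_wt n (j + 1) = box_wt n j - \<alpha> n (cls n j)"
proof (cases "j \<ge> 1")
  case True
  then have "{1..<j + 1} = insert j {1..<j}" "{j + 1..<1} = {}" "{j..<1} = {}" by auto
  then show ?thesis by (simp add: box_wt_def)
next
  case False
  then have "{j..<1} = insert j {j + 1..<1}" "{1..<j + 1} = {}" "{1..<j} = {}" by auto
  then show ?thesis by (simp add: box_wt_def)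
qed

lemma box_wt_pred: "box_wt n (j - 1) = box_wt n j + \<alpha> n (cls n (j - 1))"
  using box_wt_step[of n "j - 1"] by simp

text \<open>The three residues $x-1$, $x$, $x+1$ are distinct because $n \ge 3$. The formula is correct for
$\boxed{1}$, and a step subtracts or adds a column of the Cartan matrix.\<close>

lemma lookup_box_wt_H:
  assumes "n \<ge> 3" "i \<in> I n"
  shows "Poly_Mapping.lookup (box_wt n j) (H i)
    = (if cls n j = i then 1 else 0) - (if cls n (j - 1) = i then 1 else 0)"
proof -
  have ne: "cls n x \<noteq> cls n (x + 1)" "cls n (x - 1) \<noteq> cls n x" "cls n (x - 1) \<noteq> cls n (x + 1)" for x
    using cls_eq_window[of n x "x + 1"] cls_eq_window[of n "x - 1" x] cls_eq_window[of n "x - 1" "x + 1"] assms(1)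
    by auto
  have step: "(if cls n (x + 1) = i then 1 else 0) - (if cls n x = i then 1 else 0)
      = (if cls n x = i then 1 else 0) - (if cls n (x - 1) = i then 1 else 0)
        - (of_int (cartan n i (cls n x)) :: rat)" for x
    using ne[of x] adjacent_cls[OF assms(2), of x] by (auto simp: cartan_def)
  show ?thesis
  proof (induction j rule: int_induct[where k = 1])
    case base
    have "cls n 1 = 1" "cls n 0 = 0" using assms(1) by (simp_all add: cls_def)
    then show ?case
      by (auto simp: box_wt_def varpi_def \<Lambda>_def lookup_minus lookup_single when_def)
  next
    case (step1 x)
    then show ?case using step[of x] by (simp add: box_wt_step lookup_minus lookup_\<alpha>_H assms(2))
  next
    case (step2 x)
    then show ?case using step[of "x - 1"]
      by (simp add: box_wt_pred[of n x] lookup_add lookup_\<alpha>_H assms(2))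
  qed
qed

lemma div_step: "x div (int n + 1) = (x - 1) div (int n + 1) + (if cls n x = 0 then 1 else 0)"
  if "n \<ge> 1"
proof -
  define d s where "d = (x - 1) div (int n + 1)" and "s = (x - 1) mod (int n + 1)"
  have "x - 1 = (int n + 1) * d + s" unfolding s_def d_def by (simp only: mult_div_mod_eq)
  moreover have "0 \<le> s" "s < int n + 1" unfolding s_def by (rule pos_mod_sign pos_mod_bound, simp)+
  ultimately have s: "0 \<le> s" "s < int n + 1" "x = (int n + 1) * d + (s + 1)" by simp_all
  show ?thesis
  proof (cases "s = int n")
    case True
    then have "x = (int n + 1) * (d + 1) + 0" using s(3) by (simp add: algebra_simps)
    then show ?thesis
      using int_div_pos_eq[of x "int n + 1" "d + 1" 0] int_mod_pos_eq[of x "int n + 1" "d + 1" 0]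
      by (simp add: cls_def d_def)
  next
    case False
    then show ?thesis
      using s int_div_pos_eq[of x "int n + 1" d "s + 1"] int_mod_pos_eq[of x "int n + 1" d "s + 1"]
      by (simp add: cls_def d_def)
  qed
qed

text \<open>Only $\alpha_0$ is nonzero on $d$, so the value on $d$ counts how often $0$ is passed.\<close>

lemma lookup_box_wt_D:
  assumes n: "n \<ge> 1"
  shows "Poly_Mapping.lookup (box_wt n j) D = - of_int ((j - 1) div (int n + 1))"
proof (induction j rule: int_induct[where k = 1])
  case base
  show ?case by (simp add: box_wt_def varpi_def \<Lambda>_def lookup_minus lookup_single when_def)
next
  case (step1 x)
  then show ?case using div_step[OF n, of x] by (simp add: box_wt_step lookup_minus lookup_\<alpha>_D)
next
  case (step2 x)
  then show ?case using div_step[OF n, of "x - 1"]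
    by (simp add: box_wt_pred[of n x] lookup_add lookup_\<alpha>_D)
qed

lemma keys_box_wt: "n \<ge> 1 \<Longrightarrow> Poly_Mapping.keys (box_wt n j) \<subseteq> hbasis n"
  unfolding box_wt_def varpi_def \<Lambda>_def
  by (intro keys_add_subset keys_diff_subset keys_sum_subset keys_\<alpha>) (auto simp: hbasis_def I_def)

text \<open>The $n+1$ steps between the two boxes have every colour once, and $\delta$ is the sum of all
simple roots.\<close>

lemma box_wt_rotate: "box_wt n (x - (int n + 1)) = box_wt n x + \<delta> n"
proof -
  have "box_wt n (x - int k) = box_wt n x + (\<Sum>l\<in>{x - int k..<x}. \<alpha> n (cls n l))" for k
  proof (induction k)
    case (Suc k)
    have "{x - int (Suc k)..<x} = insert (x - int k - 1) {x - int k..<x}" by auto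
    moreover have "x - int (Suc k) = x - int k - 1" by simp
    ultimately show ?case
      using Suc box_wt_pred[of n "x - int k"] by (simp add: algebra_simps)
  qed simp
  from this[of "Suc n"] have "box_wt n (x - (int n + 1))
      = box_wt n x + (\<Sum>l\<in>{x - (int n + 1)..<x}. \<alpha> n (cls n l))" by (simp add: add.commute)
  moreover have "bij_betw (cls n) {x - (int n + 1)..<x} (I n)"
  proof -
    have inj: "inj_on (cls n) {x - (int n + 1)..<x}"
      by (rule inj_onI, rule cls_eq_window) auto
    moreover have "card {x - (int n + 1)..<x} = card (I n)" by (simp add: I_def)
    ultimately have "cls n ` {x - (int n + 1)..<x} = I n"
      by (intro card_subset_eq) (simp add: I_def, auto simp: card_image)
    with inj show ?thesis by (simp add: bij_betw_def)
  qed
  then have "(\<Sum>l\<in>{x - (int n + 1)..<x}. \<alpha> n (cls n l)) = \<delta> n"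
    unfolding \<delta>_def by (rule sum.reindex_bij_betw)
  ultimately show ?thesis by simp
qed

text \<open>The values of the weight of $\boxed{j}$ on the $h_i$ are periodic in $j$.\<close>

lemma lookup_\<delta>_H:
  assumes "n \<ge> 3" "i \<in> I n"
  shows "Poly_Mapping.lookup (\<delta> n) (H i) = 0"
proof -
  have period: "cls n (x - (int n + 1)) = cls n x" for x
    by (simp only: cls_def minus_mod_self2)
  have "(0::int) - (int n + 1) - 1 = - 1 - (int n + 1)" by simp
  then have "cls n (0 - (int n + 1) - 1) = cls n (0 - 1)"
    using period[of "- 1"] by (metis diff_0)
  then have "Poly_Mapping.lookup (box_wt n (0 - (int n + 1))) (H i) = Poly_Mapping.lookup (box_wt n 0) (H i)"
    using period[of 0] by (simp only: lookup_box_wt_H[OF assms])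
  then show ?thesis
    unfolding box_wt_rotate by (simp add: lookup_add)
qed

lemma keys_\<delta>: "Poly_Mapping.keys (\<delta> n) \<subseteq> hbasis n"
  unfolding \<delta>_def by (intro keys_sum_subset keys_\<alpha>)

section \<open>Combinatorics of columns\<close>

lemma nth_list_update_range: "p < length xs \<Longrightarrow> xs[p := x] ! s = (if s = p then x else xs ! s)"
  by (auto simp: nth_list_update)

lemma sum_list_update:
  fixes g :: "nat \<Rightarrow> 'b \<Rightarrow> 'a::ab_group_add"
  assumes "p \<le> r" "length xs = r + 1"
  shows "(\<Sum>s\<le>r. g s (xs[p := x] ! s)) = (\<Sum>s\<le>r. g s (xs ! s)) - g p (xs ! p) + g p x"
  using assms by (simp add: sum.remove[of "{..r}" p] nth_list_update_range)

lemma prod_list_update: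
  fixes g :: "nat \<Rightarrow> 'b \<Rightarrow> 'a::comm_monoid_mult"
  assumes "p \<le> r" "length xs = r + 1"
  shows "(\<Prod>s\<le>r. g s (xs[p := x] ! s)) * g p (xs ! p) = (\<Prod>s\<le>r. g s (xs ! s)) * g p x"
  using assms by (simp add: prod.remove[of "{..r}" p] nth_list_update_range mult_ac)

lemma column_basis_iff:
  "js \<in> column_basis r \<longleftrightarrow>
    length js = r + 1 \<and> (\<forall>p<r. js ! p < js ! (p + 1)) \<and> js ! r - js ! 0 \<le> 2 * int r + 1"
proof -
  have "sorted_wrt (<) js \<longleftrightarrow> (\<forall>p<r. js ! p < js ! (p + 1))" if "length js = r + 1" for js :: "int list"
    using that by (auto simp: sorted_wrt_iff_nth_Suc_transp)
  moreover have "last js = js ! r" "hd js = js ! 0" if "length js = r + 1" for js :: "int list"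
    using that by (cases "js = []"; simp add: last_conv_nth hd_conv_nth)+
  ultimately show ?thesis by (auto simp: column_basis_def increasing_def)
qed

lemma column_length: "js \<in> column_basis r \<Longrightarrow> length js = r + 1"
  by (simp add: column_basis_iff)

lemma column_gap:
  assumes "js \<in> column_basis r" "p \<le> p'" "p' \<le> r"
  shows "js ! p + int p' - int p \<le> js ! p'"
  using assms(2,3)
proof (induction p' rule: dec_induct)
  case (step s)
  have "js ! s < js ! (s + 1)" using assms(1) step by (simp add: column_basis_iff)
  then show ?case using step by simp
qed simp

lemma column_window:
  assumes "js \<in> column_basis r" "p \<le> r" "p' \<le> r"
  shows "\<bar>js ! p - js ! p'\<bar> \<le> 2 * int r + 1"
proof -
  have "js ! 0 \<le> js ! s \<and> js ! s \<le> js ! r" if "s \<le> r" for s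
    using column_gap[OF assms(1), of 0 s] column_gap[OF assms(1), of s r] that by linarith
  from this[OF assms(2)] this[OF assms(3)] assms(1) show ?thesis by (auto simp: column_basis_iff)
qed

lemma column_residues_distinct:
  assumes "js \<in> column_basis r" "p \<le> r" "p' \<le> r" "cls (2 * r + 1) (js ! p) = cls (2 * r + 1) (js ! p')"
  shows "p = p'"
proof -
  have "\<bar>js ! p - js ! p'\<bar> \<le> int (2 * r + 1)" using column_window[OF assms(1-3)] by simp
  then have eq: "js ! p = js ! p'" by (rule cls_eq_window[OF assms(4)])
  show ?thesis
  proof (cases "p \<le> p'")
    case True
    show ?thesis using column_gap[OF assms(1) True assms(3)] True eq by linarith
  next
    case False
    then show ?thesis using column_gap[OF assms(1), of p' p] assms(2) eq by linarith
  qed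
qed

text \<open>The two entries differ by less than $N = 2r+2$, and their difference is $1$ modulo $N$. If it is
$1$, they are neighbours and the position grows by one. Otherwise it is $1 - N$, which leaves
only the last and the first entry, and $1 - N + 2r = -1$.\<close>

lemma column_adjacent_residues:
  assumes "js \<in> column_basis r" "p \<le> r" "p' \<le> r" "cls (2 * r + 1) (js ! p') = cls (2 * r + 1) (js ! p + 1)"
  shows "js ! p' - 2 * int p' = js ! p - 2 * int p - 1"
proof -
  let ?N = "2 * int r + 2"
  have "?N dvd js ! p' - (js ! p + 1)" using assms(4) by (simp add: cls_eq_iff algebra_simps)
  then obtain k where k: "js ! p' - (js ! p + 1) = ?N * k" by (elim dvdE)
  have w: "js ! p' - js ! p \<le> 2 * int r + 1" "js ! p - js ! p' \<le> 2 * int r + 1"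
    using column_window[OF assms(1-3)] by simp_all
  have "k \<le> 0"
  proof (rule ccontr)
    assume "\<not> k \<le> 0"
    then have "?N * 1 \<le> js ! p' - (js ! p + 1)" unfolding k by (intro mult_left_mono) auto
    then show False using w by simp
  qed
  moreover have "k \<ge> - 1"
  proof (rule ccontr)
    assume "\<not> k \<ge> - 1"
    then have "js ! p' - (js ! p + 1) \<le> ?N * (- 2)" unfolding k by (intro mult_left_mono) auto
    then show False using w by simp
  qed
  ultimately consider "k = 0" | "k = - 1" by linarith
  then show ?thesis
  proof cases
    case 1
    then have eq: "js ! p' = js ! p + 1" using k by simp
    then have "p < p'" using column_gap[OF assms(1), of p' p] assms(2) by (cases "p' \<le> p") auto
    then show ?thesis using column_gap[OF assms(1), of p p'] assms(3) eq by simp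
  next
    case 2
    then have eq: "js ! p = js ! p' + 2 * int r + 1" using k by simp
    have "js ! r - js ! 0 \<le> 2 * int r + 1" using assms(1) by (simp add: column_basis_iff)
    then have "p = r" "p' = 0"
      using column_gap[OF assms(1), of p r] column_gap[OF assms(1), of 0 p'] assms(2,3) eq by auto
    then show ?thesis using eq by simp
  qed
qed

text \<open>Raising an entry can violate the definition of a column only by making it collide with the next
entry, or, for the last entry, with the first one shifted by the period. Both say that the residue is
taken.\<close>

lemma column_raise_iff:
  assumes "js \<in> column_basis r" "p \<le> r"
  shows "js[p := js ! p + 1] \<in> column_basis r \<longleftrightarrow>
    (\<forall>p'\<le>r. cls (2 * r + 1) (js ! p') \<noteq> cls (2 * r + 1) (js ! p + 1))"
proof -
  let ?js = "js[p := js ! p + 1]"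
  have len: "length js = r + 1" using assms(1) by (rule column_length)
  show ?thesis
  proof
    assume js': "?js \<in> column_basis r"
    show "\<forall>p'\<le>r. cls (2 * r + 1) (js ! p') \<noteq> cls (2 * r + 1) (js ! p + 1)"
    proof (intro allI impI notI)
      fix p' assume p': "p' \<le> r" and eq: "cls (2 * r + 1) (js ! p') = cls (2 * r + 1) (js ! p + 1)"
      have "p' \<noteq> p" using eq cls_eq_window[of "2 * r + 1" "js ! p" "js ! p + 1"] by auto
      then have "cls (2 * r + 1) (?js ! p') = cls (2 * r + 1) (?js ! p)"
        using eq len assms(2) by (simp add: nth_list_update_range)
      then show False using column_residues_distinct[OF js' p' assms(2)] \<open>p' \<noteq> p\<close> by simp
    qed
  next
    assume free: "\<forall>p'\<le>r. cls (2 * r + 1) (js ! p') \<noteq> cls (2 * r + 1) (js ! p + 1)"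
    show "?js \<in> column_basis r"
      unfolding column_basis_iff
    proof (intro conjI allI impI)
      show "length ?js = r + 1" using len by simp
      fix s assume s: "s < r"
      have lt: "js ! s < js ! (s + 1)" using assms(1) s by (simp add: column_basis_iff)
      have "js ! (p + 1) \<noteq> js ! p + 1" if "p < r" using free[rule_format, of "p + 1"] that by auto
      then show "?js ! s < ?js ! (s + 1)"
        using lt s len assms(2) by (auto simp: nth_list_update_range)
    next
      have "js ! 0 \<noteq> js ! r - 2 * int r - 1" if "p = r"
      proof
        assume "js ! 0 = js ! r - 2 * int r - 1"
        then have "js ! 0 - (js ! p + 1) = - (int (2 * r + 1) + 1)" using that by simp
        then have "cls (2 * r + 1) (js ! 0) = cls (2 * r + 1) (js ! p + 1)"
          by (simp only: cls_eq_iff dvd_minus_iff dvd_refl)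
        then show False using free by simp
      qed
      then show "?js ! r - ?js ! 0 \<le> 2 * int r + 1"
        using assms len by (auto simp: nth_list_update_range column_basis_iff)
    qed
  qed
qed

lemma column_lower_iff:
  assumes "js \<in> column_basis r" "p \<le> r"
  shows "js[p := js ! p - 1] \<in> column_basis r \<longleftrightarrow>
    (\<forall>p'\<le>r. cls (2 * r + 1) (js ! p') \<noteq> cls (2 * r + 1) (js ! p - 1))"
proof -
  let ?js = "js[p := js ! p - 1]"
  have len: "length js = r + 1" using assms(1) by (rule column_length)
  show ?thesis
  proof
    assume js': "?js \<in> column_basis r"
    show "\<forall>p'\<le>r. cls (2 * r + 1) (js ! p') \<noteq> cls (2 * r + 1) (js ! p - 1)"
    proof (intro allI impI notI)
      fix p' assume p': "p' \<le> r" and eq: "cls (2 * r + 1) (js ! p') = cls (2 * r + 1) (js ! p - 1)"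
      have "p' \<noteq> p" using eq cls_eq_window[of "2 * r + 1" "js ! p" "js ! p - 1"] by auto
      then have "cls (2 * r + 1) (?js ! p') = cls (2 * r + 1) (?js ! p)"
        using eq len assms(2) by (simp add: nth_list_update_range)
      then show False using column_residues_distinct[OF js' p' assms(2)] \<open>p' \<noteq> p\<close> by simp
    qed
  next
    assume free: "\<forall>p'\<le>r. cls (2 * r + 1) (js ! p') \<noteq> cls (2 * r + 1) (js ! p - 1)"
    show "?js \<in> column_basis r"
      unfolding column_basis_iff
    proof (intro conjI allI impI)
      show "length ?js = r + 1" using len by simp
      fix s assume s: "s < r"
      have lt: "js ! s < js ! (s + 1)" using assms(1) s by (simp add: column_basis_iff)
      have "js ! s \<noteq> js ! p - 1" using free[rule_format, of s] s by auto
      then show "?js ! s < ?js ! (s + 1)"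
        using lt s len assms(2) by (auto simp: nth_list_update_range)
    next
      have "js ! r \<noteq> js ! 0 + 2 * int r + 1" if "p = 0"
      proof
        assume "js ! r = js ! 0 + 2 * int r + 1"
        then have "js ! r - (js ! p - 1) = int (2 * r + 1) + 1" using that by simp
        then have "cls (2 * r + 1) (js ! r) = cls (2 * r + 1) (js ! p - 1)"
          by (simp only: cls_eq_iff dvd_refl)
        then show False using free by simp
      qed
      then show "?js ! r - ?js ! 0 \<le> 2 * int r + 1"
        using assms len by (auto simp: nth_list_update_range column_basis_iff)
    qed
  qed
qed

text \<open>The integers from \<open>x\<close> to \<open>x + r + 1\<close> without \<open>x + s\<close>. For \<open>s = r + 1\<close> and \<open>s = 0\<close> these are two
consecutive runs of consecutive integers, and decreasing \<open>s\<close> moves one entry at a time.\<close>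

definition staircase :: "nat \<Rightarrow> int \<Rightarrow> nat \<Rightarrow> int list" where
  "staircase r x s = map (\<lambda>p. if p < s then x + int p else x + int p + 1) [0..<r + 1]"

lemma length_staircase [simp]: "length (staircase r x s) = r + 1"
  by (simp add: staircase_def)

lemma nth_staircase: "p \<le> r \<Longrightarrow> staircase r x s ! p = (if p < s then x + int p else x + int p + 1)"
  unfolding staircase_def by (subst nth_map) (simp_all del: upt_Suc)

lemma staircase_column: "staircase r x s \<in> column_basis r"
  unfolding column_basis_iff
proof (intro conjI allI impI)
  fix p assume "p < r"
  then show "staircase r x s ! p < staircase r x s ! (p + 1)"
    using nth_staircase[of p r x s] nth_staircase[of "p + 1" r x s] by (auto split: if_splits)
next
  show "staircase r x s ! r - staircase r x s ! 0 \<le> 2 * int r + 1"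
    using nth_staircase[of 0 r x s] nth_staircase[of r r x s] by (auto split: if_splits)
qed simp

lemma staircase_step:
  assumes "s \<le> r"
  shows "(staircase r x (s + 1))[s := staircase r x (s + 1) ! s + 1] = staircase r x s"
  using assms by (intro nth_equalityI) (auto simp: nth_staircase nth_list_update)

lemma staircase_0: "staircase r x 0 = staircase r (x + 1) (r + 1)"
  by (intro nth_equalityI) (auto simp: nth_staircase)

text \<open>A column with a gap stays a column if the entry after the first gap is lowered. Repeating this,
with the first entry fixed, ends at a run of consecutive integers.\<close>

lemma column_lower_to_staircase:
  assumes move: "\<And>js p. js \<in> column_basis r \<Longrightarrow> p \<le> r \<Longrightarrow> js[p := js ! p + 1] \<in> column_basis r \<Longrightarrow>
      P js = P (js[p := js ! p + 1])"
    and "js \<in> column_basis r"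
  shows "P js = P (staircase r (js ! 0) (r + 1))"
  using assms(2)
proof (induction "nat (\<Sum>p\<le>r. js ! p - js ! 0)" arbitrary: js rule: less_induct)
  case less
  have lenjs: "length js = r + 1" using less.prems by (rule column_length)
  show ?case
  proof (cases "\<forall>p\<le>r. js ! p = js ! 0 + int p")
    case True
    have "js = staircase r (js ! 0) (r + 1)"
    proof (rule nth_equalityI)
      fix p assume "p < length js"
      then have "p \<le> r" using lenjs by simp
      then show "js ! p = staircase r (js ! 0) (r + 1) ! p"
        using True[rule_format, of p] nth_staircase[of p r "js ! 0" "r + 1"] by simp
    qed (simp add: lenjs)
    then show ?thesis by (rule arg_cong[of _ _ P])
  next
    case False
    then have ex: "\<exists>p. p \<le> r \<and> js ! p \<noteq> js ! 0 + int p" by blast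
    define p where "p = (LEAST p. p \<le> r \<and> js ! p \<noteq> js ! 0 + int p)"
    have p: "p \<le> r" "js ! p \<noteq> js ! 0 + int p" using LeastI_ex[OF ex] by (simp_all add: p_def)
    then have "p > 0" by (cases p) auto
    have "\<not> (p - 1 \<le> r \<and> js ! (p - 1) \<noteq> js ! 0 + int (p - 1))"
      using \<open>p > 0\<close> by (intro not_less_Least) (simp flip: p_def)
    then have prev: "js ! (p - 1) = js ! 0 + int p - 1" using p(1) \<open>p > 0\<close> by auto
    have gt: "js ! p > js ! (p - 1) + 1"
      using column_gap[OF less.prems, of 0 p] p prev by simp
    define js' where "js' = js[p := js ! p - 1]"
    have js'_nth: "js' ! s = (if s = p then js ! p - 1 else js ! s)" for s
      using p(1) lenjs by (simp add: js'_def nth_list_update_range)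
    have js': "js' \<in> column_basis r"
      unfolding column_basis_iff
    proof (intro conjI allI impI)
      show "length js' = r + 1" by (simp add: js'_def lenjs)
      fix s assume "s < r"
      then have "js ! s < js ! (s + 1)" using less.prems by (simp add: column_basis_iff)
      moreover have "s = p - 1" if "s + 1 = p" using that by simp
      ultimately show "js' ! s < js' ! (s + 1)" using gt by (auto simp: js'_nth)
    next
      have "js ! r - js ! 0 \<le> 2 * int r + 1" using less.prems by (simp add: column_basis_iff)
      then show "js' ! r - js' ! 0 \<le> 2 * int r + 1" using \<open>p > 0\<close> by (auto simp: js'_nth)
    qed
    have "(\<Sum>s\<le>r. js' ! s - js' ! 0) = (\<Sum>s\<le>r. js ! s - js ! 0) - 1"
      using \<open>p > 0\<close> sum_list_update[OF p(1) lenjs, of "\<lambda>s x. x - js ! 0" "js ! p - 1"]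
      by (simp add: js'_def)
    moreover have "(\<Sum>s\<le>r. js' ! s - js' ! 0) \<ge> 0"
    proof (rule sum_nonneg)
      fix s assume "s \<in> {..r}"
      then show "js' ! s - js' ! 0 \<ge> 0" using column_gap[OF js', of 0 s] by simp
    qed
    ultimately have "P js' = P (staircase r (js' ! 0) (r + 1))" using less.hyps[OF _ js'] by simp
    moreover have "js'[p := js' ! p + 1] = js" by (simp add: js'_def lenjs p(1) less_Suc_eq_le)
    then have "P js' = P js" using move[OF js' p(1)] less.prems by simp
    ultimately show ?thesis using \<open>p > 0\<close> by (simp add: js'_nth)
  qed
qed

text \<open>All columns are connected to runs of consecutive integers, and these to each other.\<close>

lemma column_connected:
  assumes start: "js0 \<in> column_basis r" "P js0"
    and move: "\<And>js p. js \<in> column_basis r \<Longrightarrow> p \<le> r \<Longrightarrow> js[p := js ! p + 1] \<in> column_basis r \<Longrightarrow>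
      P js = P (js[p := js ! p + 1])"
    and js: "js \<in> column_basis r"
  shows "P js"
proof -
  have shift: "P (staircase r x (r + 1)) = P (staircase r (x + 1) (r + 1))" for x
  proof -
    have "P (staircase r x 0) = P (staircase r x s)" if "s \<le> r + 1" for s
      using that
    proof (induction s)
      case (Suc s)
      then have "P (staircase r x (s + 1)) = P (staircase r x s)"
        using move[OF staircase_column, of s x "s + 1"] staircase_step[of s r x] staircase_column by simp
      then show ?case using Suc by simp
    qed simp
    from this[of "r + 1"] show ?thesis by (simp only: staircase_0 order.refl)
  qed
  have all: "P (staircase r x (r + 1)) = P (staircase r 0 (r + 1))" for x
  proof (induction x rule: int_induct[where k = 0])
    case (step1 x)
    then show ?case using shift[of x] by (simp only:)
  next
    case (step2 x)
    then show ?case using shift[of "x - 1"] by (simp only: diff_add_cancel)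
  qed simp
  have "P js = P (staircase r (js ! 0) (r + 1))" "P js0 = P (staircase r (js0 ! 0) (r + 1))"
    using column_lower_to_staircase[of r P, OF move] js start(1) by simp_all
  then have "P js = P js0" using all by metis
  then show ?thesis using start(2) by simp
qed

text \<open>Match the entries of the two columns by their residues; the differences are multiples $N d_p$
of the period with $\sum_p d_p = 0$. Unless all $d_p$ vanish, one is positive and another one negative.
Then the differences of these two entries in the two columns differ by at least $2N$, although
both are less than $N$ in absolute value.\<close>

lemma column_determined:
  assumes js: "js \<in> column_basis r" and js': "js' \<in> column_basis r"
    and residues: "cls (2 * r + 1) ` set js \<subseteq> cls (2 * r + 1) ` set js'"
    and quotients: "(\<Sum>p\<le>r. (js ! p - 1) div (2 * int r + 2)) = (\<Sum>p\<le>r. (js' ! p - 1) div (2 * int r + 2))"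
  shows "js = js'"
proof -
  let ?N = "2 * int r + 2"
  have len: "length js = r + 1" "length js' = r + 1" using js js' by (simp_all add: column_length)
  have "\<exists>p'\<le>r. cls (2 * r + 1) (js' ! p') = cls (2 * r + 1) (js ! p)" if "p \<le> r" for p
  proof -
    have "js ! p \<in> set js" using that len by simp
    then obtain x where "x \<in> set js'" "cls (2 * r + 1) x = cls (2 * r + 1) (js ! p)"
      using residues by force
    then show ?thesis using len by (metis in_set_conv_nth less_Suc_eq_le Suc_eq_plus1)
  qed
  then obtain \<pi> where \<pi>: "\<And>p. p \<le> r \<Longrightarrow> \<pi> p \<le> r \<and> cls (2 * r + 1) (js' ! \<pi> p) = cls (2 * r + 1) (js ! p)"
    by metis
  have inj: "inj_on \<pi> {..r}"
    using column_residues_distinct[OF js] \<pi> by (intro inj_onI) (metis atMost_iff)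
  moreover have "\<pi> ` {..r} = {..r}"
    using inj \<pi> by (intro endo_inj_surj) auto
  ultimately have bij: "bij_betw \<pi> {..r} {..r}" by (simp add: bij_betw_def)
  define d where "d p = (js' ! \<pi> p - js ! p) div ?N" for p
  have d: "js' ! \<pi> p = js ! p + ?N * d p" if "p \<le> r" for p
  proof -
    have "cls (2 * r + 1) (js' ! \<pi> p) = cls (2 * r + 1) (js ! p)" using \<pi>[OF that] by blast
    then have "?N dvd js' ! \<pi> p - js ! p" by (simp add: cls_eq_iff add.commute)
    then have "?N * d p = js' ! \<pi> p - js ! p" unfolding d_def by (rule dvd_mult_div_cancel)
    then show ?thesis by simp
  qed
  have "(js' ! \<pi> p - 1) div ?N = (js ! p - 1) div ?N + d p" if "p \<le> r" for p
  proof -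
    have "js' ! \<pi> p - 1 = (js ! p - 1) + ?N * d p" using d[OF that] by simp
    then show ?thesis by (simp only: div_mult_self2)
  qed
  then have "(\<Sum>p\<le>r. (js' ! \<pi> p - 1) div ?N) = (\<Sum>p\<le>r. (js ! p - 1) div ?N) + (\<Sum>p\<le>r. d p)"
    by (simp add: sum.distrib)
  moreover have "(\<Sum>p\<le>r. (js' ! \<pi> p - 1) div ?N) = (\<Sum>p\<le>r. (js' ! p - 1) div ?N)"
    by (rule sum.reindex_bij_betw[OF bij])
  ultimately have sum_d: "(\<Sum>p\<le>r. d p) = 0" using quotients by simp
  have mixed: False if "p \<le> r" "s \<le> r" "d p \<ge> 1" "d s \<le> - 1" for p s
  proof -
    have "js' ! \<pi> p - js ! p = ?N * d p" "js' ! \<pi> s - js ! s = ?N * d s" using d that by simp_all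
    moreover have "?N * 1 \<le> ?N * d p" "?N * d s \<le> ?N * (- 1)"
      using that by (intro mult_left_mono; simp)+
    ultimately have "?N * 1 \<le> js' ! \<pi> p - js ! p" "js' ! \<pi> s - js ! s \<le> ?N * (- 1)" by (simp_all only:)
    then show False
      using column_window[OF js that(1,2)] column_window[OF js', of "\<pi> p" "\<pi> s"] \<pi> that by simp
  qed
  have "d p = 0" if "p \<le> r" for p
  proof -
    consider "d p \<ge> 1" | "d p \<le> - 1" | "d p = 0" by linarith
    then show ?thesis
    proof cases
      case 1
      then have "\<forall>s\<in>{..r}. d s \<ge> 0" using mixed[OF that] by force
      then show ?thesis using sum_nonneg_eq_0_iff[of "{..r}" d] sum_d that by simp
    next
      case 2
      then have "\<forall>s\<in>{..r}. - d s \<ge> 0" using mixed[OF _ that] by force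
      moreover have "(\<Sum>s\<le>r. - d s) = 0" using sum_d by (simp add: sum_negf)
      ultimately show ?thesis using sum_nonneg_eq_0_iff[of "{..r}" "\<lambda>s. - d s"] that by simp
    qed
  qed
  then have eq: "js' ! \<pi> p = js ! p" if "p \<le> r" for p using d that by simp
  have "set js = (\<lambda>p. js ! p) ` {..r}" "set js' = (\<lambda>p. js' ! p) ` {..r}"
    using len by (auto simp: set_conv_nth less_Suc_eq_le image_iff)
  moreover have "(\<lambda>p. js' ! p) ` {..r} = (\<lambda>p. js' ! p) ` \<pi> ` {..r}"
    using bij by (simp add: bij_betw_def)
  ultimately have "set js = set js'" using eq by (auto simp: image_image)
  then show ?thesis
    using js js' by (auto simp: column_basis_def increasing_def intro: strict_sorted_equal)
qed

section \<open>The graph of columns\<close>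

context comm_monoid_set
begin

lemma one_term:
  assumes "p \<le> r" "\<And>s. s \<le> r \<Longrightarrow> s \<noteq> p \<Longrightarrow> g s = \<^bold>1"
  shows "F g {..r::nat} = g p"
proof -
  have "F g {..r} = g p \<^bold>* F g ({..r} - {p})" by (rule remove) (use assms in auto)
  also have "F g ({..r} - {p}) = \<^bold>1" by (rule neutral) (use assms in auto)
  finally show ?thesis by simp
qed

lemma two_terms:
  assumes "p \<le> r" "p' \<le> r" "p \<noteq> p'" "\<And>s. s \<le> r \<Longrightarrow> s \<noteq> p \<Longrightarrow> s \<noteq> p' \<Longrightarrow> g s = \<^bold>1"
  shows "F g {..r::nat} = g p \<^bold>* g p'"
proof -
  have "F g {..r} = g p \<^bold>* F g ({..r} - {p})" by (rule remove) (use assms in auto)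
  also have "F g ({..r} - {p}) = g p' \<^bold>* F g ({..r} - {p} - {p'})"
    by (rule remove) (use assms in auto)
  also have "F g ({..r} - {p} - {p'}) = \<^bold>1" by (rule neutral) (use assms in auto)
  finally show ?thesis by simp
qed

end

lemma box_phi_eq: "box_phi n q \<Psi> i b j = (if cls n j = i then \<Psi> (b * q powi j)
    else if cls n (j - 1) = i then inverse (\<Psi> (b * q powi (j + 1))) else 1)"
  by (auto simp: box_phi_def)

locale column =
  fixes r :: nat and t a :: complex
  assumes r: "r \<ge> 1" and not_root: "\<forall>k::nat. k > 0 \<longrightarrow> exp t ^ k \<noteq> 1" and a: "a \<noteq> 0"
begin

abbreviation "n \<equiv> 2 * r + 1"
abbreviation "q \<equiv> exp t"

text \<open>The parameter $c$ of the edge that raises the entry at position \<open>p\<close>.\<close>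

definition par :: "int list \<Rightarrow> nat \<Rightarrow> complex" where
  "par js p = a * q powi (js ! p - 2 * int p)"

definition bs :: "complex list" where
  "bs = map (\<lambda>p. a * q powi (- 2 * int p)) [0..<r + 1]"

definition edge :: "int \<Rightarrow> complex \<Rightarrow> int list \<Rightarrow> int list \<Rightarrow> bool" where
  "edge i c js js' \<longleftrightarrow> js \<in> column_basis r \<and> js' \<in> column_basis r \<and>
     (\<exists>p\<le>r. i = cls n (js ! p) \<and> c = par js p \<and> js' = js[p := js ! p + 1])"

lemma par_nonzero: "par js p \<noteq> 0"
  using a by (simp add: par_def)

lemma bs_powi: "p \<le> r \<Longrightarrow> bs ! p * q powi x = a * q powi (x - 2 * int p)"
proof -
  assume "p \<le> r"
  then have "bs ! p = a * q powi (- 2 * int p)"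
    unfolding bs_def by (subst nth_map) (simp_all del: upt_Suc)
  moreover have "q powi (x - 2 * int p) = q powi (- 2 * int p) * q powi x"
    by (simp flip: power_int_add)
  ultimately show ?thesis by simp
qed

text \<open>At the start of an edge of colour $i$ the residue $i$ is taken and $i+1$ is free; at its end it
is the other way round. In each case only one entry is relevant for sums and products over the
tensor factors.\<close>

lemma edge_out:
  assumes "edge i c b b'"
  obtains p where "p \<le> r" "cls n (b ! p) = i" "c = par b p" "b' = b[p := b ! p + 1]"
    "b \<in> column_basis r" "b' \<in> column_basis r"
    "\<And>s. s \<le> r \<Longrightarrow> cls n (b ! s) = i \<longleftrightarrow> s = p" "\<And>s. s \<le> r \<Longrightarrow> cls n (b ! s - 1) \<noteq> i"
    "\<And>s. b' ! s = (if s = p then b ! p + 1 else b ! s)"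
proof -
  obtain p where p: "p \<le> r" "i = cls n (b ! p)" "c = par b p" "b' = b[p := b ! p + 1]"
    and b: "b \<in> column_basis r" "b' \<in> column_basis r"
    using assms unfolding edge_def by blast
  have "cls n (b ! s) = i \<longleftrightarrow> s = p" if "s \<le> r" for s
    using column_residues_distinct[OF b(1) that p(1)] p(2) by auto
  moreover have "cls n (b ! s - 1) \<noteq> i" if "s \<le> r" for s
  proof -
    have "cls n (b ! s) \<noteq> cls n (b ! p + 1)"
      using column_raise_iff[OF b(1) p(1)] b(2) p(4) that by simp
    then show ?thesis using cls_shift_eq_iff(2)[of n "b ! s" 1 "b ! p + 1"] p(2) by simp
  qed
  moreover have "b' ! s = (if s = p then b ! p + 1 else b ! s)" for s
    using p(1,4) column_length[OF b(1)] by (simp add: nth_list_update_range)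
  ultimately show ?thesis using that p b by blast
qed

lemma edge_in:
  assumes "edge i c b b'"
  obtains p where "p \<le> r" "cls n (b' ! p - 1) = i" "c = a * q powi (b' ! p - 1 - 2 * int p)"
    "b = b'[p := b' ! p - 1]" "b \<in> column_basis r" "b' \<in> column_basis r"
    "\<And>s. s \<le> r \<Longrightarrow> cls n (b' ! s) \<noteq> i" "\<And>s. s \<le> r \<Longrightarrow> cls n (b' ! s - 1) = i \<longleftrightarrow> s = p"
proof -
  obtain p where p: "p \<le> r" "cls n (b ! p) = i" "c = par b p" "b' = b[p := b ! p + 1]"
    and b: "b \<in> column_basis r" "b' \<in> column_basis r"
    and nth: "\<And>s. b' ! s = (if s = p then b ! p + 1 else b ! s)"
    using edge_out[OF assms] by metis
  have i: "cls n (b' ! p - 1) = i" using p(2) nth by simp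
  have lowered: "b = b'[p := b' ! p - 1]" using p(4) nth by simp
  have "cls n (b' ! s) \<noteq> i" if "s \<le> r" for s
    using column_lower_iff[OF b(2) p(1)] b(1) lowered i that by simp
  moreover have "cls n (b' ! s - 1) = i \<longleftrightarrow> s = p" if "s \<le> r" for s
    using column_residues_distinct[OF b(2) that p(1)] i cls_shift_eq_iff(2)[of n "b' ! s" 1 "b' ! p"]
    by auto
  moreover have "c = a * q powi (b' ! p - 1 - 2 * int p)" using p(3) nth by (simp add: par_def)
  ultimately show ?thesis using that p(1) b i lowered by blast
qed

lemma edge_raise:
  assumes "js \<in> column_basis r" "p \<le> r" "js[p := js ! p + 1] \<in> column_basis r"
  shows "edge (cls n (js ! p)) (par js p) js (js[p := js ! p + 1])"
  using assms by (auto simp: edge_def)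

lemma edge_lower:
  assumes "js \<in> column_basis r" "p \<le> r" "js[p := js ! p - 1] \<in> column_basis r"
  shows "edge (cls n (js ! p - 1)) (a * q powi (js ! p - 1 - 2 * int p)) (js[p := js ! p - 1]) js"
proof -
  let ?js = "js[p := js ! p - 1]"
  have "?js ! p = js ! p - 1" "js = ?js[p := ?js ! p + 1]"
    using assms(1,2) by (simp_all add: nth_list_update_range column_length)
  then show ?thesis
    unfolding edge_def par_def using assms by (intro conjI exI[of _ p]) simp_all
qed

text \<open>If there is no edge of colour $i$, then the residues $i$ and $i+1$ are both free or both taken; in
the second case the contributions of the two entries will cancel by the equation between
their values.\<close>

lemma no_edge:
  assumes "js \<in> column_basis r" "i \<in> I n" "\<nexists>c b'. edge i c js b' \<or> edge i c b' js"
  obtains (empty) "\<And>s. s \<le> r \<Longrightarrow> cls n (js ! s) \<noteq> i" "\<And>s. s \<le> r \<Longrightarrow> cls n (js ! s - 1) \<noteq> i"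
  | (full) p p' where "p \<le> r" "p' \<le> r" "p \<noteq> p'" "cls n (js ! p) = i" "cls n (js ! p' - 1) = i"
      "js ! p' - 2 * int p' = js ! p - 2 * int p - 1"
      "\<And>s. s \<le> r \<Longrightarrow> cls n (js ! s) = i \<longleftrightarrow> s = p" "\<And>s. s \<le> r \<Longrightarrow> cls n (js ! s - 1) = i \<longleftrightarrow> s = p'"
proof (cases "\<exists>p\<le>r. cls n (js ! p) = i")
  case True
  then obtain p where p: "p \<le> r" "cls n (js ! p) = i" by blast
  have "js[p := js ! p + 1] \<notin> column_basis r"
    using edge_raise[OF assms(1) p(1)] p(2) assms(3) by blast
  then obtain p' where p': "p' \<le> r" "cls n (js ! p') = cls n (js ! p + 1)"
    using column_raise_iff[OF assms(1) p(1)] by blast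
  have i: "cls n (js ! p' - 1) = i" using p' p(2) cls_shift_eq_iff(2)[of n "js ! p'" 1 "js ! p + 1"] by simp
  show ?thesis
  proof (rule full[OF p(1) p'(1) _ p(2) i column_adjacent_residues[OF assms(1) p(1) p'(1) p'(2)]])
    show "p \<noteq> p'" using p'(2) cls_eq_window[of n "js ! p" "js ! p + 1"] by auto
    show "cls n (js ! s) = i \<longleftrightarrow> s = p" if "s \<le> r" for s
      using column_residues_distinct[OF assms(1) that p(1)] p(2) by auto
    show "cls n (js ! s - 1) = i \<longleftrightarrow> s = p'" if "s \<le> r" for s
      using column_residues_distinct[OF assms(1) that p'(1)] i
        cls_shift_eq_iff(2)[of n "js ! s" 1 "js ! p'"] by auto
  qed
next
  case False
  have "cls n (js ! s - 1) \<noteq> i" if "s \<le> r" for s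
  proof
    assume i: "cls n (js ! s - 1) = i"
    then have "js[s := js ! s - 1] \<in> column_basis r"
      using False column_lower_iff[OF assms(1) that] by simp
    then show False using edge_lower[OF assms(1) that] i assms(3) by blast
  qed
  then show ?thesis using empty False by blast
qed

lemma cls_neq: "cls n x \<noteq> cls n (x + 1)" "cls n (x - 1) \<noteq> cls n x" "cls n (x - 1) \<noteq> cls n (x + 1)"
  using cls_eq_window[of n x "x + 1"] cls_eq_window[of n "x - 1" x] cls_eq_window[of n "x - 1" "x + 1"] r
  by auto

section \<open>The operators on columns\<close>

lemma pr_scaleC_basis_vec: "pr C (c *\<^sub>C basis_vec b) = (if b \<in> C then c *\<^sub>C basis_vec b else 0)"
  by (simp add: pr_def lin_ext_scaleC)

definition X :: "sign \<Rightarrow> int \<Rightarrow> int \<Rightarrow> int list \<Rightarrow> (int list \<Rightarrow>\<^sub>0 complex)" where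
  "X \<sigma> i s js = pr (column_basis r) (tensor_x n q bs \<sigma> i s js)"

definition moves :: "sign \<Rightarrow> int \<Rightarrow> int list \<Rightarrow> nat set" where
  "moves \<sigma> i js = {p. p < length js \<and> i = cls n (box_edge \<sigma> (js ! p))}"

text \<open>The coefficient in \<open>tensor_x\<close> for the summand that moves the entry at position \<open>p\<close>.\<close>

definition move_coeff :: "sign \<Rightarrow> int \<Rightarrow> int \<Rightarrow> int list \<Rightarrow> nat \<Rightarrow> complex" where
  "move_coeff \<sigma> i s js p = (let c = bs ! p * q powi box_edge \<sigma> (js ! p);
            others = (case \<sigma> of Pos \<Rightarrow> {..<p} | Neg \<Rightarrow> {p<..<length js})
        in (c powi s * (\<Prod>p'\<in>others.
              box_phi n q (\<lambda>c'. psi q (c' * inverse c)) i (bs ! p') (js ! p'))))"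

lemma X_eq: "X \<sigma> i s js = (\<Sum>p\<in>moves \<sigma> i js.
    if js[p := js ! p - sg \<sigma>] \<in> column_basis r
    then move_coeff \<sigma> i s js p *\<^sub>C basis_vec (js[p := js ! p - sg \<sigma>]) else 0)"
proof -
  have "tensor_x n q bs \<sigma> i s js
      = (\<Sum>p\<in>moves \<sigma> i js. move_coeff \<sigma> i s js p *\<^sub>C basis_vec (js[p := js ! p - sg \<sigma>]))"
    by (simp add: tensor_x_def moves_def move_coeff_def Let_def)
  then have "X \<sigma> i s js = (\<Sum>p\<in>moves \<sigma> i js.
      pr (column_basis r) (move_coeff \<sigma> i s js p *\<^sub>C basis_vec (js[p := js ! p - sg \<sigma>])))"
    by (simp add: X_def pr_def lin_ext_sum)
  then show ?thesis by (simp only: pr_scaleC_basis_vec)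
qed

text \<open>If the result of the move is a column, then all other tensor factors have residues different
from $i$ and $i+1$, so $\phi_i$ acts on them by $1$ and the coproduct contributes no further factor.
Otherwise the projection kills the summand.\<close>

lemma X_edge_Neg:
  assumes "edge i c b b'"
  shows "X Neg i s b = c powi s *\<^sub>C basis_vec b'"
proof -
  obtain p where p: "p \<le> r" "cls n (b ! p) = i" "c = par b p" "b' = b[p := b ! p + 1]"
    and b: "b \<in> column_basis r" "b' \<in> column_basis r"
    and others: "\<And>s. s \<le> r \<Longrightarrow> cls n (b ! s) = i \<longleftrightarrow> s = p" "\<And>s. s \<le> r \<Longrightarrow> cls n (b ! s - 1) \<noteq> i"
    using edge_out[OF assms] by metis
  have len: "length b = r + 1" using b(1) by (rule column_length)
  have "moves Neg i b = {p}"
    using p others(1) len by (auto simp: moves_def box_edge_def less_Suc_eq_le)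
  moreover have "move_coeff Neg i s b p = c powi s"
  proof -
    have "box_phi n q \<Psi> i (bs ! s) (b ! s) = 1" if "s \<in> {p<..<length b}" for s and \<Psi> :: "complex \<Rightarrow> complex"
    proof -
      have "s \<le> r" "s \<noteq> p" using that len by auto
      then show ?thesis using others[of s] by (auto simp: box_phi_eq)
    qed
    then show ?thesis
      using p(1,3) by (simp add: move_coeff_def box_edge_def Let_def bs_powi par_def)
  qed
  ultimately show ?thesis using p(4) b(2) by (simp add: X_eq)
qed

lemma X_edge_Pos:
  assumes "edge i c b b'"
  shows "X Pos i s b' = c powi s *\<^sub>C basis_vec b"
proof -
  obtain p where p: "p \<le> r" "cls n (b' ! p - 1) = i" "c = a * q powi (b' ! p - 1 - 2 * int p)"
      "b = b'[p := b' ! p - 1]"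
    and b: "b \<in> column_basis r" "b' \<in> column_basis r"
    and others: "\<And>s. s \<le> r \<Longrightarrow> cls n (b' ! s) \<noteq> i" "\<And>s. s \<le> r \<Longrightarrow> cls n (b' ! s - 1) = i \<longleftrightarrow> s = p"
    using edge_in[OF assms] by metis
  have len: "length b' = r + 1" using b(2) by (rule column_length)
  have "moves Pos i b' = {p}"
    using p others(2) len by (auto simp: moves_def box_edge_def less_Suc_eq_le)
  moreover have "move_coeff Pos i s b' p = c powi s"
  proof -
    have "box_phi n q \<Psi> i (bs ! s) (b' ! s) = 1" if "s \<in> {..<p}" for s and \<Psi> :: "complex \<Rightarrow> complex"
    proof -
      have "s \<le> r" "s \<noteq> p" using that p(1) by auto
      then show ?thesis using others[of s] by (auto simp: box_phi_eq)
    qed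
    then show ?thesis
      using p(1,3) by (simp add: move_coeff_def box_edge_def Let_def bs_powi)
  qed
  ultimately show ?thesis using p(4) b(1) by (simp add: X_eq)
qed

lemma X_zero_Neg:
  assumes "b \<in> column_basis r" "\<nexists>c b'. edge i c b b'"
  shows "X Neg i s b = 0"
proof -
  have "b[p := b ! p + 1] \<notin> column_basis r" if "p \<in> moves Neg i b" for p
  proof
    assume "b[p := b ! p + 1] \<in> column_basis r"
    moreover have "p \<le> r" "i = cls n (b ! p)"
      using that assms(1) by (auto simp: moves_def box_edge_def column_length less_Suc_eq_le)
    ultimately show False using edge_raise[OF assms(1)] assms(2) by blast
  qed
  then show ?thesis unfolding X_eq by (intro sum.neutral) auto
qed

lemma X_zero_Pos:
  assumes "b \<in> column_basis r" "\<nexists>c b'. edge i c b' b"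
  shows "X Pos i s b = 0"
proof -
  have "b[p := b ! p - 1] \<notin> column_basis r" if "p \<in> moves Pos i b" for p
  proof
    assume "b[p := b ! p - 1] \<in> column_basis r"
    moreover have "p \<le> r" "i = cls n (b ! p - 1)"
      using that assms(1) by (auto simp: moves_def box_edge_def column_length less_Suc_eq_le)
    ultimately show False using edge_lower[OF assms(1)] assms(2) by blast
  qed
  then show ?thesis unfolding X_eq by (intro sum.neutral) auto
qed

section \<open>Weights of columns\<close>

lemma tensor_wt_eq: "js \<in> column_basis r \<Longrightarrow> tensor_wt n js = (\<Sum>s\<le>r. box_wt n (js ! s))"
  by (simp add: tensor_wt_def sum_list_sum_nth column_length atLeast0LessThan lessThan_Suc_atMost)

lemma lookup_tensor_wt_H:
  assumes "js \<in> column_basis r" "i \<in> I n"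
  shows "Poly_Mapping.lookup (tensor_wt n js) (H i)
    = (\<Sum>s\<le>r. (if cls n (js ! s) = i then 1 else 0) - (if cls n (js ! s - 1) = i then 1 else 0))"
proof -
  have "n \<ge> 3" using r by simp
  then show ?thesis
    using lookup_box_wt_H[OF _ assms(2)] unfolding tensor_wt_eq[OF assms(1)] lookup_sum by simp
qed

lemma wt_edge: "edge i c b b' \<Longrightarrow> tensor_wt n b' = tensor_wt n b - \<alpha> n i"
proof -
  assume "edge i c b b'"
  then obtain p where p: "p \<le> r" "cls n (b ! p) = i" "b' = b[p := b ! p + 1]"
    and b: "b \<in> column_basis r" "b' \<in> column_basis r" by (metis edge_out)
  have "tensor_wt n b' = (\<Sum>s\<le>r. box_wt n (b[p := b ! p + 1] ! s))"
    unfolding tensor_wt_eq[OF b(2)] by (simp only: p(3))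
  also have "\<dots> = (\<Sum>s\<le>r. box_wt n (b ! s)) - box_wt n (b ! p) + box_wt n (b ! p + 1)"
    by (rule sum_list_update[OF p(1) column_length[OF b(1)]])
  finally show ?thesis unfolding tensor_wt_eq[OF b(1)] box_wt_step p(2) by simp
qed

lemma wt_out:
  assumes e: "edge i c b b'"
  shows "Poly_Mapping.lookup (tensor_wt n b) (H i) = 1"
proof -
  obtain p where p: "p \<le> r" "cls n (b ! p) = i" and b: "b \<in> column_basis r"
    and others: "\<And>s. s \<le> r \<Longrightarrow> cls n (b ! s) = i \<longleftrightarrow> s = p" "\<And>s. s \<le> r \<Longrightarrow> cls n (b ! s - 1) \<noteq> i"
    using edge_out[OF e] by metis
  have i: "i \<in> I n" using p(2) by auto
  show ?thesis
    unfolding lookup_tensor_wt_H[OF b i] by (subst sum.one_term[OF p(1)]) (use p others in auto)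
qed

lemma wt_none:
  assumes b: "b \<in> column_basis r" and i: "i \<in> I n" and none: "\<nexists>c b'. edge i c b b' \<or> edge i c b' b"
  shows "Poly_Mapping.lookup (tensor_wt n b) (H i) = 0"
proof (cases rule: no_edge[OF b i none, case_names empty full])
  case empty
  then show ?thesis unfolding lookup_tensor_wt_H[OF b i] by (intro sum.neutral) auto
next
  case (full p p')
  have "cls n (b ! p - 1) \<noteq> i" "cls n (b ! p') \<noteq> i"
    using full(3,7,8) full(1,2) by auto
  then show ?thesis
    unfolding lookup_tensor_wt_H[OF b i]
    by (subst sum.two_terms[OF full(1-3)]) (use full in auto)
qed

lemma tensor_wt_in_lattice:
  assumes b: "b \<in> column_basis r"
  shows "Poly_Mapping.keys (tensor_wt n b) \<subseteq> hbasis n"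
    "i \<in> I n \<Longrightarrow> Poly_Mapping.lookup (tensor_wt n b) (H i) \<in> \<int>"
proof -
  show "Poly_Mapping.keys (tensor_wt n b) \<subseteq> hbasis n"
    unfolding tensor_wt_eq[OF b] by (intro keys_sum_subset keys_box_wt) simp
  show "Poly_Mapping.lookup (tensor_wt n b) (H i) \<in> \<int>" if "i \<in> I n"
    unfolding lookup_tensor_wt_H[OF b that] by (intro Ints_sum) auto
qed

section \<open>Eigenvalues on columns\<close>

lemma tensor_phi_eq: "js \<in> column_basis r \<Longrightarrow>
    tensor_phi n q bs \<epsilon> i js = (\<Prod>s\<le>r. box_phi n q (psi_expansion q \<epsilon>) i (bs ! s) (js ! s))"
  by (simp add: tensor_phi_def column_length lessThan_Suc_atMost)

lemma phi_out:
  assumes e: "edge i c b b'"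
  shows "tensor_phi n q bs \<epsilon> i b = psi_expansion q \<epsilon> c"
proof -
  obtain p where p: "p \<le> r" "cls n (b ! p) = i" "c = par b p" and b: "b \<in> column_basis r"
    and others: "\<And>s. s \<le> r \<Longrightarrow> cls n (b ! s) = i \<longleftrightarrow> s = p" "\<And>s. s \<le> r \<Longrightarrow> cls n (b ! s - 1) \<noteq> i"
    using edge_out[OF e] by metis
  show ?thesis
    unfolding tensor_phi_eq[OF b]
    by (subst prod.one_term[OF p(1)]) (use p others in \<open>auto simp: box_phi_eq bs_powi par_def\<close>)
qed

lemma phi_in:
  assumes e: "edge i c b b'"
  shows "tensor_phi n q bs \<epsilon> i b' = inverse (psi_expansion q \<epsilon> (q\<^sup>2 * c))"
proof -
  obtain p where p: "p \<le> r" "cls n (b' ! p - 1) = i" "c = a * q powi (b' ! p - 1 - 2 * int p)"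
    and b: "b' \<in> column_basis r"
    and others: "\<And>s. s \<le> r \<Longrightarrow> cls n (b' ! s) \<noteq> i" "\<And>s. s \<le> r \<Longrightarrow> cls n (b' ! s - 1) = i \<longleftrightarrow> s = p"
    using edge_in[OF e] by metis
  have "b' ! p + 1 - 2 * int p = 2 + (b' ! p - 1 - 2 * int p)" by simp
  then have "q powi (b' ! p + 1 - 2 * int p) = q\<^sup>2 * q powi (b' ! p - 1 - 2 * int p)"
    by (simp only: power_int_add exp_not_eq_zero power_int_numeral simp_thms)
  then have c: "bs ! p * q powi (b' ! p + 1) = q\<^sup>2 * c"
    using p(1,3) by (simp add: bs_powi)
  show ?thesis
    unfolding tensor_phi_eq[OF b]
    by (subst prod.one_term[OF p(1)]) (use p others c in \<open>auto simp: box_phi_eq\<close>)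
qed

text \<open>The factors of two entries with residues $i$ and $i+1$ are inverse to each other.\<close>

lemma phi_none:
  assumes b: "b \<in> column_basis r" and i: "i \<in> I n" and none: "\<nexists>c b'. edge i c b b' \<or> edge i c b' b"
  shows "tensor_phi n q bs \<epsilon> i b = 1"
proof (cases rule: no_edge[OF b i none, case_names empty full])
  case empty
  then show ?thesis unfolding tensor_phi_eq[OF b] by (intro prod.neutral) (auto simp: box_phi_eq)
next
  case (full p p')
  let ?f = "\<lambda>s. box_phi n q (psi_expansion q \<epsilon>) i (bs ! s) (b ! s)"
  have "cls n (b ! p') \<noteq> i" using full by auto
  moreover have "b ! p' + 1 - 2 * int p' = b ! p - 2 * int p" using full(6) by simp
  then have "bs ! p' * q powi (b ! p' + 1) = par b p" using full(2) by (simp add: bs_powi par_def)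
  ultimately have "?f p = psi_expansion q \<epsilon> (par b p)" "?f p' = inverse (psi_expansion q \<epsilon> (par b p))"
    using full(1,4,5) by (auto simp: box_phi_eq bs_powi par_def)
  moreover have "?f s = 1" if "s \<le> r" "s \<noteq> p" "s \<noteq> p'" for s
    using full that by (auto simp: box_phi_eq)
  ultimately have "(\<Prod>s\<le>r. ?f s) = psi_expansion q \<epsilon> (par b p) * inverse (psi_expansion q \<epsilon> (par b p))"
    using prod.two_terms[OF full(1-3), of ?f] by simp
  then show ?thesis
    unfolding tensor_phi_eq[OF b] using psi_expansion_inverse_cancel[OF _ par_nonzero] by simp
qed

text \<open>Only the tensor factor that moves is affected. If $i$ is the residue before it, a factor
$\psi(qcz)^{-1}$ is lost; if $i$ is the residue after it, a factor $\psi(qcz)$ is gained.\<close>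

lemma phi_move:
  assumes e: "edge j c b b'" and i: "i \<in> I n" "i \<noteq> j"
  shows "adjacent n i j \<Longrightarrow> tensor_phi n q bs \<epsilon> i b' = tensor_phi n q bs \<epsilon> i b * psi_expansion q \<epsilon> (q * c)"
    and "\<not> adjacent n i j \<Longrightarrow> tensor_phi n q bs \<epsilon> i b' = tensor_phi n q bs \<epsilon> i b"
proof -
  obtain p where p: "p \<le> r" "cls n (b ! p) = j" "c = par b p" "b' = b[p := b ! p + 1]"
    and b: "b \<in> column_basis r" "b' \<in> column_basis r" using edge_out[OF e] by metis
  let ?g = "\<lambda>s x. box_phi n q (psi_expansion q \<epsilon>) i (bs ! s) x"
  have upd: "tensor_phi n q bs \<epsilon> i b' * ?g p (b ! p) = tensor_phi n q bs \<epsilon> i b * ?g p (b ! p + 1)"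
    using prod_list_update[OF p(1) column_length[OF b(1)], of ?g "b ! p + 1"]
    unfolding tensor_phi_eq[OF b(1)] tensor_phi_eq[OF b(2)] p(4)[symmetric] .
  have adj: "adjacent n i j \<longleftrightarrow> i = cls n (b ! p - 1) \<or> i = cls n (b ! p + 1)"
    using adjacent_cls[OF i(1), of "b ! p"] p(2) by simp
  have "b ! p + 1 - 2 * int p = 1 + (b ! p - 2 * int p)" by simp
  then have "q powi (b ! p + 1 - 2 * int p) = q * q powi (b ! p - 2 * int p)"
    by (simp only: power_int_add exp_not_eq_zero power_int_1_right simp_thms)
  then have c: "bs ! p * q powi (b ! p + 1) = q * c" using p(1,3) by (simp add: bs_powi par_def)
  have c0: "q * c \<noteq> 0" using par_nonzero p(3) by simp
  show "tensor_phi n q bs \<epsilon> i b' = tensor_phi n q bs \<epsilon> i b" if "\<not> adjacent n i j"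
  proof -
    have "?g p (b ! p) = 1" "?g p (b ! p + 1) = 1"
      using adj that i(2) p(2) by (auto simp: box_phi_eq)
    then show ?thesis using upd by simp
  qed
  assume "adjacent n i j"
  then consider "i = cls n (b ! p - 1)" | "i = cls n (b ! p + 1)" using adj by blast
  then show "tensor_phi n q bs \<epsilon> i b' = tensor_phi n q bs \<epsilon> i b * psi_expansion q \<epsilon> (q * c)"
  proof cases
    case 1
    then have "?g p (b ! p) = inverse (psi_expansion q \<epsilon> (q * c))" "?g p (b ! p + 1) = 1"
      using i(2) p(2) cls_neq[of "b ! p"] c by (auto simp: box_phi_eq)
    then have "tensor_phi n q bs \<epsilon> i b = tensor_phi n q bs \<epsilon> i b' * inverse (psi_expansion q \<epsilon> (q * c))"
      using upd by simp
    moreover have "inverse (psi_expansion q \<epsilon> (q * c)) * psi_expansion q \<epsilon> (q * c) = 1"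
      using psi_expansion_inverse_cancel[OF exp_not_eq_zero c0] by (simp only: mult.commute)
    ultimately show ?thesis by (simp only: mult.assoc mult_1_right)
  next
    case 2
    then have "?g p (b ! p) = 1" "?g p (b ! p + 1) = psi_expansion q \<epsilon> (q * c)"
      using i(2) p(2) cls_neq[of "b ! p"] c by (auto simp: box_phi_eq)
    then show ?thesis using upd by simp
  qed
qed

section \<open>Interplay of moves\<close>

text \<open>Either the same entry moves twice, and its value grows by one; or $j = i-1$ and the second move
becomes possible because the first entry has made room, in which case
\<open>column_adjacent_residues\<close> relates the two values.\<close>

lemma edges_adjacent:
  assumes "edge i c b b'" "edge j d b' b''" "i \<noteq> j" "adjacent n i j"
  shows "d = q * c"
proof -
  obtain p where p: "p \<le> r" "cls n (b ! p) = i" "c = par b p" and b: "b \<in> column_basis r"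
    and others: "\<And>s. s \<le> r \<Longrightarrow> cls n (b ! s - 1) \<noteq> i"
    and nth: "\<And>s. b' ! s = (if s = p then b ! p + 1 else b ! s)"
    using edge_out[OF assms(1)] by metis
  obtain p' where p': "p' \<le> r" "cls n (b' ! p') = j" "d = par b' p'"
    using edge_out[OF assms(2)] by metis
  have "b' ! p' - 2 * int p' = 1 + (b ! p - 2 * int p)"
  proof (cases "p' = p")
    case True
    then show ?thesis using nth by simp
  next
    case False
    then have eq: "b' ! p' = b ! p'" using nth by simp
    have "j = cls n (b ! p + 1) \<or> j = cls n (b ! p - 1)"
      using assms(4) p(2) by (auto simp: adjacent_def cls_add_cls)
    moreover have "j \<noteq> cls n (b ! p + 1)"
      using others[OF p'(1)] p'(2) p(2) eq cls_shift_eq_iff(2)[of n "b ! p'" 1 "b ! p + 1"] by auto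
    ultimately have "cls n (b ! p') = cls n (b ! p - 1)" using p'(2) eq by simp
    then have "cls n (b ! p) = cls n (b ! p' + 1)"
      using cls_shift_eq_iff(1)[of n "b ! p'" 1 "b ! p - 1"] by simp
    then have "b ! p - 2 * int p = b ! p' - 2 * int p' - 1"
      by (rule column_adjacent_residues[OF b p'(1) p(1)])
    then show ?thesis using eq by simp
  qed
  then have "q powi (b' ! p' - 2 * int p') = q * q powi (b ! p - 2 * int p)"
    by (simp only: power_int_add exp_not_eq_zero power_int_1_right simp_thms)
  then show ?thesis using p(3) p'(3) by (simp add: par_def)
qed

text \<open>In this and the next two lemmas two different entries move, and neither move changes whether the
other is possible.\<close>

lemma edges_far:
  assumes "edge i c b b'" "edge j d b' b''" "i \<noteq> j" "\<not> adjacent n i j"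
  shows "\<exists>b1. edge j d b b1 \<and> edge i c b1 b''"
proof -
  obtain p where p: "p \<le> r" "cls n (b ! p) = i" "c = par b p" "b' = b[p := b ! p + 1]"
    and b: "b \<in> column_basis r" "b' \<in> column_basis r"
    and nth: "\<And>s. b' ! s = (if s = p then b ! p + 1 else b ! s)"
    using edge_out[OF assms(1)] by metis
  obtain p' where p': "p' \<le> r" "cls n (b' ! p') = j" "d = par b' p'" "b'' = b'[p' := b' ! p' + 1]"
    and b'': "b'' \<in> column_basis r"
    using edge_out[OF assms(2)] by metis
  have ne: "p' \<noteq> p" using assms(4) p(2) p'(2) nth by (auto simp: adjacent_def cls_add_cls)
  have eq: "b' ! p' = b ! p'" using nth ne by simp
  define b1 where "b1 = b[p' := b ! p' + 1]"
  have "cls n (b ! s) \<noteq> cls n (b ! p' + 1)" if s: "s \<le> r" for s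
  proof (cases "s = p")
    case False
    then show ?thesis
      using column_raise_iff[OF b(2) p'(1)] b'' p'(4) s nth eq by auto
  next
    case True
    have "cls n (b ! p) = cls n (b ! p' + 1) \<Longrightarrow> j = cls n (i - 1)"
      using cls_shift_eq_iff(2)[of n "b ! p" 1 "b ! p' + 1"] p(2) p'(2) eq cls_add_cls(2)[of n "b ! p" 1] by simp
    then show ?thesis using True assms(4) by (auto simp: adjacent_def)
  qed
  then have b1: "b1 \<in> column_basis r" using column_raise_iff[OF b(1) p'(1)] by (simp add: b1_def)
  have "edge j d b b1"
    using edge_raise[OF b(1) p'(1)] b1 p'(2,3) eq by (simp add: b1_def par_def)
  moreover have "b1 ! p = b ! p" using ne by (simp add: b1_def)
  moreover have "b'' = b1[p := b1 ! p + 1]"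
    using p(4) p'(4) eq ne \<open>b1 ! p = b ! p\<close> by (simp add: b1_def list_update_swap)
  ultimately show ?thesis
    using edge_raise[OF b1 p(1)] b'' p(2,3) by (auto simp: par_def)
qed

lemma edges_join:
  assumes "edge i c b b''" "edge j d b' b''" "i \<noteq> j"
  shows "\<exists>b1. edge j d b1 b \<and> edge i c b1 b'"
proof -
  obtain p where p: "p \<le> r" "cls n (b ! p) = i" "c = par b p" "b'' = b[p := b ! p + 1]"
    and b: "b \<in> column_basis r" "b'' \<in> column_basis r"
    and nth: "\<And>s. b'' ! s = (if s = p then b ! p + 1 else b ! s)"
    using edge_out[OF assms(1)] by metis
  obtain p' where p': "p' \<le> r" "cls n (b'' ! p' - 1) = j" "d = a * q powi (b'' ! p' - 1 - 2 * int p')"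
    "b' = b''[p' := b'' ! p' - 1]"
    and b': "b' \<in> column_basis r" and others: "\<And>s. s \<le> r \<Longrightarrow> cls n (b'' ! s) \<noteq> j"
    using edge_in[OF assms(2)] by metis
  have ne: "p' \<noteq> p" using assms(3) p(2) p'(2) nth by auto
  have eq: "b'' ! p' = b ! p'" using nth ne by simp
  define b1 where "b1 = b[p' := b ! p' - 1]"
  have "cls n (b ! s) \<noteq> cls n (b ! p' - 1)" if s: "s \<le> r" for s
    using others[OF s] nth[of s] p(2) p'(2) eq assms(3) by (cases "s = p") auto
  then have b1: "b1 \<in> column_basis r" using column_lower_iff[OF b(1) p'(1)] by (simp add: b1_def)
  have "edge j d b1 b"
    using edge_lower[OF b(1) p'(1)] b1 p'(2,3) eq by (simp add: b1_def)
  moreover have "b1 ! p = b ! p" using ne by (simp add: b1_def)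
  moreover have "b' = b1[p := b1 ! p + 1]"
    using p(4) p'(4) eq ne \<open>b1 ! p = b ! p\<close> by (simp add: b1_def list_update_swap)
  ultimately show ?thesis
    using edge_raise[OF b1 p(1)] b' p(2,3) by (auto simp: par_def)
qed

lemma edges_meet:
  assumes "edge i c b'' b" "edge j d b'' b'" "i \<noteq> j"
  shows "\<exists>b1. edge j d b b1 \<and> edge i c b' b1"
proof -
  obtain p where p: "p \<le> r" "cls n (b'' ! p) = i" "c = par b'' p" "b = b''[p := b'' ! p + 1]"
    and b: "b'' \<in> column_basis r" "b \<in> column_basis r"
    and nth: "\<And>s. b ! s = (if s = p then b'' ! p + 1 else b'' ! s)"
    using edge_out[OF assms(1)] by metis
  obtain p' where p': "p' \<le> r" "cls n (b'' ! p') = j" "d = par b'' p'" "b' = b''[p' := b'' ! p' + 1]"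
    and b': "b' \<in> column_basis r" and nth': "\<And>s. b' ! s = (if s = p' then b'' ! p' + 1 else b'' ! s)"
    using edge_out[OF assms(2)] by metis
  have ne: "p' \<noteq> p" using assms(3) p(2) p'(2) by auto
  have eq: "b ! p' = b'' ! p'" using nth ne by simp
  define b1 where "b1 = b[p' := b ! p' + 1]"
  have free: "cls n (b'' ! s) \<noteq> cls n (b'' ! p' + 1)" if "s \<le> r" for s
    using column_raise_iff[OF b(1) p'(1)] b' p'(4) that by simp
  have "cls n (b'' ! p + 1) \<noteq> cls n (b'' ! p' + 1)"
    using p(2) p'(2) assms(3) by (simp add: cls_shift_eq_iff)
  then have "cls n (b ! s) \<noteq> cls n (b ! p' + 1)" if s: "s \<le> r" for s
    using free[OF s] nth[of s] eq by (cases "s = p") auto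
  then have b1: "b1 \<in> column_basis r" using column_raise_iff[OF b(2) p'(1)] by (simp add: b1_def)
  have "edge j d b b1"
    using edge_raise[OF b(2) p'(1)] b1 p'(2,3) eq by (simp add: b1_def par_def)
  moreover have "b' ! p = b'' ! p" using nth' ne by simp
  moreover have "b1 = b'[p := b' ! p + 1]"
    using p(4) p'(4) eq ne \<open>b' ! p = b'' ! p\<close> by (simp add: b1_def list_update_swap)
  ultimately show ?thesis
    using edge_raise[OF b' p(1)] b1 p(2,3) by (auto simp: par_def)
qed

lemma edge_module_column:
  assumes \<nu>: "Poly_Mapping.keys \<nu> \<subseteq> hbasis n" "\<And>i. i \<in> I n \<Longrightarrow> Poly_Mapping.lookup \<nu> (H i) = 0"
  shows "edge_module n t (column_basis r) edge X (tensor_phi n q bs) (\<lambda>js. tensor_wt n js + \<nu>)"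
proof unfold_locales
  have dest: "i \<in> I n \<and> b \<in> column_basis r \<and> b' \<in> column_basis r \<and> c \<noteq> 0" if "edge i c b b'" for i c b b'
    using that par_nonzero by (auto simp: edge_def)
  then show "edge i c b b' \<Longrightarrow> i \<in> I n \<and> b \<in> column_basis r \<and> b' \<in> column_basis r \<and> c \<noteq> 0" for i c b b' .
  show "\<forall>k>0. exp t ^ k \<noteq> 1" by (rule not_root)
  show "d = c \<and> b'' = b'" if e: "edge i c b b'" "edge i d b b''" for i c b b' d b''
  proof -
    obtain p where p: "c = par b p" "b' = b[p := b ! p + 1]" "\<And>s. s \<le> r \<Longrightarrow> cls n (b ! s) = i \<longleftrightarrow> s = p"
      using edge_out[OF e(1)] by metis
    obtain p' where p': "p' \<le> r" "cls n (b ! p') = i" "d = par b p'" "b'' = b[p' := b ! p' + 1]"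
      using edge_out[OF e(2)] by metis
    then have "p' = p" using p(3) by simp
    then show ?thesis using p p' by simp
  qed
  show "d = c \<and> b'' = b" if e: "edge i c b b'" "edge i d b'' b'" for i c b b' d b''
  proof -
    obtain p where p: "c = a * q powi (b' ! p - 1 - 2 * int p)" "b = b'[p := b' ! p - 1]"
      "\<And>s. s \<le> r \<Longrightarrow> cls n (b' ! s - 1) = i \<longleftrightarrow> s = p"
      using edge_in[OF e(1)] by metis
    obtain p' where p': "p' \<le> r" "cls n (b' ! p' - 1) = i" "d = a * q powi (b' ! p' - 1 - 2 * int p')"
      "b'' = b'[p' := b' ! p' - 1]"
      using edge_in[OF e(2)] by metis
    then have "p' = p" using p(3) by simp
    then show ?thesis using p p' by simp
  qed
  show "edge i c b b' \<Longrightarrow> X Neg i s b = c powi s *\<^sub>C basis_vec b'" for i c b b' s by (rule X_edge_Neg)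
  show "edge i c b b' \<Longrightarrow> X Pos i s b' = c powi s *\<^sub>C basis_vec b" for i c b b' s by (rule X_edge_Pos)
  show "b \<in> column_basis r \<Longrightarrow> \<nexists>c b'. edge i c b b' \<Longrightarrow> X Neg i s b = 0" for i b s by (rule X_zero_Neg)
  show "b \<in> column_basis r \<Longrightarrow> \<nexists>c b'. edge i c b' b \<Longrightarrow> X Pos i s b = 0" for i b s by (rule X_zero_Pos)
  show "tensor_wt n b + \<nu> \<in> weight_lattice n" if "b \<in> column_basis r" for b
    using keys_add_subset[OF tensor_wt_in_lattice(1)[OF that] \<nu>(1)] tensor_wt_in_lattice(2)[OF that] \<nu>(2)
    by (simp add: weight_lattice_def pairing_hh lookup_add)
  show "edge i c b b' \<Longrightarrow> tensor_wt n b' + \<nu> = tensor_wt n b + \<nu> - \<alpha> n i" for i c b b'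
    using wt_edge by simp
  show "edge i c b b' \<Longrightarrow> pairing (tensor_wt n b + \<nu>) (hh i) = 1" for i c b b'
    using wt_out \<nu>(2) dest by (simp add: pairing_hh lookup_add)
  show "i \<in> I n \<Longrightarrow> b \<in> column_basis r \<Longrightarrow> \<nexists>c b'. edge i c b b' \<or> edge i c b' b \<Longrightarrow>
      pairing (tensor_wt n b + \<nu>) (hh i) = 0" for i b
    using wt_none \<nu>(2) by (simp add: pairing_hh lookup_add)
  show "edge i c b b' \<Longrightarrow> tensor_phi n q bs \<epsilon> i b = psi_expansion (exp t) \<epsilon> c" for i c b b' \<epsilon>
    by (rule phi_out)
  show "tensor_phi n q bs \<epsilon> i b' = psi_expansion (inverse (exp t)) \<epsilon> c" if "edge i c b b'" for i c b b' \<epsilon>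
    using phi_in[OF that] inverse_psi_expansion[of q c \<epsilon>] dest[OF that] by simp
  show "i \<in> I n \<Longrightarrow> b \<in> column_basis r \<Longrightarrow> \<nexists>c b'. edge i c b b' \<or> edge i c b' b \<Longrightarrow>
      tensor_phi n q bs \<epsilon> i b = 1" for i b \<epsilon>
    by (rule phi_none)
  show "edge j c b b' \<Longrightarrow> i \<in> I n \<Longrightarrow> i \<noteq> j \<Longrightarrow> adjacent n i j \<Longrightarrow>
      tensor_phi n q bs \<epsilon> i b' = tensor_phi n q bs \<epsilon> i b * psi_expansion (exp t) \<epsilon> (exp t * c)" for i j c b b' \<epsilon>
    by (rule phi_move(1))
  show "edge j c b b' \<Longrightarrow> i \<in> I n \<Longrightarrow> i \<noteq> j \<Longrightarrow> \<not> adjacent n i j \<Longrightarrow>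
      tensor_phi n q bs \<epsilon> i b' = tensor_phi n q bs \<epsilon> i b" for i j c b b' \<epsilon>
    by (rule phi_move(2))
qed (fact edges_adjacent edges_far edges_join edges_meet)+

lemma connected:
  assumes "b0 \<in> column_basis r"
  shows "\<forall>P. P b0 \<longrightarrow> (\<forall>i c b b'. edge i c b b' \<longrightarrow> P b = P b') \<longrightarrow> (\<forall>b\<in>column_basis r. P b)"
proof (intro allI impI ballI)
  fix P b assume P: "P b0" "\<forall>i c b b'. edge i c b b' \<longrightarrow> P b = P b'" and b: "b \<in> column_basis r"
  show "P b"
  proof (rule column_connected[of b0 r P, OF assms P(1)])
    show "b \<in> column_basis r" by (rule b)
    show "P js = P (js[p := js ! p + 1])"
      if "js \<in> column_basis r" "p \<le> r" "js[p := js ! p + 1] \<in> column_basis r" for js p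
      using P(2) edge_raise[OF that] by blast
  qed
qed

text \<open>A move of colour different from \<open>j\<close> does not change the quotient of any \<open>js ! p - j - 1\<close> by the
period, so each entry stays in an interval of length $n+1$.\<close>

lemma finite_components:
  assumes j: "j \<in> I n" and b: "b \<in> column_basis r"
  shows "\<exists>C. finite C \<and> b \<in> C \<and> C \<subseteq> column_basis r \<and>
    (\<forall>i c b1 b2. edge i c b1 b2 \<longrightarrow> i \<noteq> j \<longrightarrow> (b1 \<in> C \<longleftrightarrow> b2 \<in> C))"
proof -
  let ?N = "int n + 1"
  define C where "C = {js \<in> column_basis r. \<forall>p\<le>r. (js ! p - j - 1) div ?N = (b ! p - j - 1) div ?N}"
  define S where "S = (\<Union>p\<in>{..r}. {j + 1 + ?N * ((b ! p - j - 1) div ?N)..j + 1 + ?N * ((b ! p - j - 1) div ?N) + ?N})"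
  have "C \<subseteq> {xs. set xs \<subseteq> S \<and> length xs = r + 1}"
  proof
    fix js assume js: "js \<in> C"
    then have len: "length js = r + 1" using column_length[of js r] by (simp add: C_def)
    have "js ! p \<in> S" if "p \<le> r" for p
    proof -
      define N x where "N = ?N" and "x = js ! p - j - 1"
      have "x div N = (b ! p - j - 1) div N" using js that by (simp add: C_def N_def x_def)
      then have "x = N * ((b ! p - j - 1) div N) + x mod N" by (metis mult_div_mod_eq)
      moreover have "N > 0" by (simp add: N_def)
      then have "0 \<le> x mod N" "x mod N < N" by (rule pos_mod_sign, rule pos_mod_bound)
      ultimately have "js ! p \<in> {j + 1 + N * ((b ! p - j - 1) div N)..j + 1 + N * ((b ! p - j - 1) div N) + N}"
        unfolding atLeastAtMost_iff x_def by linarith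
      then have "js ! p \<in> {j + 1 + ?N * ((b ! p - j - 1) div ?N)..j + 1 + ?N * ((b ! p - j - 1) div ?N) + ?N}"
        unfolding N_def .
      then show ?thesis using that unfolding S_def by blast
    qed
    then have "set js \<subseteq> S" using len by (auto simp: in_set_conv_nth)
    then show "js \<in> {xs. set xs \<subseteq> S \<and> length xs = r + 1}" using len by simp
  qed
  moreover have "finite S" by (simp add: S_def)
  ultimately have "finite C" using finite_lists_length_eq finite_subset by blast
  moreover have "b1 \<in> C \<longleftrightarrow> b2 \<in> C" if e: "edge i c b1 b2" "i \<noteq> j" for i c b1 b2
  proof -
    obtain p where p: "p \<le> r" "cls n (b1 ! p) = i" and bb: "b1 \<in> column_basis r" "b2 \<in> column_basis r"
      and nth: "\<And>s. b2 ! s = (if s = p then b1 ! p + 1 else b1 ! s)"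
      using edge_out[OF e(1)] by metis
    have "cls n (b1 ! p) \<noteq> cls n j" using p(2) e(2) cls_I[OF j] by simp
    then have "cls n (b1 ! p - j) \<noteq> 0" by (simp add: cls_eq_iff) (simp add: cls_def dvd_eq_mod_eq_0)
    then have "(b1 ! p - j) div ?N = (b1 ! p - j - 1) div ?N"
      using div_step[of n "b1 ! p - j"] by simp
    then have "(b2 ! s - j - 1) div ?N = (b1 ! s - j - 1) div ?N" for s using nth[of s] by simp
    then show ?thesis using bb by (simp add: C_def)
  qed
  moreover have "b \<in> C" "C \<subseteq> column_basis r" using b by (auto simp: C_def)
  ultimately show ?thesis by blast
qed

section \<open>Monomials of columns\<close>

text \<open>This encodes the eigenvalues on the single box $\boxed{x}$ in the tensor factor at position $s$.
The weight \<open>\<nu>\<close> in the next definition is a shift of the grading.\<close>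

definition box_mono :: "nat \<Rightarrow> int \<Rightarrow> int \<times> complex \<Rightarrow>\<^sub>0 int" where
  "box_mono s x = Poly_Mapping.single (cls n x, a * q powi (x - 2 * int s - 1)) 1
     - Poly_Mapping.single (cls n (x - 1), a * q powi (x - 2 * int s)) 1"

definition mono_of :: "weight \<Rightarrow> int list \<Rightarrow> mono" where
  "mono_of \<nu> js = (tensor_wt n js + \<nu>, \<Sum>s\<le>r. box_mono s (js ! s))"

lemma q_powi_pred: "a * q powi (x - 1) = a * q powi x * inverse q"
  by (simp add: power_int_diff divide_inverse)

lemma q_powi_Suc: "a * q powi (x + 1) = a * q powi x * q"
  by (simp add: power_int_add)

lemma u_exp_mono_of: "u_exp (mono_of \<nu> js) i x = (\<Sum>s\<le>r.
    (if cls n (js ! s) = i then if x = a * q powi (js ! s - 2 * int s - 1) then 1 else 0 else 0)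
    - (if cls n (js ! s - 1) = i then if x = a * q powi (js ! s - 2 * int s) then 1 else 0 else 0))"
  unfolding u_exp_def mono_of_def box_mono_def snd_conv lookup_sum lookup_minus lookup_single when_def
  by (intro sum.cong) auto

lemma u_exp_out:
  assumes e: "edge i c b b'"
  shows "u_exp (mono_of \<nu> b) i x = (if x = c * inverse q then 1 else 0)"
proof -
  obtain p where p: "p \<le> r" "cls n (b ! p) = i" "c = par b p"
    and others: "\<And>s. s \<le> r \<Longrightarrow> cls n (b ! s) = i \<longleftrightarrow> s = p" "\<And>s. s \<le> r \<Longrightarrow> cls n (b ! s - 1) \<noteq> i"
    using edge_out[OF e] by metis
  have "c * inverse q = a * q powi (b ! p - 2 * int p - 1)"
    unfolding p(3) par_def by (rule q_powi_pred[symmetric])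
  then show ?thesis
    unfolding u_exp_mono_of by (subst sum.one_term[OF p(1)]) (use p others in auto)
qed

lemma u_exp_in:
  assumes e: "edge i c b b'"
  shows "u_exp (mono_of \<nu> b') i x = (if x = c * q then - 1 else 0)"
proof -
  obtain p where p: "p \<le> r" "cls n (b' ! p - 1) = i" "c = a * q powi (b' ! p - 1 - 2 * int p)"
    and others: "\<And>s. s \<le> r \<Longrightarrow> cls n (b' ! s) \<noteq> i" "\<And>s. s \<le> r \<Longrightarrow> cls n (b' ! s - 1) = i \<longleftrightarrow> s = p"
    using edge_in[OF e] by metis
  have "c * q = a * q powi (b' ! p - 1 - 2 * int p + 1)"
    unfolding p(3) by (rule q_powi_Suc[symmetric])
  then have "c * q = a * q powi (b' ! p - 2 * int p)" by simp
  then show ?thesis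
    unfolding u_exp_mono_of by (subst sum.one_term[OF p(1)]) (use p others in auto)
qed

lemma u_exp_none:
  assumes b: "b \<in> column_basis r" and i: "i \<in> I n" and none: "\<nexists>c b'. edge i c b b' \<or> edge i c b' b"
  shows "u_exp (mono_of \<nu> b) i x = 0"
proof (cases rule: no_edge[OF b i none, case_names empty full])
  case empty
  then show ?thesis unfolding u_exp_mono_of by (intro sum.neutral) auto
next
  case (full p p')
  have "cls n (b ! p - 1) \<noteq> i" "cls n (b ! p') \<noteq> i" using full by auto
  moreover have "b ! p - 2 * int p - 1 = b ! p' - 2 * int p'" using full(6) by simp
  ultimately show ?thesis
    unfolding u_exp_mono_of by (subst sum.two_terms[OF full(1-3)]) (use full in auto)
qed

lemma vertex_cases:
  assumes "b \<in> column_basis r" "i \<in> I n"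
  obtains (out) c b' where "edge i c b b'" | (inn) c b' where "edge i c b' b"
  | (none) "\<nexists>c b'. edge i c b b' \<or> edge i c b' b"
  by blast

text \<open>After cancellation the monomial contains at most one $Y_{i,c}$ for each $i$, as the eigenvalue
of $\phi_i$ contains at most one factor $\psi$.\<close>

lemma mono_phi_mono_of:
  assumes b: "b \<in> column_basis r" and i: "i \<in> I n"
  shows "mono_phi q \<epsilon> i (mono_of \<nu> b) = tensor_phi n q bs \<epsilon> i b"
proof (cases rule: vertex_cases[OF b i, case_names out inn none])
  case (out c b')
  have "{x. u_exp (mono_of \<nu> b) i x \<noteq> 0} = {c * inverse q}" by (auto simp: u_exp_out[OF out])
  then show ?thesis
    unfolding phi_out[OF out]
    by (simp add: mono_phi_def u_exp_out[OF out] power_int_def mult.assoc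
        del: psi_expansion.simps)
next
  case (inn c b')
  have "{x. u_exp (mono_of \<nu> b) i x \<noteq> 0} = {c * q}" by (auto simp: u_exp_in[OF inn])
  then show ?thesis
    unfolding phi_in[OF inn]
    by (simp add: mono_phi_def u_exp_in[OF inn] power_int_def power2_eq_square mult_ac
        del: psi_expansion.simps)
next
  case none
  then show ?thesis using u_exp_none[OF b i] phi_none[OF b i] by (simp add: mono_phi_def)
qed

lemma mono_of_in_monomials:
  assumes b: "b \<in> column_basis r"
    and \<nu>: "Poly_Mapping.keys \<nu> \<subseteq> hbasis n" "\<And>i. i \<in> I n \<Longrightarrow> Poly_Mapping.lookup \<nu> (H i) = 0"
  shows "mono_of \<nu> b \<in> monomials n"
proof -
  interpret EM: edge_module n t "column_basis r" edge X "tensor_phi n q bs" "\<lambda>js. tensor_wt n js + \<nu>"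
    by (rule edge_module_column[OF \<nu>])
  have "Poly_Mapping.keys (snd (mono_of \<nu> b)) \<subseteq> I n \<times> (- {0})"
    unfolding mono_of_def snd_conv box_mono_def
    by (intro keys_sum_subset keys_diff_subset) (use a in auto)
  moreover have "of_int (\<Sum>x | u_exp (mono_of \<nu> b) i x \<noteq> 0. u_exp (mono_of \<nu> b) i x)
      = pairing (tensor_wt n b + \<nu>) (hh i)" if i: "i \<in> I n" for i
  proof (cases rule: vertex_cases[OF b i, case_names out inn none])
    case (out c b')
    have "{x. u_exp (mono_of \<nu> b) i x \<noteq> 0} = {c * inverse q}" by (auto simp: u_exp_out[OF out])
    then show ?thesis using EM.pairing_out[OF out] by (simp add: u_exp_out[OF out])
  next
    case (inn c b')
    have "{x. u_exp (mono_of \<nu> b) i x \<noteq> 0} = {c * q}" by (auto simp: u_exp_in[OF inn])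
    then show ?thesis using EM.pairing_in[OF inn] by (simp add: u_exp_in[OF inn])
  next
    case none
    then show ?thesis using u_exp_none[OF b i none] EM.pairing_none[OF i b none] by simp
  qed
  ultimately show ?thesis
    using EM.wt_in_lattice[OF b] by (simp add: monomials_def mono_of_def)
qed

lemma mono_of_edge:
  assumes e: "edge i c b b'"
  shows "mono_of \<nu> b' = mono_of \<nu> b - A n q i c"
proof -
  obtain p where p: "p \<le> r" "cls n (b ! p) = i" "c = par b p" "b' = b[p := b ! p + 1]"
    and b: "b \<in> column_basis r"
    using edge_out[OF e] by metis
  have "c * inverse q = a * q powi (b ! p - 2 * int p - 1)"
    unfolding p(3) par_def by (rule q_powi_pred[symmetric])
  moreover have "c * q = a * q powi (b ! p - 2 * int p + 1)"
    unfolding p(3) par_def by (rule q_powi_Suc[symmetric])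
  moreover have "b ! p - 2 * int p + 1 = b ! p + 1 - 2 * int p" by simp
  ultimately have c: "c * inverse q = a * q powi (b ! p - 2 * int p - 1)" "c * q = a * q powi (b ! p + 1 - 2 * int p)"
    by (simp_all only:)
  have cls: "cls n (i - 1) = cls n (b ! p - 1)" "cls n (i + 1) = cls n (b ! p + 1)"
    using p(2) by (auto simp: cls_add_cls)
  have "(\<Sum>s\<le>r. box_mono s (b' ! s)) = (\<Sum>s\<le>r. box_mono s (b ! s)) - box_mono p (b ! p) + box_mono p (b ! p + 1)"
    unfolding p(4) by (rule sum_list_update[OF p(1) column_length[OF b]])
  moreover have "box_mono p (b ! p) = Poly_Mapping.single (i, c * inverse q) 1
      - Poly_Mapping.single (cls n (i - 1), c) 1"
    unfolding box_mono_def c cls p(2) using p(3) by (simp add: par_def)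
  moreover have "box_mono p (b ! p + 1) = Poly_Mapping.single (cls n (i + 1), c) 1
      - Poly_Mapping.single (i, c * q) 1"
  proof -
    have "b ! p + 1 - 2 * int p - 1 = b ! p - 2 * int p" by simp
    then show ?thesis unfolding box_mono_def c cls using p(2,3) by (simp add: par_def)
  qed
  ultimately show ?thesis
    using wt_edge[OF e] by (simp add: mono_of_def A_def wt_mono_def Y_def)
qed

text \<open>The exponents of the monomial show which edges start and end at a column, so the rules that
generate the crystal are the steps along edges. The rules can therefore not leave the
monomials of columns, and connectedness gives all of them.\<close>

lemma crystal_eq:
  assumes b0: "b0 \<in> column_basis r"
  shows "crystal n q (mono_of \<nu> b0) = mono_of \<nu> ` column_basis r"
proof
  show "crystal n q (mono_of \<nu> b0) \<subseteq> mono_of \<nu> ` column_basis r"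
  proof
    fix m assume "m \<in> crystal n q (mono_of \<nu> b0)"
    then show "m \<in> mono_of \<nu> ` column_basis r"
    proof induction
      case start
      then show ?case using b0 by blast
    next
      case (lower m i x)
      then obtain b where b: "b \<in> column_basis r" and m: "m = mono_of \<nu> b" by blast
      show ?case
      proof (cases rule: vertex_cases[OF b \<open>i \<in> I n\<close>, case_names out inn none])
        case (out c b')
        then have "x * q = c" using lower(3) by (auto simp: m u_exp_out[OF out] split: if_splits)
        then have "m - A n q i (x * q) = mono_of \<nu> b'" using mono_of_edge[OF out] m by simp
        then show ?thesis using out by (auto simp: edge_def)
      next
        case (inn c b')
        then show ?thesis using lower(3) by (auto simp: m u_exp_in[OF inn] split: if_splits)
      next
        case none
        then show ?thesis using lower(3) u_exp_none[OF b \<open>i \<in> I n\<close> none] by (simp add: m)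
      qed
    next
      case (raise m i x)
      then obtain b where b: "b \<in> column_basis r" and m: "m = mono_of \<nu> b" by blast
      show ?case
      proof (cases rule: vertex_cases[OF b \<open>i \<in> I n\<close>, case_names out inn none])
        case (inn c b')
        then have "x * inverse q = c" using raise(3) by (auto simp: m u_exp_in[OF inn] split: if_splits)
        then have "m + A n q i (x * inverse q) = mono_of \<nu> b'" using mono_of_edge[OF inn, of \<nu>] m by simp
        then show ?thesis using inn by (auto simp: edge_def)
      next
        case (out c b')
        then show ?thesis using raise(3) by (auto simp: m u_exp_out[OF out] split: if_splits)
      next
        case none
        then show ?thesis using raise(3) u_exp_none[OF b \<open>i \<in> I n\<close> none] by (simp add: m)
      qed
    qed
  qed
  let ?P = "\<lambda>b. mono_of \<nu> b \<in> crystal n q (mono_of \<nu> b0)"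
  have "?P b = ?P b'" if e: "edge i c b b'" for i c b b'
  proof
    have i: "i \<in> I n" using e by (auto simp: edge_def)
    have c: "c * inverse q * q = c" "c * q * inverse q = c" by (simp_all add: mult.assoc)
    have u: "u_exp (mono_of \<nu> b) i (c * inverse q) = 1" "u_exp (mono_of \<nu> b') i (c * q) = - 1"
      by (simp_all add: u_exp_out[OF e] u_exp_in[OF e])
    have A: "mono_of \<nu> b - A n q i c = mono_of \<nu> b'" "mono_of \<nu> b' + A n q i c = mono_of \<nu> b"
      using mono_of_edge[OF e, of \<nu>] by simp_all
    show "?P b'" if "?P b" using crystal.lower[OF that i u(1)] unfolding c A .
    show "?P b" if "?P b'" using crystal.raise[OF that i u(2)] unfolding c A .
  qed
  then have "\<forall>b\<in>column_basis r. ?P b"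
    using connected[OF b0, THEN spec[of _ ?P]] crystal.start by blast
  then show "mono_of \<nu> ` column_basis r \<subseteq> crystal n q (mono_of \<nu> b0)" by blast
qed

text \<open>The values on the $h_i$ are the differences of the indicator function of the taken residues. Two
columns of equal weight thus have indicator functions that differ by a constant, and the constant is
at most $0$, since some residue is taken by the second column. So the residues of the first column
are taken by the second one, as \<open>column_determined\<close> requires; the value on $d$ gives the sum of the
quotients.\<close>

lemma tensor_wt_injective:
  assumes js: "js \<in> column_basis r" and js': "js' \<in> column_basis r"
    and wt: "tensor_wt n js = tensor_wt n js'"
  shows "js = js'"
proof (rule column_determined[OF js js'])
  define occ :: "int list \<Rightarrow> int \<Rightarrow> rat"
    where "occ ks x = (if \<exists>s\<le>r. cls n (ks ! s) = cls n x then 1 else 0)" for ks x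
  have count: "(\<Sum>s\<le>r. if cls n (ks ! s) = cls n x then 1 else 0) = occ ks x"
    if "ks \<in> column_basis r" for ks x
  proof (cases "\<exists>p\<le>r. cls n (ks ! p) = cls n x")
    case True
    then obtain p where p: "p \<le> r" "cls n (ks ! p) = cls n x" by blast
    have "(\<Sum>s\<le>r. if cls n (ks ! s) = cls n x then 1 else 0 :: rat)
        = (if cls n (ks ! p) = cls n x then 1 else 0)"
      by (rule sum.one_term[OF p(1)]) (use column_residues_distinct[OF that _ p(1)] p(2) in auto)
    then show ?thesis using p by (auto simp: occ_def)
  next
    case False
    then show ?thesis by (auto simp: occ_def intro: sum.neutral)
  qed
  have lookup: "Poly_Mapping.lookup (tensor_wt n ks) (H (cls n x)) = occ ks x - occ ks (x + 1)"
    if "ks \<in> column_basis r" for ks x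
  proof -
    have "cls n (y - 1) = cls n x \<longleftrightarrow> cls n y = cls n (x + 1)" for y
      using cls_shift_eq_iff(2)[of n y 1 "x + 1"] by simp
    then show ?thesis
      by (simp only: lookup_tensor_wt_H[OF that cls_in_I] sum_subtractf count[OF that])
  qed
  define gap where "gap x = occ js x - occ js' x" for x
  have "gap (x + 1) = gap x" for x
    using lookup[OF js, of x] lookup[OF js', of x] wt by (simp add: gap_def)
  then have "gap x = gap 0" for x
    by (induction x rule: int_induct[where k = 0]) (simp_all, metis diff_add_cancel)
  then have const: "gap x = gap y" for x y by metis
  show "cls n ` set js \<subseteq> cls n ` set js'"
  proof
    fix z assume "z \<in> cls n ` set js"
    then obtain x where x: "x \<in> set js" "z = cls n x" by blast
    then obtain p where "p < length js" "x = js ! p" by (auto simp: in_set_conv_nth)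
    then have "\<exists>s\<le>r. cls n (js ! s) = cls n x" using column_length[OF js] by (intro exI[of _ p]) simp
    then have "occ js x = 1" by (simp add: occ_def)
    moreover have "occ js' (js' ! 0) = 1" by (auto simp: occ_def)
    then have "gap (js' ! 0) \<le> 0" by (simp add: gap_def) (simp add: occ_def)
    then have "gap x \<le> 0" using const[of x "js' ! 0"] by simp
    ultimately have "occ js' x \<ge> 1" by (simp add: gap_def)
    then obtain s where "s \<le> r" "cls n (js' ! s) = cls n x" by (auto simp: occ_def split: if_splits)
    then show "z \<in> cls n ` set js'" using x(2) column_length[OF js'] by (metis Suc_eq_plus1 image_eqI le_imp_less_Suc nth_mem)
  qed
  have "Poly_Mapping.lookup (tensor_wt n ks) D = - of_int (\<Sum>p\<le>r. (ks ! p - 1) div (2 * int r + 2))"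
    if "ks \<in> column_basis r" for ks
  proof -
    have "int n + 1 = 2 * int r + 2" by simp
    then have "Poly_Mapping.lookup (box_wt n x) D = - of_int ((x - 1) div (2 * int r + 2))" for x
      using lookup_box_wt_D[of n x] by (simp only: le_add2)
    then show ?thesis
      unfolding tensor_wt_eq[OF that] lookup_sum by (simp only: sum_negf of_int_sum)
  qed
  from this[OF js] this[OF js'] wt
  show "(\<Sum>p\<le>r. (js ! p - 1) div (2 * int r + 2)) = (\<Sum>p\<le>r. (js' ! p - 1) div (2 * int r + 2))"
    by (metis neg_equal_iff_equal of_int_eq_iff)
qed

lemma inj_mono_of: "inj_on (mono_of \<nu>) (column_basis r)"
  using tensor_wt_injective by (intro inj_onI) (auto simp: mono_of_def)

lemma crystal_x_mono_of:
  assumes b: "b \<in> column_basis r" and i: "i \<in> I n"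
  shows "crystal_x n q \<sigma> i s (mono_of \<nu> b) = lin_ext (\<lambda>b. basis_vec (mono_of \<nu> b)) (X \<sigma> i s b)"
proof -
  interpret EM: edge_module n t "column_basis r" edge X "tensor_phi n q bs" "\<lambda>js. tensor_wt n js + 0"
    by (rule edge_module_column) auto
  show ?thesis
  proof (cases rule: vertex_cases[OF b i, case_names out inn none])
    case (out c b')
    have "\<nexists>c b'. edge i c b' b" using EM.pairing_in EM.pairing_out[OF out] by fastforce
    then have X: "X Pos i s b = 0" "X Neg i s b = c powi s *\<^sub>C basis_vec b'"
      using X_zero_Pos[OF b] X_edge_Neg[OF out] by simp_all
    have ex: "\<exists>x. u_exp (mono_of \<nu> b) i x = 1" "\<not> (\<exists>x. u_exp (mono_of \<nu> b) i x = - 1)"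
      "(THE x. u_exp (mono_of \<nu> b) i x = 1) = c * inverse q"
      by (auto simp: u_exp_out[OF out])
    have c: "c * inverse q * q = c" by (simp add: mult.assoc)
    show ?thesis
      using X ex mono_of_edge[OF out, of \<nu>]
      by (cases \<sigma>) (simp_all only: crystal_x_def sign.case if_True if_False Let_def c lin_ext_scaleC lin_ext_basis_vec lin_ext_zero)
  next
    case (inn c b')
    have "\<nexists>c b'. edge i c b b'" using EM.pairing_in[OF inn] EM.pairing_out by fastforce
    then have X: "X Neg i s b = 0" "X Pos i s b = c powi s *\<^sub>C basis_vec b'"
      using X_zero_Neg[OF b] X_edge_Pos[OF inn] by simp_all
    have ex: "\<exists>x. u_exp (mono_of \<nu> b) i x = - 1" "\<not> (\<exists>x. u_exp (mono_of \<nu> b) i x = 1)"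
      "(THE x. u_exp (mono_of \<nu> b) i x = - 1) = c * q"
      by (auto simp: u_exp_in[OF inn])
    have c: "c * q * inverse q = c" by (simp add: mult.assoc)
    have "mono_of \<nu> b + A n q i c = mono_of \<nu> b'" using mono_of_edge[OF inn, of \<nu>] by simp
    then show ?thesis
      using X ex
      by (cases \<sigma>) (simp_all only: crystal_x_def sign.case if_True if_False Let_def c lin_ext_scaleC lin_ext_basis_vec lin_ext_zero)
  next
    case none
    then have "X Pos i s b = 0" "X Neg i s b = 0" using X_zero_Pos[OF b] X_zero_Neg[OF b] by blast+
    then show ?thesis using u_exp_none[OF b i none] by (cases \<sigma>) (simp_all add: crystal_x_def)
  qed
qed

section \<open>The extremal vector\<close>

text \<open>This is $(1,2,\dots,r+1)$ rotated once: the last entry is lowered by the period and put in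
front. The rotation multiplies the parameters of the monomial by $q^{-2}$ and adds $\delta$ to the
weight.\<close>

definition start :: "int list" where
  "start = map (\<lambda>p. if p = 0 then - int r - 1 else int p) [0..<r + 1]"

lemma length_start: "length start = r + 1"
  by (simp add: start_def)

lemma nth_start: "p \<le> r \<Longrightarrow> start ! p = (if p = 0 then - int r - 1 else int p)"
  unfolding start_def by (subst nth_map) (simp_all del: upt_Suc)

lemma start_column: "start \<in> column_basis r"
  unfolding column_basis_iff
proof (intro conjI allI impI)
  fix p assume "p < r"
  then show "start ! p < start ! (p + 1)" by (simp add: nth_start)
qed (use r in \<open>simp_all add: nth_start length_start\<close>)

lemma box_wt_finite_type:
  assumes "1 \<le> j" "j \<le> int n"
  shows "box_wt n j = \<Lambda> j - \<Lambda> (j - 1)"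
proof (rule poly_mapping_eqI)
  fix x
  have cls: "cls n j = j" "cls n (j - 1) = j - 1" using assms by (simp_all add: cls_def)
  consider (i) i where "x = H i" "i \<in> I n" | (out) "x \<notin> hbasis n" | (D) "x = D"
    by (cases x) (auto simp: hbasis_def)
  then show "Poly_Mapping.lookup (box_wt n j) x = Poly_Mapping.lookup (\<Lambda> j - \<Lambda> (j - 1)) x"
  proof cases
    case i
    then show ?thesis
      using lookup_box_wt_H[of n i j] r cls by (simp add: lookup_minus \<Lambda>_def lookup_single when_def)
  next
    case out
    then have "Poly_Mapping.lookup (box_wt n j) x = 0" using keys_box_wt[of n j] by (auto simp: in_keys_iff)
    moreover have "x \<noteq> H j" "x \<noteq> H (j - 1)" using out assms by (auto simp: hbasis_def I_def)
    ultimately show ?thesis by (simp add: lookup_minus \<Lambda>_def lookup_single when_def)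
  next
    case D
    have "(j - 1) div (int n + 1) = 0" using assms by simp
    then show ?thesis using D lookup_box_wt_D[of n j]
      by (simp add: lookup_minus \<Lambda>_def lookup_single when_def)
  qed
qed

text \<open>The contributions of $1,\dots,r$ telescope, for the weights as well as for the monomials. The
entry $-r-1$ contributes the remaining $Y_{r+1}$, cancels $Y_r$, and is responsible for $\delta$.\<close>

lemma mono_of_start: "mono_of \<nu> start = wt_mono (\<delta> n + \<nu>) + (wt_mono (varpi (int r + 1))
    + Y (int r + 1) (a * q powi (- int r - 2)) - Y 0 (a * q powi (- 1)))"
proof -
  have "tensor_wt n start = (\<Sum>s\<le>r. box_wt n (start ! s))" by (rule tensor_wt_eq[OF start_column])
  also have "\<dots> = box_wt n (start ! 0) + (\<Sum>s<r. box_wt n (start ! Suc s))"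
    by (rule sum.atMost_shift)
  also have "(\<Sum>s<r. box_wt n (start ! Suc s)) = (\<Sum>s<r. \<Lambda> (int (Suc s)) - \<Lambda> (int s))"
  proof (rule sum.cong)
    fix s assume "s \<in> {..<r}"
    then show "box_wt n (start ! Suc s) = \<Lambda> (int (Suc s)) - \<Lambda> (int s)"
      using box_wt_finite_type[of "int (Suc s)"] by (simp add: nth_start)
  qed simp
  also have "\<dots> = \<Lambda> (int r) - \<Lambda> 0" using sum_lessThan_telescope[of "\<lambda>s. \<Lambda> (int s)" r] by simp
  also have "start ! 0 = int r + 1 - (int n + 1)" by (simp add: nth_start)
  also have "box_wt n \<dots> = \<Lambda> (int r + 1) - \<Lambda> (int r) + \<delta> n"
    unfolding box_wt_rotate using box_wt_finite_type[of "int r + 1"] by simp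
  finally have wt: "tensor_wt n start = varpi (int r + 1) + \<delta> n" by (simp add: varpi_def)
  define G where "G s = Poly_Mapping.single (int s, a * q powi (- int s - 1)) (1::int)" for s
  have "(\<Sum>s\<le>r. box_mono s (start ! s)) = box_mono 0 (start ! 0) + (\<Sum>s<r. box_mono (Suc s) (start ! Suc s))"
    by (rule sum.atMost_shift)
  also have "(\<Sum>s<r. box_mono (Suc s) (start ! Suc s)) = (\<Sum>s<r. G (Suc s) - G s)"
  proof (rule sum.cong)
    fix s assume s: "s \<in> {..<r}"
    have "cls n (int (Suc s)) = int (Suc s)" "cls n (int s) = int s" using s by (simp_all add: cls_def)
    moreover have "int (Suc s) - 1 = int s" "int (Suc s) - 2 * int (Suc s) - 1 = - int (Suc s) - 1"
      "int (Suc s) - 2 * int (Suc s) = - int s - 1" "start ! Suc s = int (Suc s)"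
      using s by (simp_all add: nth_start)
    ultimately show "box_mono (Suc s) (start ! Suc s) = G (Suc s) - G s"
      by (simp only: box_mono_def G_def)
  qed simp
  also have "\<dots> = G r - G 0" by (rule sum_lessThan_telescope)
  also have "box_mono 0 (start ! 0) = Poly_Mapping.single (int r + 1, a * q powi (- int r - 2)) 1 - G r"
  proof -
    have "cls n (- int r - 1) = cls n (int r + 1)" "cls n (- int r - 2) = cls n (int r)"
      unfolding cls_eq_iff by (simp_all add: dvd_def) (rule exI[of _ "- 1"], simp)+
    then have cls: "cls n (- int r - 1) = int r + 1" "cls n (- int r - 2) = int r"
      by (simp_all add: cls_def)
    have "start ! 0 = - int r - 1" "- int r - 1 - 1 = - int r - 2"
      "- int r - 1 - 2 * int 0 - 1 = - int r - 2" "- int r - 1 - 2 * int 0 = - int r - 1"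
      by (simp_all add: nth_start)
    then show ?thesis by (simp only: box_mono_def G_def cls)
  qed
  finally show ?thesis
    unfolding mono_of_def wt by (simp add: wt_mono_def Y_def G_def)
qed

end

section \<open>Isomorphism and extremality\<close>

lemma basis_isomorphism:
  assumes inj: "inj_on \<mu> B"
  shows "bij_betw (lin_ext (\<lambda>b. basis_vec (\<mu> b))) (supported_on B) (supported_on (\<mu> ` B))"
proof -
  let ?f = "lin_ext (\<lambda>b. basis_vec (\<mu> b))" and ?g = "lin_ext (\<lambda>m. basis_vec (inv_into B \<mu> m))"
  have "?g (?f v) = v" if "v \<in> supported_on B" for v
  proof (rule linear_map_eqI[of "\<lambda>v. ?g (?f v)" "\<lambda>v. v"])
    fix b assume "b \<in> Poly_Mapping.keys v"
    then have "b \<in> B" using that by (auto simp: supported_on_def)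
    then show "?g (?f (basis_vec b)) = basis_vec b" using inj by simp
  qed (intro linear_map_intros)+
  moreover have "?f (?g w) = w" if "w \<in> supported_on (\<mu> ` B)" for w
  proof (rule linear_map_eqI[of "\<lambda>w. ?f (?g w)" "\<lambda>w. w"])
    fix m assume "m \<in> Poly_Mapping.keys w"
    then have "m \<in> \<mu> ` B" using that by (auto simp: supported_on_def)
    then show "?f (?g (basis_vec m)) = basis_vec m" by (simp add: f_inv_into_f)
  qed (intro linear_map_intros)+
  moreover have "?f v \<in> supported_on (\<mu> ` B)" if "v \<in> supported_on B" for v
    by (rule lin_ext_supported[OF that]) simp
  moreover have "?g w \<in> supported_on B" if "w \<in> supported_on (\<mu> ` B)" for w
    by (rule lin_ext_supported[OF that]) (auto intro: inv_into_into)
  ultimately show ?thesis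
    by (intro bij_betw_byWitness[where f' = ?g]) auto
qed

lemma basis_module_simps:
  "space (basis_module t B X \<Phi> wt) = supported_on B"
  "xop (basis_module t B X \<Phi> wt) \<sigma> i s = lin_ext (X \<sigma> i s)"
  "hop (basis_module t B X \<Phi> wt) i m = diag (\<lambda>b. of_int (sgn m) / (exp t - inverse (exp t))
      * fps_nth (fps_log (\<Phi> (if m > 0 then Pos else Neg) i b)) (nat \<bar>m\<bar>))"
  "kop (basis_module t B X \<Phi> wt) h = diag (\<lambda>b. qpow t (pairing (wt b) h))"
  by (simp_all add: basis_module_def supported_on_def diag_def)

text \<open>Shifting the grading amounts to a shift of the weights of the basis vectors.\<close>

lemma grade_shift_basis_module:
  assumes "\<And>h. pairing \<nu> h = c * pairing (\<delta> n) h"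
  shows "grade_shift n t c (basis_module t B X \<Phi> wt) = basis_module t B X \<Phi> (\<lambda>b. wt b + \<nu>)"
proof -
  have "qpow t (c * pairing (\<delta> n) h) *\<^sub>C kop (basis_module t B X \<Phi> wt) h v
      = kop (basis_module t B X \<Phi> (\<lambda>b. wt b + \<nu>)) h v" for h v
    by (simp add: basis_module_simps scaleC_diag pairing_add_left assms qpow_add mult.commute)
  then have "(\<lambda>h v. qpow t (c * pairing (\<delta> n) h) *\<^sub>C kop (basis_module t B X \<Phi> wt) h v)
      = kop (basis_module t B X \<Phi> (\<lambda>b. wt b + \<nu>))" by blast
  then show ?thesis by (simp add: grade_shift_def basis_module_def)
qed

text \<open>The generators $h_{i,m}$ are computed from \<open>\<Phi>\<close> in the same way on both sides, so
equality of the eigenvalues of $\phi_i$ suffices for them.\<close>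

lemma tor_iso_basis_module:
  assumes inj: "inj_on \<mu> B"
    and X: "\<And>\<sigma> i s b. i \<in> I n \<Longrightarrow> b \<in> B \<Longrightarrow> X' \<sigma> i s (\<mu> b) = lin_ext (\<lambda>b. basis_vec (\<mu> b)) (X \<sigma> i s b)"
    and \<Phi>: "\<And>\<epsilon> i b. i \<in> I n \<Longrightarrow> b \<in> B \<Longrightarrow> \<Phi>' \<epsilon> i (\<mu> b) = \<Phi> \<epsilon> i b"
    and wt: "\<And>b. b \<in> B \<Longrightarrow> wt' (\<mu> b) = wt b"
  shows "tor_iso n (basis_module t B X \<Phi> wt) (basis_module t (\<mu> ` B) X' \<Phi>' wt')"
proof -
  let ?f = "lin_ext (\<lambda>b. basis_vec (\<mu> b))"
  have ext: "F (?f v) = ?f (G v)"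
    if "v \<in> supported_on B" "linear_map F" "linear_map G"
      "\<And>b. b \<in> B \<Longrightarrow> F (basis_vec (\<mu> b)) = ?f (G (basis_vec b))" for F G v
  proof (rule linear_map_eqI[of "\<lambda>v. F (?f v)" "\<lambda>v. ?f (G v)"])
    show "linear_map (\<lambda>v. F (?f v))"
      using that(2) by (simp add: linear_on_def lin_ext_add lin_ext_scaleC)
    show "linear_map (\<lambda>v. ?f (G v))" by (intro linear_map_intros that(3))
    show "F (?f (basis_vec b)) = ?f (G (basis_vec b))" if "b \<in> Poly_Mapping.keys v" for b
      using that \<open>v \<in> supported_on B\<close> \<open>\<And>b. b \<in> B \<Longrightarrow> F (basis_vec (\<mu> b)) = ?f (G (basis_vec b))\<close>
      by (auto simp: supported_on_def)
  qed
  show ?thesis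
    unfolding tor_iso_def basis_module_simps
  proof (intro exI[of _ ?f] conjI ballI allI impI)
    show "linear_on (supported_on B) (supported_on (\<mu> ` B)) ?f"
      using lin_ext_supported[of _ B "\<lambda>b. basis_vec (\<mu> b)" "\<mu> ` B"]
      by (simp add: linear_on_def lin_ext_add lin_ext_scaleC)
    show "bij_betw ?f (supported_on B) (supported_on (\<mu> ` B))" by (rule basis_isomorphism[OF inj])
    fix v assume v: "v \<in> supported_on B"
    show "?f (lin_ext (X \<sigma> i s) v) = lin_ext (X' \<sigma> i s) (?f v)" if "i \<in> I n" for \<sigma> i s
      by (rule ext[OF v linear_map_lin_ext linear_map_lin_ext, symmetric]) (simp add: X that)
    show "?f (diag (\<lambda>b. of_int (sgn m) / (exp t - inverse (exp t))
          * fps_nth (fps_log (\<Phi> (if m > 0 then Pos else Neg) i b)) (nat \<bar>m\<bar>)) v)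
        = diag (\<lambda>b. of_int (sgn m) / (exp t - inverse (exp t))
          * fps_nth (fps_log (\<Phi>' (if m > 0 then Pos else Neg) i b)) (nat \<bar>m\<bar>)) (?f v)" if "i \<in> I n" for i m
      by (rule ext[OF v linear_map_diag linear_map_diag, symmetric]) (simp add: \<Phi> that lin_ext_scaleC)
    show "?f (diag (\<lambda>b. qpow t (pairing (wt b) h)) v) = diag (\<lambda>b. qpow t (pairing (wt' b) h)) (?f v)" for h
      by (rule ext[OF v linear_map_diag linear_map_diag, symmetric]) (simp add: wt lin_ext_scaleC)
  qed
qed

context column
begin

lemma column_module_eq:
  "column_module r t a = basis_module t (column_basis r) X (tensor_phi n q bs) (tensor_wt n)"
  by (simp add: column_module_def X_def[abs_def] bs_def Let_def)

text \<open>The last two claims of the theorem are the cases $\nu = -\delta$ and $\nu = 0$.\<close>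

lemma extremal_shifted:
  assumes \<nu>: "Poly_Mapping.keys \<nu> \<subseteq> hbasis n" "\<And>i. i \<in> I n \<Longrightarrow> Poly_Mapping.lookup \<nu> (H i) = 0"
  shows "extremal_loop_weight_module n t
    (basis_module t (column_basis r) X (tensor_phi n q bs) (\<lambda>js. tensor_wt n js + \<nu>)) (mono_of \<nu> start)"
proof -
  interpret EM: edge_module n t "column_basis r" edge X "tensor_phi n q bs" "\<lambda>js. tensor_wt n js + \<nu>"
    by (rule edge_module_column[OF \<nu>])
  have "extremal_loop_weight_module n t EM.M (mono_of \<nu> start)"
  proof (rule EM.extremal_loop_weight_module_M[OF _ mono_of_in_monomials[OF start_column \<nu>] start_column])
    show "n \<ge> 2" using r by simp
    show "tensor_wt n start + \<nu> = fst (mono_of \<nu> start)" by (simp add: mono_of_def)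
    show "tensor_phi n q bs \<epsilon> i start = mono_phi q \<epsilon> i (mono_of \<nu> start)" if "i \<in> I n" for \<epsilon> i
      by (rule mono_phi_mono_of[OF start_column that, symmetric])
    show "\<forall>P. P start \<longrightarrow> (\<forall>i c b b'. edge i c b b' \<longrightarrow> P b = P b') \<longrightarrow> (\<forall>b\<in>column_basis r. P b)"
      by (rule connected[OF start_column])
  qed (assumption | rule finite_components)+
  then show ?thesis by (simp only: EM.M_def)
qed

end

theorem theorem4p16:
  fixes r n :: nat and a t q :: complex and m :: mono
  assumes "r \<ge> 1" and "n = 2 * r + 1"
    and "q = exp t" and "\<forall>k::nat. k > 0 \<longrightarrow> q ^ k \<noteq> 1"
    and "a \<noteq> 0"
    and "m = wt_mono (varpi (int r + 1)) + Y (int r + 1) (a * q powi (- int r - 2))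
           - Y 0 (a * q powi (-1))"
  shows "tor_iso n (column_module r t a) (grade_shift n t 1 (fundamental_module n t m))
    \<and> extremal_loop_weight_module n t (grade_shift n t (-1) (column_module r t a)) m
    \<and> extremal_loop_weight_module n t (column_module r t a) (wt_mono (\<delta> n) + m)"
proof -
  interpret C: column r t a using assms by unfold_locales auto
  have n: "2 * r + 1 = n" using assms(2) by simp
  have n3: "n \<ge> 3" using assms(1,2) by simp
  have shift_in: "Poly_Mapping.keys (- \<delta> n) \<subseteq> hbasis n"
    "\<And>i. i \<in> I n \<Longrightarrow> Poly_Mapping.lookup (- \<delta> n) (H i) = 0"
    using keys_\<delta>[of n] lookup_\<delta>_H[OF n3] by simp_all
  have pairing: "pairing (- \<delta> n) h = - 1 * pairing (\<delta> n) h" for h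
    using pairing_diff_left[of 0 "\<delta> n" h] by (simp add: pairing_def)
  have m: "m = C.mono_of (- \<delta> n) C.start"
    unfolding C.mono_of_start n using assms(3,6) by (simp add: wt_mono_def zero_prod_def[symmetric])
  have m': "wt_mono (\<delta> n) + m = C.mono_of 0 C.start"
    unfolding C.mono_of_start n using assms(3,6) by simp
  have shifted: "grade_shift n t (- 1) (column_module r t a)
      = basis_module t (column_basis r) C.X (tensor_phi n q C.bs) (\<lambda>js. tensor_wt n js + - \<delta> n)"
    unfolding C.column_module_eq n assms(3) by (rule grade_shift_basis_module) (rule pairing)
  have "extremal_loop_weight_module n t (grade_shift n t (- 1) (column_module r t a)) m"
    using C.extremal_shifted[of "- \<delta> n"] shift_in unfolding shifted m n assms(3) by blast
  moreover have "extremal_loop_weight_module n t (column_module r t a) (wt_mono (\<delta> n) + m)"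
    using C.extremal_shifted[of 0] unfolding C.column_module_eq m' n by simp
  moreover have "tor_iso n (column_module r t a) (grade_shift n t 1 (fundamental_module n t m))"
  proof -
    have "grade_shift n t 1 (fundamental_module n t m)
        = basis_module t (C.mono_of (- \<delta> n) ` column_basis r) (crystal_x n q) (mono_phi q) (\<lambda>m. fst m + \<delta> n)"
      unfolding fundamental_module_def m C.crystal_eq[OF C.start_column, unfolded n] assms(3)
      by (rule grade_shift_basis_module) simp
    moreover have "tor_iso n (column_module r t a)
        (basis_module t (C.mono_of (- \<delta> n) ` column_basis r) (crystal_x n q) (mono_phi q) (\<lambda>m. fst m + \<delta> n))"
      unfolding C.column_module_eq n assms(3)
    proof (rule tor_iso_basis_module[OF C.inj_mono_of])
      show "crystal_x n (exp t) \<sigma> i s (C.mono_of (- \<delta> n) b)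
          = lin_ext (\<lambda>b. basis_vec (C.mono_of (- \<delta> n) b)) (C.X \<sigma> i s b)"
        if "i \<in> I n" "b \<in> column_basis r" for \<sigma> i s b
        using C.crystal_x_mono_of[of b i \<sigma> s "- \<delta> n"] that unfolding n by blast
      show "mono_phi (exp t) \<epsilon> i (C.mono_of (- \<delta> n) b) = tensor_phi n (exp t) C.bs \<epsilon> i b"
        if "i \<in> I n" "b \<in> column_basis r" for \<epsilon> i b
        using C.mono_phi_mono_of[of b i \<epsilon> "- \<delta> n"] that unfolding n by blast
      show "fst (C.mono_of (- \<delta> n) b) + \<delta> n = tensor_wt n b" for b
        unfolding C.mono_of_def n by simp
    qed
    ultimately show ?thesis by simp
  qed
  ultimately show ?thesis by blast
qed

end
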